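(* Let $V$ be a space of quasi-polynomials with the data $(\bar z,\bar\lambda;\bar\alpha,\bar\mu)$, and let $W=\mathfrak{T}_1(\mathfrak{T}_3(V))$, which is a space of quasi-exponentials with the difference data $(\bar\alpha,\bar\mu';1-\bar z-\bar\lambda'_1,\bar\lambda')$, where $1-\bar z-\bar\lambda_1'=\big(1-z_a-(\lambda^{(a)})'_1\big)_{a=1}^k$. Let $\mathcal{S}_V$ and $\mathcal{S}_W$ be the fundamental pseudo-difference operators of $V$ and $W$, respectively. Then $$\mathcal{S}_W=\mathcal{S}_V^{-1}.$$
   Context: Partitions are infinite nonincreasing sequences of nonnegative integers stabilizing at zero; $\lambda'$ is the conjugate, $\lambda'_i=\#\{j:\lambda_j\ge i\}$; $|\lambda|=\sum\lambda_i$. Fix a branch of $\ln$, $\alpha^x=e^{x\ln\alpha}$. $(Tf)(x)=f(x+1)$. Discrete Wronskian: $\mathcal{W}(g_1,\dots,g_m)=\det\big((T^{j-1}g_i)_{i,j=1}^m\big)$. Data: $\bar z=(z_1,\dots,z_k)$ complex numbers with $z_a-z_b\notin\mathbb{Z}$ ($a\ne b$); $\bar\alpha=(\alpha_1,\dots,\alpha_n)$ pairwise distinct nonzero complex numbers; $\bar\lambda=(\lambda^{(a)})_{a=1}^k$, $\bar\mu=(\mu^{(i)})_{i=1}^n$ sequences of nonzero partitions. $L'=\sum_a(\lambda^{(a)})'_1$, $M'=\sum_i(\mu^{(i)})'_1$, $M=\sum_i\mu^{(i)}_1$, $n_{ab}=(\lambda^{(a)})'_1+\lambda^{(a)}_b-b$,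 $$p_{\bar\alpha,\bar\mu}(x)=\prod_{i=1}^n(x-\alpha_i)^{(\mu^{(i)})'_1},\qquad q_{\bar z,\bar\lambda}(x)=\prod_{a=1}^k\prod_{b=1}^{(\lambda^{(a)})'_1}(x-z_a-n_{ab}).$$ Space of quasi-polynomials with the data $(\bar z,\bar\lambda;\bar\alpha,\bar\mu)$: a space $V$ of functions with a basis $\{x^{z_a}q_{ab}(x):1\le a\le k,\ 1\le b\le(\lambda^{(a)})'_1\}$, $q_{ab}$ polynomials with $\deg q_{ab}=n_{ab}$, such that (i) for each $a$ and $b=1,\dots,(\lambda^{(a)})'_1$ some linear combination of $q_{a1},q_{a2},\dots$ has a root at $0$ of multiplicity exactly $b-1$; (ii) $\alpha_1,\dots,\alpha_n$ are precisely the points $\alpha\in\mathbb{C}^*$ where the sequence of exponents of $V$ differs from $(L'-1,\dots,0)$, and at $\alpha_i$ the exponents are $L'+\mu^{(i)}_a-a$, $a=1,\dots,L'$, with $\mu^{(i)}_a=0$ for $a>L'$. (Exponents at $\alpha$: the integers $e_1>\dots>e_{L'}$ such that $V$ has a basis $f_a=(x-\alpha)^{e_a}(1+o(1))$, $x\to\alpha$.) $D_V$ is the monic linear differential operator of order $L'$ annihilating $V$; $\bar D_V=p_{\bar\alpha,\bar\mu}(x)\,x^{L'}D_V$. It is known that $\bar D_V=\sum_{i=0}^{M'}\sum_{a=0}^{L'}A_{ia}x^i\left(x\frac{d}{dx}\right)^a$ with constants $A_{ia}$. Spaces of quasi-exponentials: $\mathcal{E}(\bar\alpha,\bar\mu)$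 is the set of spaces with a basis $\{\alpha_i^xq_{ij}(x):1\le i\le n,\ 1\le j\le(\mu^{(i)})'_1\}$, $q_{ij}$ polynomials with $\deg q_{ij}=(\mu^{(i)})'_1+\mu^{(i)}_j-j$. Such a space $U$ has dimension $M'$, and $S_U$ denotes the unique monic difference operator $T^{M'}+\sum_{i=1}^{M'}b_i(x)T^{M'-i}$ annihilating it; its coefficients are rational functions regular at infinity. The sequence of discrete exponents of $U$ at $z$ is the sequence of integers $e_1>\dots>e_{M'}$ such that $U$ has a basis $\psi_i$ with $(T^j\psi_i)(z)=0$ for $0\le j<e_i$, $(T^{e_i}\psi_i)(z)\neq0$. $U\in\mathcal{E}(\bar\alpha,\bar\mu)$ has the difference data $(\bar\alpha,\bar\mu;\bar z,\bar\lambda)$ if for each $a$ the discrete exponents of $U$ at $z_a$ are $M'+\lambda^{(a)}_i-i$, $i=1,\dots,M'$, with $\lambda^{(a)}_i=0$ for $i>M'$, and $\sum_a|\lambda^{(a)}|=\sum_i|\mu^{(i)}|$. $\mathfrak{T}_3$ (bispectral duality; a known bijection from spaces of quasi-polynomials with the data $(\bar z,\bar\lambda;\bar\alpha,\bar\mu)$ to spaces of quasi-exponentials with the difference data $(\bar\alpha,\bar\mu;\bar z+\bar\lambda'_1,\bar\lambda)$, where $\bar z+\bar\lambda'_1=(z_a+(\lambda^{(a)})'_1)_a$): $\mathfrak{T}_3(V)$ is the unique such space $U$ with $q_{\bar z,\bar\lambda}(x)S_U=\sum_{i,a}A_{ia}x^aT^i$. $\mathfrak{T}_1$: for $U\in\mathcal{E}(\bar\alpha,\bar\mu)$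 let $\widehat U$ be the span of $\alpha_i^xx^p$, $1\le i\le n$, $0\le p\le\mu^{(i)}_1+(\mu^{(i)})'_1-1$. Choose a basis $f_1,\dots,f_{M'}$ of $U$ and complete it by $h_1,\dots,h_M$ to a basis of $\widehat U$. $Q(U)$ is the span of $\phi_a=T\left(\frac{\mathcal{W}(f_1,\dots,f_{M'},h_1,\dots,\widehat{h_a},\dots,h_M)}{\mathcal{W}(f_1,\dots,f_{M'},h_1,\dots,h_M)}\right)$, $a=1,\dots,M$ ($\widehat{h_a}$ omitted), and $\mathfrak{T}_1(U)=\{f(-x):f\in Q(U)\}\in\mathcal{E}(\bar\alpha,\bar\mu')$. Pseudo-difference operators: formal series $\sum_{m=-\infty}^{N}\sum_{l=-\infty}^{K}C_{lm}x^lT^m$, $C_{lm}\in\mathbb{C}$, multiplied using $T^mx^l=(x+m)^lT^m$ with $(x+m)^l$ expanded as a Laurent series at $x=\infty$; they form an associative algebra. Difference operators with rational coefficients are viewed as elements by expanding the coefficients at $x=\infty$. Put $\tau(\bar D_V)=\sum_{i,a}A_{ia}T^i(-x)^a$. The fundamental pseudo-difference operators are $$\mathcal{S}_V=\big(p_{\bar\alpha,\bar\mu}(T)\big)^{-1}\,\tau(\bar D_V)\,\big(q_{\bar z,\bar\lambda}(-x)\big)^{-1},\qquad \mathcal{S}_W=S_W\,\big(p_{\bar\alpha,\bar\mu'}(T)\big)^{-1}$$ (for $W\in\mathcal{E}(\bar\alpha,\bar\mu')$); all inverses are taken in the algebra of pseudo-difference operators and exist there. *)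

theory Defs
  imports
    "HOL-Analysis.Analysis"
    "HOL-Computational_Algebra.Computational_Algebra"
    "HOL-Computational_Algebra.Field_as_Ring"
    "HOL-Library.Function_Algebras"
    "Jordan_Normal_Form.Determinant"
begin

section \<open>Partitions\<close>

text \<open>
  Partitions are indexed from 1, as are all families (the points, the partitions, the bases)
  below; the value of a partition at 0 is irrelevant.
\<close>

definition is_partition :: "(nat \<Rightarrow> nat) \<Rightarrow> bool" where
  "is_partition p \<longleftrightarrow> (\<forall>i\<ge>1. p (Suc i) \<le> p i) \<and> (\<exists>N. \<forall>i\<ge>N. p i = 0)"

definition nonzero_partition :: "(nat \<Rightarrow> nat) \<Rightarrow> bool" where
  "nonzero_partition p \<longleftrightarrow> is_partition p \<and> (\<exists>i\<ge>1. p i \<noteq> 0)"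

definition conj_part :: "(nat \<Rightarrow> nat) \<Rightarrow> nat \<Rightarrow> nat" where
  "conj_part p i = card {j. 1 \<le> j \<and> i \<le> p j}"

definition part_size :: "(nat \<Rightarrow> nat) \<Rightarrow> nat" where
  "part_size p = (\<Sum>i | 1 \<le> i \<and> p i \<noteq> 0. p i)"

text \<open>The number \<open>L'\<close> (resp. \<open>M'\<close>) for the sequence of the first \<open>k\<close> members of \<open>lam\<close>.\<close>

definition total_length :: "nat \<Rightarrow> (nat \<Rightarrow> nat \<Rightarrow> nat) \<Rightarrow> nat" where
  "total_length k lam = (\<Sum>a=1..k. conj_part (lam a) 1)"

definition partition_degree :: "(nat \<Rightarrow> nat) \<Rightarrow> nat \<Rightarrow> nat" where
  "partition_degree p b = conj_part p 1 + p b - b"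

definition p_poly :: "nat \<Rightarrow> (nat \<Rightarrow> complex) \<Rightarrow> (nat \<Rightarrow> nat \<Rightarrow> nat) \<Rightarrow> complex poly" where
  "p_poly n \<alpha> \<mu> = (\<Prod>i=1..n. [:- \<alpha> i, 1:] ^ conj_part (\<mu> i) 1)"

definition q_poly :: "nat \<Rightarrow> (nat \<Rightarrow> complex) \<Rightarrow> (nat \<Rightarrow> nat \<Rightarrow> nat) \<Rightarrow> complex poly" where
  "q_poly k z lam =
     (\<Prod>a=1..k. \<Prod>b=1..conj_part (lam a) 1. [:- (z a + of_nat (partition_degree (lam a) b)), 1:])"

definition admissible_data ::
  "nat \<Rightarrow> (nat \<Rightarrow> complex) \<Rightarrow> (nat \<Rightarrow> nat \<Rightarrow> nat) \<Rightarrow>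
   nat \<Rightarrow> (nat \<Rightarrow> complex) \<Rightarrow> (nat \<Rightarrow> nat \<Rightarrow> nat) \<Rightarrow> bool" where
  "admissible_data k z lam n \<alpha> \<mu> \<longleftrightarrow>
     (\<forall>a\<in>{1..k}. \<forall>b\<in>{1..k}. a \<noteq> b \<longrightarrow> z a - z b \<notin> \<int>) \<and>
     inj_on \<alpha> {1..n} \<and> (\<forall>i\<in>{1..n}. \<alpha> i \<noteq> 0) \<and>
     (\<forall>a\<in>{1..k}. nonzero_partition (lam a)) \<and>
     (\<forall>i\<in>{1..n}. nonzero_partition (\<mu> i))"


section \<open>Spaces of functions\<close>

interpretation cfun: vector_space "\<lambda>c (f :: complex \<Rightarrow> complex) x. c * f x"
  by unfold_locales (auto simp: fun_eq_iff algebra_simps)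

definition basis_family ::
  "(complex \<Rightarrow> complex) set \<Rightarrow> 'i set \<Rightarrow> ('i \<Rightarrow> complex \<Rightarrow> complex) \<Rightarrow> bool" where
  "basis_family V I f \<longleftrightarrow> inj_on f I \<and> \<not> cfun.dependent (f ` I) \<and> cfun.span (f ` I) = V"


section \<open>Operators with rational coefficients\<close>

definition rat_regular :: "complex poly fract \<Rightarrow> complex \<Rightarrow> bool" where
  "rat_regular r x \<longleftrightarrow> poly (snd (quot_of_fract r)) x \<noteq> 0"

definition rat_eval :: "complex poly fract \<Rightarrow> complex \<Rightarrow> complex" where
  "rat_eval r x = poly (fst (quot_of_fract r)) x / poly (snd (quot_of_fract r)) x"

text \<open>
  A difference operator \<open>\<Sum>\<^sub>i r\<^sub>i(x) T\<^sup>i\<close> or a differential operator \<open>\<Sum>\<^sub>i r\<^sub>i(x) (d/dx)\<^sup>i\<close> with rational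
  coefficients is given by the polynomial in \<open>T\<close> or \<open>d/dx\<close> with the coefficients \<open>r\<^sub>i\<close> on the
  left. Of the structure of the polynomial type only the degree, the coefficients and
  the multiplication by a rational function from the left (\<^const>\<open>Polynomial.smult\<close>) make sense
  for operators; in particular its commutative product is never used for them.
\<close>

type_synonym rat_op = "complex poly fract poly"

definition op_regular :: "rat_op \<Rightarrow> complex \<Rightarrow> bool" where
  "op_regular D x \<longleftrightarrow> (\<forall>i. rat_regular (coeff D i) x)"

definition diffop_apply :: "rat_op \<Rightarrow> (complex \<Rightarrow> complex) \<Rightarrow> complex \<Rightarrow> complex" where
  "diffop_apply S f x = (\<Sum>i\<le>degree S. rat_eval (coeff S i) x * f (x + of_nat i))"

text \<open>
  A multivalued function of \<open>x\<close> in the punctured plane is represented by a function of \<open>t = ln x\<close>,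
  i.e. on the universal cover \<open>t \<mapsto> x = exp t\<close>. In this coordinate \<open>d/dx = exp (-t) d/dt\<close> and
  \<open>x d/dx = d/dt\<close>.
\<close>

definition ddx :: "(complex \<Rightarrow> complex) \<Rightarrow> complex \<Rightarrow> complex" where
  "ddx F t = exp (- t) * deriv F t"

definition dop_apply :: "rat_op \<Rightarrow> (complex \<Rightarrow> complex) \<Rightarrow> complex \<Rightarrow> complex" where
  "dop_apply D F t = (\<Sum>j\<le>degree D. rat_eval (coeff D j) (exp t) * (ddx ^^ j) F t)"


section \<open>Spaces of quasi-polynomials\<close>

text \<open>The function \<open>x\<^sup>z q(x)\<close>, in the coordinate \<open>t = ln x\<close>.\<close>

definition quasi_poly :: "complex \<Rightarrow> complex poly \<Rightarrow> complex \<Rightarrow> complex" where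
  "quasi_poly z q t = exp (z * t) * poly q (exp t)"

text \<open>
  The exponents are computed at the point \<open>Ln \<alpha>\<close> of the cover over \<open>\<alpha>\<close>. Any other point over \<open>\<alpha>\<close>
  gives the same exponents for the spaces considered here, since the shift
  \<open>t \<mapsto> t + 2 \<pi> i\<close> multiplies \<open>x\<^sup>z q(x)\<close> by a constant.
\<close>

definition exponents_at ::
  "(complex \<Rightarrow> complex) set \<Rightarrow> nat \<Rightarrow> complex \<Rightarrow> (nat \<Rightarrow> int) \<Rightarrow> bool" where
  "exponents_at V d \<alpha> e \<longleftrightarrow>
     (\<forall>a\<in>{1..d}. \<forall>b\<in>{1..d}. a < b \<longrightarrow> e b < e a) \<and>
     (\<exists>f. basis_family V {1..d} f \<and>
        (\<forall>a\<in>{1..d}. ((\<lambda>t. f a t / (exp t - \<alpha>) powi e a) \<longlongrightarrow> 1) (at (Ln \<alpha>))))"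

definition quasi_polynomial_space ::
  "nat \<Rightarrow> (nat \<Rightarrow> complex) \<Rightarrow> (nat \<Rightarrow> nat \<Rightarrow> nat) \<Rightarrow>
   nat \<Rightarrow> (nat \<Rightarrow> complex) \<Rightarrow> (nat \<Rightarrow> nat \<Rightarrow> nat) \<Rightarrow> (complex \<Rightarrow> complex) set \<Rightarrow> bool" where
  "quasi_polynomial_space k z lam n \<alpha> \<mu> V \<longleftrightarrow>
     (let L' = total_length k lam in
      (\<exists>q. basis_family V (SIGMA a:{1..k}. {1..conj_part (lam a) 1})
             (\<lambda>(a, b). quasi_poly (z a) (q a b)) \<and>
         (\<forall>a\<in>{1..k}. \<forall>b\<in>{1..conj_part (lam a) 1}.
            degree (q a b) = partition_degree (lam a) b) \<and>
         (\<forall>a\<in>{1..k}. \<forall>b\<in>{1..conj_part (lam a) 1}.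
            \<exists>c. let r = (\<Sum>j=1..conj_part (lam a) 1. Polynomial.smult (c j) (q a j))
                in r \<noteq> 0 \<and> Polynomial.order 0 r = b - 1)) \<and>
      (\<forall>x. x \<noteq> 0 \<longrightarrow>
         (x \<in> \<alpha> ` {1..n} \<longleftrightarrow> \<not> exponents_at V L' x (\<lambda>a. int L' - int a))) \<and>
      (\<forall>i\<in>{1..n}.
         exponents_at V L' (\<alpha> i) (\<lambda>a. int L' + int (\<mu> i a) - int a) \<and>
         (\<forall>a>L'. \<mu> i a = 0)))"

definition is_monic_dop :: "(complex \<Rightarrow> complex) set \<Rightarrow> nat \<Rightarrow> rat_op \<Rightarrow> bool" where
  "is_monic_dop V d D \<longleftrightarrow>
     degree D = d \<and> lead_coeff D = 1 \<and>
     (\<forall>F\<in>V. \<forall>t. op_regular D (exp t) \<longrightarrow> dop_apply D F t = 0)"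

text \<open>
  The numbers \<open>A i a\<close> are the coefficients of \<open>p(x) x\<^sup>d D = \<Sum>\<^sub>i\<^sub>,\<^sub>a A\<^sub>i\<^sub>a x\<^sup>i (x d/dx)\<^sup>a\<close>, where \<open>D\<close> is
  the monic differential operator of order \<open>d\<close> annihilating \<open>V\<close>. Equality of
  differential operators means that they act in the same way on all functions
  holomorphic on the cover.
\<close>

definition bar_D_coeffs ::
  "(complex \<Rightarrow> complex) set \<Rightarrow> complex poly \<Rightarrow> nat \<Rightarrow> nat \<Rightarrow> (nat \<Rightarrow> nat \<Rightarrow> complex) \<Rightarrow> bool" where
  "bar_D_coeffs V p m d A \<longleftrightarrow>
     (\<exists>D. is_monic_dop V d D \<and>
        (\<forall>F t. F holomorphic_on UNIV \<longrightarrow> op_regular D (exp t) \<longrightarrow>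
           poly p (exp t) * exp t ^ d * dop_apply D F t =
           (\<Sum>i\<le>m. \<Sum>a\<le>d. A i a * exp t ^ i * (deriv ^^ a) F t)))"


section \<open>Spaces of quasi-exponentials\<close>

text \<open>Only the values of the branch at the finitely many bases \<open>\<alpha>\<^sub>i\<close> are used.\<close>

definition ln_branch :: "(complex \<Rightarrow> complex) \<Rightarrow> bool" where
  "ln_branch l \<longleftrightarrow> (\<forall>x. x \<noteq> 0 \<longrightarrow> exp (l x) = x)"

definition quasi_exp :: "(complex \<Rightarrow> complex) \<Rightarrow> complex \<Rightarrow> complex poly \<Rightarrow> complex \<Rightarrow> complex" where
  "quasi_exp l \<alpha> q x = exp (x * l \<alpha>) * poly q x"

definition quasi_exponential_space ::
  "(complex \<Rightarrow> complex) \<Rightarrow> nat \<Rightarrow> (nat \<Rightarrow> complex) \<Rightarrow> (nat \<Rightarrow> nat \<Rightarrow> nat) \<Rightarrow>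
   (complex \<Rightarrow> complex) set \<Rightarrow> bool" where
  "quasi_exponential_space l n \<alpha> \<mu> U \<longleftrightarrow>
     (\<exists>q. basis_family U (SIGMA i:{1..n}. {1..conj_part (\<mu> i) 1})
            (\<lambda>(i, j). quasi_exp l (\<alpha> i) (q i j)) \<and>
        (\<forall>i\<in>{1..n}. \<forall>j\<in>{1..conj_part (\<mu> i) 1}.
           degree (q i j) = partition_degree (\<mu> i) j))"

definition is_fund_diffop :: "(complex \<Rightarrow> complex) set \<Rightarrow> rat_op \<Rightarrow> bool" where
  "is_fund_diffop U S \<longleftrightarrow>
     degree S = cfun.dim U \<and> lead_coeff S = 1 \<and>
     (\<forall>f\<in>U. \<forall>x. op_regular S x \<longrightarrow> diffop_apply S f x = 0)"

definition fund_diffop :: "(complex \<Rightarrow> complex) set \<Rightarrow> rat_op" where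
  "fund_diffop U = (THE S. is_fund_diffop U S)"

definition discrete_exponents ::
  "(complex \<Rightarrow> complex) set \<Rightarrow> nat \<Rightarrow> complex \<Rightarrow> (nat \<Rightarrow> nat) \<Rightarrow> bool" where
  "discrete_exponents U d w e \<longleftrightarrow>
     (\<forall>i\<in>{1..d}. \<forall>j\<in>{1..d}. i < j \<longrightarrow> e j < e i) \<and>
     (\<exists>\<psi>. basis_family U {1..d} \<psi> \<and>
        (\<forall>i\<in>{1..d}. (\<forall>j<e i. \<psi> i (w + of_nat j) = 0) \<and> \<psi> i (w + of_nat (e i)) \<noteq> 0))"

definition has_difference_data ::
  "(complex \<Rightarrow> complex) \<Rightarrow> nat \<Rightarrow> (nat \<Rightarrow> complex) \<Rightarrow> (nat \<Rightarrow> nat \<Rightarrow> nat) \<Rightarrow>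
   nat \<Rightarrow> (nat \<Rightarrow> complex) \<Rightarrow> (nat \<Rightarrow> nat \<Rightarrow> nat) \<Rightarrow> (complex \<Rightarrow> complex) set \<Rightarrow> bool" where
  "has_difference_data l n \<alpha> \<mu> k z lam U \<longleftrightarrow>
     (let M' = total_length n \<mu> in
      quasi_exponential_space l n \<alpha> \<mu> U \<and>
      (\<forall>a\<in>{1..k}.
         discrete_exponents U M' (z a) (\<lambda>i. M' + lam a i - i) \<and>
         (\<forall>i>M'. lam a i = 0)) \<and>
      (\<Sum>a=1..k. part_size (lam a)) = (\<Sum>i=1..n. part_size (\<mu> i)))"


section \<open>The maps\<close>

text \<open>
  \<open>bispectral_dual \<dots> A U\<close> says that \<open>U\<close> is the image under bispectral duality of the space of
  quasi-polynomials \<open>V\<close> with the data \<open>(z, lam; \<alpha>, \<mu>)\<close> whose operator \<open>\<Sum>\<^sub>i\<^sub>,\<^sub>a A\<^sub>i\<^sub>a x\<^sup>i (x d/dx)\<^sup>a\<close> is as in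
  \<^const>\<open>bar_D_coeffs\<close>. The image depends on \<open>V\<close> only through these coefficients.
\<close>

definition bispectral_dual ::
  "(complex \<Rightarrow> complex) \<Rightarrow> nat \<Rightarrow> (nat \<Rightarrow> complex) \<Rightarrow> (nat \<Rightarrow> nat \<Rightarrow> nat) \<Rightarrow>
   nat \<Rightarrow> (nat \<Rightarrow> complex) \<Rightarrow> (nat \<Rightarrow> nat \<Rightarrow> nat) \<Rightarrow> (nat \<Rightarrow> nat \<Rightarrow> complex) \<Rightarrow>
   (complex \<Rightarrow> complex) set \<Rightarrow> bool" where
  "bispectral_dual l k z lam n \<alpha> \<mu> A U \<longleftrightarrow>
     has_difference_data l n \<alpha> \<mu> k (\<lambda>a. z a + of_nat (conj_part (lam a) 1)) lam U \<and>
     (\<exists>S. is_fund_diffop U S \<and>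
        Polynomial.smult (to_fract (q_poly k z lam)) S =
        (\<Sum>i\<le>total_length n \<mu>. \<Sum>a\<le>total_length k lam.
           Polynomial.monom (to_fract (Polynomial.monom (A i a) a)) i))"

definition discrete_wronskian :: "(complex \<Rightarrow> complex) list \<Rightarrow> complex \<Rightarrow> complex" where
  "discrete_wronskian gs x =
     Determinant.det (Matrix.mat (length gs) (length gs) (\<lambda>(i, j). (gs ! i) (x + of_nat j)))"

definition hat_space ::
  "(complex \<Rightarrow> complex) \<Rightarrow> nat \<Rightarrow> (nat \<Rightarrow> complex) \<Rightarrow> (nat \<Rightarrow> nat \<Rightarrow> nat) \<Rightarrow>
   (complex \<Rightarrow> complex) set" where
  "hat_space l n \<alpha> \<mu> =
     cfun.span {quasi_exp l (\<alpha> i) (Polynomial.monom 1 p) | i p.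
       i \<in> {1..n} \<and> p < \<mu> i 1 + conj_part (\<mu> i) 1}"

text \<open>
  \<open>quotient_dual \<dots> U W\<close> says that \<open>W\<close> is obtained from \<open>U\<close> by some choice of the bases (it does
  not depend on the choice). The functions \<open>hs\<close> are numbered from 0 here.
\<close>

definition quotient_dual ::
  "(complex \<Rightarrow> complex) \<Rightarrow> nat \<Rightarrow> (nat \<Rightarrow> complex) \<Rightarrow> (nat \<Rightarrow> nat \<Rightarrow> nat) \<Rightarrow>
   (complex \<Rightarrow> complex) set \<Rightarrow> (complex \<Rightarrow> complex) set \<Rightarrow> bool" where
  "quotient_dual l n \<alpha> \<mu> U W \<longleftrightarrow>
     (\<exists>fs hs.
        basis_family U {..<length fs} (\<lambda>i. fs ! i) \<and>
        basis_family (hat_space l n \<alpha> \<mu>) {..<length (fs @ hs)} (\<lambda>i. (fs @ hs) ! i) \<and>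
        (let \<phi> = (\<lambda>a x. discrete_wronskian (fs @ take a hs @ drop (Suc a) hs) (x + 1) /
                        discrete_wronskian (fs @ hs) (x + 1));
             Q = cfun.span (\<phi> ` {..<length hs})
         in W = {\<lambda>x. f (- x) | f. f \<in> Q}))"


section \<open>Pseudo-difference operators\<close>

text \<open>\<open>pdo_coeff P l m\<close> is the coefficient of \<open>x\<^sup>l T\<^sup>m\<close> in \<open>P\<close>.\<close>

typedef pdo =
  "{C :: int \<Rightarrow> int \<Rightarrow> complex. \<exists>K N. \<forall>l m. C l m \<noteq> 0 \<longrightarrow> l \<le> K \<and> m \<le> N}"
  morphisms pdo_coeff Abs_pdo
  by (rule exI[of _ "\<lambda>_ _. 0"]) auto

setup_lifting type_definition_pdo

instantiation pdo :: ab_group_add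
begin

lift_definition zero_pdo :: pdo is "\<lambda>_ _. 0" by simp

lift_definition plus_pdo :: "pdo \<Rightarrow> pdo \<Rightarrow> pdo" is "\<lambda>C D l m. C l m + D l m"
proof -
  fix C D :: "int \<Rightarrow> int \<Rightarrow> complex"
  assume "\<exists>K N. \<forall>l m. C l m \<noteq> 0 \<longrightarrow> l \<le> K \<and> m \<le> N"
  then obtain K N where 1: "\<And>l m. C l m \<noteq> 0 \<Longrightarrow> l \<le> K \<and> m \<le> N" by blast
  assume "\<exists>K N. \<forall>l m. D l m \<noteq> 0 \<longrightarrow> l \<le> K \<and> m \<le> N"
  then obtain K' N' where 2: "\<And>l m. D l m \<noteq> 0 \<Longrightarrow> l \<le> K' \<and> m \<le> N'" by blast
  show "\<exists>K N. \<forall>l m. C l m + D l m \<noteq> 0 \<longrightarrow> l \<le> K \<and> m \<le> N"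
  proof (intro exI allI impI)
    fix l m assume "C l m + D l m \<noteq> 0"
    then have "C l m \<noteq> 0 \<or> D l m \<noteq> 0" by auto
    with 1[of l m] 2[of l m] show "l \<le> max K K' \<and> m \<le> max N N'" by auto
  qed
qed

lift_definition uminus_pdo :: "pdo \<Rightarrow> pdo" is "\<lambda>C l m. - C l m" by simp

definition minus_pdo :: "pdo \<Rightarrow> pdo \<Rightarrow> pdo" where "minus_pdo P Q = P + - Q"

instance
  by standard (unfold minus_pdo_def, (transfer, simp add: fun_eq_iff)+)

end

text \<open>
  The product is determined by
  \<open>(x\<^sup>l T\<^sup>m) (x\<^sup>l\<^sup>' T\<^sup>m\<^sup>') = x\<^sup>l (x + m)\<^sup>l\<^sup>' T\<^sup>m\<^sup>+\<^sup>m\<^sup>' = \<Sum>\<^sub>j (l' gchoose j) m\<^sup>j x\<^sup>l\<^sup>+\<^sup>l\<^sup>'\<^sup>-\<^sup>j T\<^sup>m\<^sup>+\<^sup>m\<^sup>'\<close>.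
  The index set of the sum below is finite, see \<open>pdo_times_finite\<close>.
\<close>

lemma pdo_times_finite:
  fixes C D :: "int \<Rightarrow> int \<Rightarrow> complex"
  assumes "\<And>l m. C l m \<noteq> 0 \<Longrightarrow> l \<le> K \<and> m \<le> N" and "\<And>l m. D l m \<noteq> 0 \<Longrightarrow> l \<le> K' \<and> m \<le> N'"
  shows "finite {(l, l', m). C l m \<noteq> 0 \<and> D l' (s - m) \<noteq> 0 \<and> r \<le> l + l'}"
proof (rule finite_subset)
  show "{(l, l', m). C l m \<noteq> 0 \<and> D l' (s - m) \<noteq> 0 \<and> r \<le> l + l'}
          \<subseteq> {r - K'..K} \<times> {r - K..K'} \<times> {s - N'..N}"
    using assms by force
qed simp

instantiation pdo :: "{one, times}"
begin

lift_definition one_pdo :: pdo is "\<lambda>l m. if l = 0 \<and> m = 0 then 1 else 0"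
  by (intro exI[of _ 0]) auto

lift_definition times_pdo :: "pdo \<Rightarrow> pdo \<Rightarrow> pdo" is
  "\<lambda>C D r s. \<Sum>(l, l', m) \<in> {(l, l', m). C l m \<noteq> 0 \<and> D l' (s - m) \<noteq> 0 \<and> r \<le> l + l'}.
     C l m * D l' (s - m) * (of_int l' gchoose nat (l + l' - r)) * of_int m ^ nat (l + l' - r)"
proof -
  fix C D :: "int \<Rightarrow> int \<Rightarrow> complex"
  assume "\<exists>K N. \<forall>l m. C l m \<noteq> 0 \<longrightarrow> l \<le> K \<and> m \<le> N"
  then obtain K N where 1: "\<And>l m. C l m \<noteq> 0 \<Longrightarrow> l \<le> K \<and> m \<le> N" by blast
  assume "\<exists>K N. \<forall>l m. D l m \<noteq> 0 \<longrightarrow> l \<le> K \<and> m \<le> N"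
  then obtain K' N' where 2: "\<And>l m. D l m \<noteq> 0 \<Longrightarrow> l \<le> K' \<and> m \<le> N'" by blast
  let ?I = "\<lambda>r s. {(l, l', m). C l m \<noteq> 0 \<and> D l' (s - m) \<noteq> 0 \<and> r \<le> l + l'}"
  let ?t = "\<lambda>r s (l, l', m). C l m * D l' (s - m) * (of_int l' gchoose nat (l + l' - r)) *
              of_int m ^ nat (l + l' - r)"
  show "\<exists>K N. \<forall>r s. sum (?t r s) (?I r s) \<noteq> 0 \<longrightarrow> r \<le> K \<and> s \<le> N"
  proof (intro exI allI impI)
    fix r s assume "sum (?t r s) (?I r s) \<noteq> 0"
    then have "?I r s \<noteq> {}" by fastforce
    then obtain l l' m where *: "C l m \<noteq> 0" "D l' (s - m) \<noteq> 0" "r \<le> l + l'" by blast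
    with 1[OF *(1)] 2[OF *(2)] show "r \<le> K + K' \<and> s \<le> N + N'" by auto
  qed
qed

instance ..

end

lift_definition pdo_monom :: "complex \<Rightarrow> int \<Rightarrow> int \<Rightarrow> pdo" is
  "\<lambda>c l m l' m'. if l' = l \<and> m' = m then c else 0"
  by (rule exI, rule exI) (auto split: if_splits)

definition pdo_invertible :: "pdo \<Rightarrow> bool" where
  "pdo_invertible P \<longleftrightarrow> (\<exists>Q. P * Q = 1 \<and> Q * P = 1)"

definition pdo_inverse :: "pdo \<Rightarrow> pdo" where
  "pdo_inverse P = (THE Q. P * Q = 1 \<and> Q * P = 1)"

text \<open>
  Expansion at \<open>x = \<infinity>\<close>: the variable of the Laurent series is \<open>1/x\<close>, so that \<open>x\<close> becomes
  \<^const>\<open>fls_X_inv\<close> and the coefficient of \<open>x\<^sup>l\<close> is the one with the index \<open>- l\<close>.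
\<close>

definition poly_at_infinity :: "complex poly \<Rightarrow> complex fls" where
  "poly_at_infinity p = poly (map_poly fls_const p) fls_X_inv"

definition rat_at_infinity :: "complex poly fract \<Rightarrow> complex fls" where
  "rat_at_infinity r =
     poly_at_infinity (fst (quot_of_fract r)) / poly_at_infinity (snd (quot_of_fract r))"

lift_definition pdo_of_diffop :: "rat_op \<Rightarrow> pdo" is
  "\<lambda>S l m. if 0 \<le> m then fls_nth (rat_at_infinity (coeff S (nat m))) (- l) else 0"
proof -
  fix S :: rat_op
  let ?F = "\<lambda>i. rat_at_infinity (coeff S i)"
  let ?K = "Max ((\<lambda>i. - fls_subdegree (?F i)) ` {..degree S})"
  show "\<exists>K N. \<forall>l m. (if 0 \<le> m then fls_nth (?F (nat m)) (- l) else 0) \<noteq> 0 \<longrightarrow> l \<le> K \<and> m \<le> N"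
  proof (intro exI allI impI)
    fix l m assume "(if 0 \<le> m then fls_nth (?F (nat m)) (- l) else 0) \<noteq> 0"
    then have m: "0 \<le> m" and nz: "fls_nth (?F (nat m)) (- l) \<noteq> 0" by (auto split: if_splits)
    have "rat_at_infinity 0 = 0" by (simp add: rat_at_infinity_def poly_at_infinity_def)
    with nz have "coeff S (nat m) \<noteq> 0" by fastforce
    then have deg: "nat m \<le> degree S" by (rule le_degree)
    have "fls_subdegree (?F (nat m)) \<le> - l" using nz by (rule fls_subdegree_leI)
    then have "l \<le> - fls_subdegree (?F (nat m))" by simp
    also have "\<dots> \<le> ?K" using deg by (intro Max_ge) auto
    finally show "l \<le> ?K \<and> m \<le> int (degree S)" using deg m by auto
  qed
qed

definition pdo_poly_x :: "complex poly \<Rightarrow> pdo" where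
  "pdo_poly_x q = pdo_of_diffop [:to_fract q:]"

definition pdo_poly_T :: "complex poly \<Rightarrow> pdo" where
  "pdo_poly_T p = pdo_of_diffop (map_poly (\<lambda>c. to_fract [:c:]) p)"

text \<open>\<open>\<tau>\<close> of the operator with the coefficients \<open>A\<close>: the summands are \<open>A\<^sub>i\<^sub>a T\<^sup>i (-x)\<^sup>a\<close>.\<close>

definition pdo_tau :: "nat \<Rightarrow> nat \<Rightarrow> (nat \<Rightarrow> nat \<Rightarrow> complex) \<Rightarrow> pdo" where
  "pdo_tau m d A =
     (\<Sum>i\<le>m. \<Sum>a\<le>d. pdo_monom (A i a) 0 (int i) * pdo_monom ((- 1) ^ a) (int a) 0)"

text \<open>Here \<open>A\<close> are the coefficients \<^const>\<open>bar_D_coeffs\<close> of the space of quasi-polynomials.\<close>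

definition fund_pdo_quasi_poly ::
  "nat \<Rightarrow> (nat \<Rightarrow> complex) \<Rightarrow> (nat \<Rightarrow> nat \<Rightarrow> nat) \<Rightarrow>
   nat \<Rightarrow> (nat \<Rightarrow> complex) \<Rightarrow> (nat \<Rightarrow> nat \<Rightarrow> nat) \<Rightarrow> (nat \<Rightarrow> nat \<Rightarrow> complex) \<Rightarrow> pdo" where
  "fund_pdo_quasi_poly k z lam n \<alpha> \<mu> A =
     pdo_inverse (pdo_poly_T (p_poly n \<alpha> \<mu>)) *
     pdo_tau (total_length n \<mu>) (total_length k lam) A *
     pdo_inverse (pdo_poly_x (pcompose (q_poly k z lam) [:0, - 1:]))"

definition fund_pdo_quasi_exp ::
  "nat \<Rightarrow> (nat \<Rightarrow> complex) \<Rightarrow> (nat \<Rightarrow> nat \<Rightarrow> nat) \<Rightarrow> (complex \<Rightarrow> complex) set \<Rightarrow> pdo" where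
  "fund_pdo_quasi_exp n \<alpha> \<mu> W =
     pdo_of_diffop (fund_diffop W) * pdo_inverse (pdo_poly_T (p_poly n \<alpha> \<mu>))"

end

theory Submission
  imports Defs
begin

text \<open>
  Write \<open>p\<close>, \<open>p'\<close> for the polynomials \<^const>\<open>p_poly\<close> of \<open>\<mu>\<close> and of its conjugate. The constant coefficient
  operator \<open>p(T) p'(T)\<close> annihilates \<^const>\<open>hat_space\<close> and in particular \<open>U\<close>, so it is divisible on the right
  by \<open>S\<^sub>U\<close>, say \<open>p(T) p'(T) = Q S\<^sub>U\<close>. The functions \<open>\<phi>\<^sub>a\<close> are, up to sign, entries of the last row of an inverse
  Casorati matrix, that is, they solve the equation adjoint to \<open>Q\<close>. Hence \<open>S\<^sub>W = Q\<^sup>\<dagger>\<close> for the anti-automorphism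
  \<open>T\<^sup>\<dagger> = T\<close>, \<open>x\<^sup>\<dagger> = - x\<close>. The same anti-automorphism turns \<open>q S\<^sub>U\<close> into \<open>\<tau>\<close> of the operator of \<open>V\<close>, so the
  two fundamental operators are \<open>p(T)\<^sup>-\<^sup>1 S\<^sub>U\<^sup>\<dagger>\<close> and \<open>Q\<^sup>\<dagger> p'(T)\<^sup>-\<^sup>1\<close>, and their product is
  \<open>p(T)\<^sup>-\<^sup>1 (Q S\<^sub>U)\<^sup>\<dagger> p'(T)\<^sup>-\<^sup>1 = 1\<close>.
\<close>

section \<open>The ring of pseudo-difference operators\<close>

text \<open>The coefficients of \<open>S\<close> and \<open>Q\<close> have poles, so the pointwise
  arguments run at points \<open>x\<close> whose whole lattice \<open>x + \<int>\<close> avoids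
  them; only countably many \<open>x\<close> are lost. Identities between operators come back
  because a rational function is determined by its values, and vanishing at all regular points comes
  back by continuity. The adjoint equation is delicate since on a two-sided infinite lattice a right
  inverse need not be a left inverse. Truncating the Green function at the diagonal makes it vanish
  far enough in one direction, and there uniqueness for a monic recurrence applies. As
  \<open>fund_diffop\<close> is a definite description, annihilation of \<open>W\<close> is only
  half of the claim: uniqueness needs the generators of \<open>W\<close> to be independent over
  \<open>e\<close> consecutive points of almost every lattice. The algebra itself, defined by its
  double coefficients, is handled as skew Laurent series in \<open>T\<close> over Laurent series in
  \<open>x\<close>. It has no zero divisors, so one product equal to 1 decides
  invertibility.\<close>

text \<open>The substitution \<open>x \<mapsto> x + c\<close> in a Laurent series in \<open>X = 1/x\<close>, where it reads \<open>X \<mapsto> X / (1 + c X)\<close>.\<close>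

definition fls_translate :: "complex \<Rightarrow> complex fls \<Rightarrow> complex fls" where
  "fls_translate c f = fls_compose_fps f (fps_X * inverse (1 + fps_const c * fps_X))"

lemma translate_base_nonzero:
  "fps_X * inverse (1 + fps_const c * fps_X) \<noteq> (0 :: complex fps)"
  "fps_nth (fps_X * inverse (1 + fps_const c * fps_X) :: complex fps) 0 = 0"
proof -
  have "inverse (1 + fps_const c * fps_X) \<noteq> (0 :: complex fps)"
    by (simp add: fps_inverse_eq_0_iff)
  then show "fps_X * inverse (1 + fps_const c * fps_X) \<noteq> (0 :: complex fps)" by simp
qed simp

lemma fls_translate_simps [simp]:
  "fls_translate c 0 = 0" "fls_translate c 1 = 1" "fls_translate c (fls_const a) = fls_const a"
  by (simp_all add: fls_translate_def)

lemma fls_translate_mult: "fls_translate c (f * g) = fls_translate c f * fls_translate c g"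
  unfolding fls_translate_def using translate_base_nonzero by (rule fls_compose_fps_mult)

lemma fls_translate_add: "fls_translate c (f + g) = fls_translate c f + fls_translate c g"
  unfolding fls_translate_def using translate_base_nonzero by (rule fls_compose_fps_add)

lemma fls_translate_divide: "fls_translate c (f / g) = fls_translate c f / fls_translate c g"
  unfolding fls_translate_def using translate_base_nonzero by (rule fls_compose_fps_divide)

lemma fls_translate_eq_0_iff [simp]: "fls_translate c f = 0 \<longleftrightarrow> f = 0"
  unfolding fls_translate_def using translate_base_nonzero by (rule fls_compose_fps_eq_0_iff)

lemma fls_translate_sum: "fls_translate c (sum f A) = (\<Sum>x\<in>A. fls_translate c (f x))"
  by (induction A rule: infinite_finite_induct) (simp_all add: fls_translate_add)

text \<open>Both \<open>G a oo G b\<close> and \<open>G (a + b)\<close> become \<open>X\<close>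
  after multiplication by \<open>1 + (a + b) X\<close>. Associativity of the product of
  \<open>pdo\<close> rests on this law.\<close>

lemma fls_translate_translate: "fls_translate b (fls_translate a f) = fls_translate (a + b) f"
proof -
  define G :: "complex \<Rightarrow> complex fps"
    where "G = (\<lambda>c. fps_X * inverse (1 + fps_const c * fps_X))"
  have nz: "(1 + fps_const c * fps_X :: complex fps) \<noteq> 0" for c
    by (auto dest!: arg_cong[of _ _ "\<lambda>f. fps_nth f 0"])
  have G: "G c * (1 + fps_const c * fps_X) = fps_X" for c
    by (simp add: G_def mult.assoc inverse_mult_eq_1)
  have G0: "fps_nth (G c) 0 = 0" for c by (simp add: G_def)
  have "(G a oo G b) * (1 + fps_const a * G b) = (G a * (1 + fps_const a * fps_X)) oo G b"
    using G0 by (simp add: fps_compose_mult_distrib fps_compose_add_distrib)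
  also have "\<dots> = G b" using G[of a] G0 by simp
  finally have "(G a oo G b) * (1 + fps_const a * G b) * (1 + fps_const b * fps_X) = fps_X"
    by (simp add: G)
  then have "(G a oo G b) * (1 + fps_const b * fps_X + fps_const a * (G b * (1 + fps_const b * fps_X))) = fps_X"
    by (simp add: algebra_simps)
  then have "(G a oo G b) * (1 + fps_const (a + b) * fps_X) = fps_X"
    unfolding G by (simp add: algebra_simps fps_const_add [symmetric] del: fps_const_add)
  with G[of "a + b"] have "(G a oo G b) * (1 + fps_const (a + b) * fps_X) = G (a + b) * (1 + fps_const (a + b) * fps_X)"
    by simp
  then have "G a oo G b = G (a + b)" using nz by simp
  then show ?thesis
    using fls_compose_fps_assoc[OF translate_base_nonzero[of a] translate_base_nonzero[of b], of f]
    by (simp add: fls_translate_def G_def)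
qed

lemma fls_translate_0 [simp]: "fls_translate 0 f = f"
  using fls_nth_fls_compose_fps_linear[of "1::complex" f]
  by (intro fls_eqI) (simp add: fls_translate_def)

lemma X_inv_X: "fls_X_inv * fls_X = (1 :: complex fls)"
  by (simp flip: fls_inverse_X)

lemma fls_translate_X_inv: "fls_translate c fls_X_inv = fls_X_inv + fls_const c"
proof -
  let ?u = "1 + fps_const c * fps_X :: complex fps"
  have "fps_to_fls (fps_X * inverse ?u) * (fls_X_inv * fps_to_fls ?u) =
      (fls_X_inv * fps_to_fls fps_X) * fps_to_fls (?u * inverse ?u)"
    by (simp add: fls_times_fps_to_fls)
  also have "\<dots> = 1"
    by (simp add: inverse_mult_eq_1' X_inv_X)
  finally have "inverse (fps_to_fls (fps_X * inverse ?u)) = fls_X_inv * fps_to_fls ?u"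
    by (metis inverse_unique)
  moreover have "fls_translate c fls_X_inv = inverse (fps_to_fls (fps_X * inverse ?u))"
    using fls_compose_fps_inverse[OF translate_base_nonzero[of c], of fls_X]
    by (simp add: fls_translate_def fls_inverse_X)
  moreover have "fls_X_inv * fps_to_fls ?u = fls_X_inv + fls_const c"
    by (simp add: fls_times_fps_to_fls distrib_left X_inv_X mult.left_commute[of fls_X_inv])
  ultimately show ?thesis by simp
qed

text \<open>Negative exponents are included; this is the source of the coefficients
  \<open>gchoose\<close> in the expansion of \<open>(x + c) powi l\<close> at infinity.\<close>

lemma one_plus_X_powi:
  "fps_to_fls (1 + fps_X :: complex fps) powi n = fps_to_fls (fps_binomial (of_int n))"
proof (cases "n \<ge> 0")
  case True
  then obtain k where "n = int k" using nonneg_int_cases by blast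
  then show ?thesis by (simp add: fps_binomial_of_nat fps_to_fls_power)
next
  case False
  then obtain k where n: "n = - int k" using nonpos_int_cases[of n] by (metis linear)
  have "fps_to_fls (fps_binomial (of_int n)) * fps_to_fls ((1 + fps_X) ^ k) = (1 :: complex fls)"
    unfolding n of_int_minus of_int_of_nat_eq fps_binomial_of_nat [symmetric]
      fls_times_fps_to_fls [symmetric] fps_binomial_add_mult [symmetric]
    by simp
  then have "fps_to_fls (fps_binomial (of_int n)) = inverse (fps_to_fls ((1 + fps_X :: complex fps) ^ k))"
    by (metis inverse_unique mult.commute)
  then show ?thesis by (simp add: n power_int_minus fps_to_fls_power)
qed

lemma fls_X_inv_powi: "fls_X_inv powi l = (fls_X_intpow (- l) :: complex fls)"
  by (simp only: fls_X_power_int [symmetric] fls_inverse_X [symmetric] power_int_minus power_int_inverse)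

lemma fls_translate_X_powi_nth:
  "fls_nth (fls_translate c (fls_X_inv powi l)) (- r) =
     (if r \<le> l then (of_int l gchoose nat (l - r)) * c ^ nat (l - r) else 0)"
proof -
  have "fls_translate c (fls_X_inv powi l) = (fls_X_inv + fls_const c) powi l"
    using fls_compose_fps_powi[OF translate_base_nonzero[of c], of fls_X_inv l]
      fls_translate_X_inv[of c] by (simp add: fls_translate_def)
  also have "fls_X_inv + fls_const c = fls_X_inv * fps_to_fls (1 + fps_const c * fps_X)"
    by (simp add: fls_times_fps_to_fls distrib_left X_inv_X mult.left_commute[of fls_X_inv])
  also have "\<dots> powi l = fls_X_inv powi l * fps_to_fls (1 + fps_const c * fps_X) powi l"
    by (simp add: power_int_mult_distrib)
  also have "fps_to_fls (1 + fps_const c * fps_X) powi l =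
      fps_to_fls (fps_binomial (of_int l) oo (fps_const c * fps_X))"
  proof (cases "c = 0")
    case True
    \<comment> \<open>The rules for composing Laurent series ask for a nonzero inner series, so
      \<open>c = 0\<close> is treated apart.\<close>
    have "(fps_binomial (of_int l) oo 0 :: complex fps) = 1"
      by (intro fps_ext) (simp add: fps_compose_0_right)
    then show ?thesis using True by simp
  next
    case False
    let ?H = "fps_const c * fps_X :: complex fps"
    have H: "?H \<noteq> 0" "fps_nth ?H 0 = 0" using False by auto
    have "fps_to_fls (1 + ?H) = fls_compose_fps (fps_to_fls (1 + fps_X)) ?H"
      using H by (subst fls_compose_fps_to_fls) (auto simp: fps_compose_add_distrib)
    then show ?thesis
      using fls_compose_fps_powi[OF H, of "fps_to_fls (1 + fps_X)" l]
      by (simp only: one_plus_X_powi fls_compose_fps_to_fls[OF H])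
  qed
  also have "fls_X_inv powi l * \<dots> = fls_shift l \<dots>"
    by (simp only: fls_X_inv_powi fls_X_intpow_times_conv_shift(1)) simp
  finally show ?thesis by (auto simp: fps_compose_linear)
qed

text \<open>Translation preserves the subdegree in \<open>1/x\<close>, so the part \<open>h\<close>
  of degree below \<open>r\<close> in \<open>x\<close> cannot contribute; what remains is a finite
  sum of powers of \<open>x\<close>.\<close>

lemma fls_translate_nth:
  assumes "\<And>l. l > K \<Longrightarrow> fls_nth f (- l) = 0"
  shows "fls_nth (fls_translate c f) (- r) =
    (\<Sum>l=r..K. fls_nth f (- l) * (of_int l gchoose nat (l - r)) * c ^ nat (l - r))"
proof -
  define g where "g = (\<Sum>l=r..K. fls_const (fls_nth f (- l)) * fls_X_inv powi l)"
  define h where "h = f - g"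
  have X: "fls_nth (fls_X_inv powi l :: complex fls) i = (if i = - l then 1 else 0)" for l i
    by (auto simp: fls_X_inv_powi)
  have g: "fls_nth g (- s) = (if s \<in> {r..K} then fls_nth f (- s) else 0)" for s
    by (auto simp: g_def fls_nth_sum X if_distrib sum.delta cong: if_cong)
  have h: "fls_nth h (- s) = 0" if "s \<ge> r" for s
    using that assms[of s] by (auto simp: h_def g)
  have "fls_nth (fls_translate c h) (- r) = 0"
  proof (cases "h = 0")
    case False
    have "fls_subdegree h > - r"
    proof (rule ccontr)
      assume "\<not> fls_subdegree h > - r"
      then have "fls_nth h (- (- fls_subdegree h)) = 0" by (intro h) auto
      with False show False by simp
    qed
    moreover have "fls_subdegree (fls_translate c h) = fls_subdegree h * subdegree (fps_X * inverse (1 + fps_const c * fps_X))"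
      unfolding fls_translate_def using translate_base_nonzero
      by (intro subdegree_fls_compose_fps)
    moreover have "subdegree (fps_X * inverse (1 + fps_const c * fps_X)) = 1"
      by (rule subdegreeI) auto
    ultimately show ?thesis by (intro fls_eq0_below_subdegree) simp
  qed simp
  moreover have "fls_translate c f = fls_translate c g + fls_translate c h"
    by (simp add: h_def flip: fls_translate_add)
  moreover have "fls_nth (fls_translate c g) (- r) =
      (\<Sum>l=r..K. fls_nth f (- l) * (of_int l gchoose nat (l - r)) * c ^ nat (l - r))"
    unfolding g_def fls_translate_sum fls_nth_sum fls_translate_mult fls_translate_simps
      fls_mult_const_nth fls_translate_X_powi_nth
    by (intro sum.cong) auto
  ultimately show ?thesis by simp
qed


text \<open>The range comes from arbitrary upper bounds on the powers of \<open>x\<close> instead of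
  \<open>fls_subdegree\<close>, so that one range serves all coefficients of an operator at
  once.\<close>

lemma fls_mult_nth_bounds:
  fixes f g :: "complex fls"
  assumes "\<And>l. l > K \<Longrightarrow> fls_nth f (- l) = 0" and "\<And>l. l > K' \<Longrightarrow> fls_nth g (- l) = 0"
  shows "fls_nth (f * g) (- r) = (\<Sum>l=r-K'..K. fls_nth f (- l) * fls_nth g (- (r - l)))"
proof -
  let ?S = "{fls_subdegree f..- r - fls_subdegree g}" and ?T = "uminus ` {r-K'..K}"
  have "fls_nth f i * fls_nth g (- r - i) = 0" if "i \<notin> ?S" for i
    using that by (auto simp: not_le)
  moreover have "fls_nth f i * fls_nth g (- r - i) = 0" if "i \<notin> ?T" for i
  proof -
    have "- i \<notin> {r-K'..K}" using that by force
    then have "- i > K \<or> r + i > K'" by auto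
    then show ?thesis using assms(1)[of "- i"] assms(2)[of "r + i"] by auto
  qed
  ultimately have "(\<Sum>i\<in>?S. fls_nth f i * fls_nth g (- r - i)) = (\<Sum>i\<in>?T. fls_nth f i * fls_nth g (- r - i))"
    by (intro sum.mono_neutral_cong) auto
  moreover have "(\<Sum>i\<in>?T. fls_nth f i * fls_nth g (- r - i)) = (\<Sum>l=r-K'..K. fls_nth f (- l) * fls_nth g (- (r - l)))"
    by (subst sum.reindex) (auto simp: algebra_simps)
  ultimately show ?thesis by (simp only: fls_times_nth(2))
qed

section \<open>Operators as series in T with Laurent coefficients; ring axioms\<close>

definition pdo_fls :: "pdo \<Rightarrow> int \<Rightarrow> complex fls" where
  "pdo_fls P m = Abs_fls (\<lambda>i. pdo_coeff P (- i) m)"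

lemma pdo_bounds:
  obtains K N where "\<And>l m. pdo_coeff P l m \<noteq> 0 \<Longrightarrow> l \<le> K \<and> m \<le> N"
  using pdo_coeff[of P] by auto

lemma pdo_fls_nth [simp]: "fls_nth (pdo_fls P m) i = pdo_coeff P (- i) m"
proof -
  obtain K N where *: "\<And>l m. pdo_coeff P l m \<noteq> 0 \<Longrightarrow> l \<le> K \<and> m \<le> N" using pdo_bounds by blast
  have "\<forall>i < - K. pdo_coeff P (- i) m = 0" using *[of _ m] by force
  then show ?thesis unfolding pdo_fls_def by (subst nth_Abs_fls_lower_bound) auto
qed

lemma pdo_eqI: "(\<And>m. pdo_fls P m = pdo_fls Q m) \<Longrightarrow> P = Q"
proof -
  assume *: "\<And>m. pdo_fls P m = pdo_fls Q m"
  have "pdo_coeff P l m = pdo_coeff Q l m" for l m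
    using arg_cong[OF *[of m], of "\<lambda>f. fls_nth f (- l)"] by simp
  then show "P = Q" by (simp add: fun_eq_iff flip: pdo_coeff_inject)
qed

lemma pdo_fls_bound:
  obtains N where "\<forall>m>N. pdo_fls P m = 0"
proof -
  obtain K N where *: "\<And>l m. pdo_coeff P l m \<noteq> 0 \<Longrightarrow> l \<le> K \<and> m \<le> N" using pdo_bounds by blast
  have "pdo_fls P m = 0" if "m > N" for m
    using * that by (intro fls_eqI) force
  then show ?thesis using that by blast
qed

lemma pdo_fls_add [simp]: "pdo_fls (P + Q) m = pdo_fls P m + pdo_fls Q m"
  by (intro fls_eqI) (simp add: plus_pdo.rep_eq)

lemma pdo_fls_0 [simp]: "pdo_fls 0 m = 0"
  by (intro fls_eqI) (simp add: zero_pdo.rep_eq)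

lemma pdo_fls_1: "pdo_fls 1 m = (if m = 0 then 1 else 0)"
  by (intro fls_eqI) (auto simp: one_pdo.rep_eq)

text \<open>Grouping by powers of \<open>T\<close> turns the product into a convolution twisted by
  \<open>T^m g = (fls_translate m g) T^m\<close>.\<close>

lemma pdo_fls_mult:
  assumes "finite A" and A: "\<And>m. m \<notin> A \<Longrightarrow> pdo_fls P m = 0 \<or> pdo_fls Q (s - m) = 0"
  shows "pdo_fls (P * Q) s = (\<Sum>m\<in>A. pdo_fls P m * fls_translate (of_int m) (pdo_fls Q (s - m)))"
proof (intro fls_eqI)
  fix i
  define r :: int where "r = - i"
  let ?C = "pdo_coeff P" and ?D = "pdo_coeff Q"
  obtain K N where C: "\<And>l m. ?C l m \<noteq> 0 \<Longrightarrow> l \<le> K \<and> m \<le> N" using pdo_bounds by blast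
  obtain K' N' where D: "\<And>l m. ?D l m \<noteq> 0 \<Longrightarrow> l \<le> K' \<and> m \<le> N'" using pdo_bounds by blast
  have A': "?C l m = 0 \<or> ?D l' (s - m) = 0" if "m \<notin> A" for l l' m
    using A[OF that] by (metis pdo_fls_nth fls_zero_nth minus_minus)
  let ?t = "\<lambda>l l' m. ?C l m * ?D l' (s - m) * (of_int l' gchoose nat (l + l' - r)) * of_int m ^ nat (l + l' - r)"
  let ?I = "{(l, l', m). ?C l m \<noteq> 0 \<and> ?D l' (s - m) \<noteq> 0 \<and> r \<le> l + l'}"
  let ?J = "SIGMA m:A. SIGMA l:{r-K'..K}. {r-l..K'}"
  have bQ: "fls_nth (pdo_fls Q j) (- l) = 0" if "l > K'" for j l using D[of l j] that by auto
  have bT: "fls_nth (fls_translate c (pdo_fls Q j)) (- l) = 0" if "l > K'" for c j l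
    using bQ that by (subst fls_translate_nth[where K = K']) auto
  have bP: "fls_nth (pdo_fls P j) (- l) = 0" if "l > K" for j l using C[of l j] that by auto
  have "fls_nth (\<Sum>m\<in>A. pdo_fls P m * fls_translate (of_int m) (pdo_fls Q (s - m))) i =
      (\<Sum>m\<in>A. fls_nth (pdo_fls P m * fls_translate (of_int m) (pdo_fls Q (s - m))) (- r))"
    by (simp add: fls_nth_sum r_def)
  also have "\<dots> = (\<Sum>m\<in>A. \<Sum>l=r-K'..K. \<Sum>l'=r-l..K'. ?t l l' m)"
  proof (intro sum.cong refl)
    fix m
    have T: "fls_nth (fls_translate (of_int m) (pdo_fls Q (s - m))) (- (r - l)) =
        (\<Sum>l'=r-l..K'. ?D l' (s - m) * (of_int l' gchoose nat (l' - (r - l))) * of_int m ^ nat (l' - (r - l)))" for l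
      using bQ by (subst fls_translate_nth[where K = K']) auto
    have "fls_nth (pdo_fls P m * fls_translate (of_int m) (pdo_fls Q (s - m))) (- r) =
        (\<Sum>l=r-K'..K. fls_nth (pdo_fls P m) (- l) *
          fls_nth (fls_translate (of_int m) (pdo_fls Q (s - m))) (- (r - l)))"
      by (intro fls_mult_nth_bounds bP bT)
    also have "\<dots> = (\<Sum>l=r-K'..K. \<Sum>l'=r-l..K'. ?t l l' m)"
      unfolding T sum_distrib_left by (intro sum.cong refl) (simp add: algebra_simps)
    finally show "fls_nth (pdo_fls P m * fls_translate (of_int m) (pdo_fls Q (s - m))) (- r) =
        (\<Sum>l=r-K'..K. \<Sum>l'=r-l..K'. ?t l l' m)" .
  qed
  also have "\<dots> = (\<Sum>(m, l, l')\<in>?J. ?t l l' m)"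
    using assms(1) by (simp add: sum.Sigma)
  also have "\<dots> = (\<Sum>(l, l', m)\<in>(\<lambda>(m, l, l'). (l, l', m)) ` ?J. ?t l l' m)"
    by (subst sum.reindex) (auto simp: inj_on_def intro!: sum.cong)
  \<comment> \<open>The reordered box contains \<open>?I\<close>, and each of its other terms has a
    vanishing coefficient.\<close>
  also have "\<dots> = (\<Sum>(l, l', m)\<in>?I. ?t l l' m)"
  proof (intro sum.mono_neutral_cong_right)
    show "finite ((\<lambda>(m, l, l'). (l, l', m)) ` ?J)" using assms(1) by (intro finite_imageI finite_SigmaI) auto
    show "?I \<subseteq> (\<lambda>(m, l, l'). (l, l', m)) ` ?J"
    proof clarify
      fix l l' m assume *: "?C l m \<noteq> 0" "?D l' (s - m) \<noteq> 0" "r \<le> l + l'"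
      then have "(m, l, l') \<in> ?J" using A'[of m l l'] C[of l m] D[of l' "s - m"] by auto
      then show "(l, l', m) \<in> (\<lambda>(m, l, l'). (l, l', m)) ` ?J" by force
    qed
  qed auto
  also have "\<dots> = fls_nth (pdo_fls (P * Q) s) i"
    by (simp add: times_pdo.rep_eq r_def)
  finally show "fls_nth (pdo_fls (P * Q) s) i =
    fls_nth (\<Sum>m\<in>A. pdo_fls P m * fls_translate (of_int m) (pdo_fls Q (s - m))) i" by simp
qed

text \<open>The ends \<open>a\<close> and \<open>b\<close> stay free because each ring law compares
  several products over a common interval.\<close>

lemma pdo_fls_mult_bounded:
  assumes "\<forall>m>N. pdo_fls P m = 0" and "\<forall>m>N'. pdo_fls Q m = 0" and "a \<le> s - N'" and "N \<le> b"
  shows "pdo_fls (P * Q) s = (\<Sum>m=a..b. pdo_fls P m * fls_translate (of_int m) (pdo_fls Q (s - m)))"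
proof (rule pdo_fls_mult)
  fix m assume "m \<notin> {a..b}"
  then have "m > N \<or> s - m > N'" using assms(3,4) by auto
  then show "pdo_fls P m = 0 \<or> pdo_fls Q (s - m) = 0" using assms(1,2) by blast
qed simp

lemma pdo_fls_mult_leading:
  assumes "\<forall>m>N. pdo_fls P m = 0" and "\<forall>m>N'. pdo_fls Q m = 0"
  shows "pdo_fls (P * Q) (N + N') = pdo_fls P N * fls_translate (of_int N) (pdo_fls Q N')"
    and "\<forall>s>N + N'. pdo_fls (P * Q) s = 0"
  using pdo_fls_mult_bounded[where a = N and s = "N + N'" and b = N, OF assms]
    pdo_fls_mult_bounded[where a = "s - N'" and s = s and b = N for s, OF assms] by auto

instance pdo :: ring_1_no_zero_divisors
proof
  fix P Q R :: pdo
  show "P * Q * R = P * (Q * R)"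
  proof (rule pdo_eqI)
    fix s
    obtain N1 where P: "\<forall>m>N1. pdo_fls P m = 0" using pdo_fls_bound by blast
    obtain N2 where Q: "\<forall>m>N2. pdo_fls Q m = 0" using pdo_fls_bound by blast
    obtain N3 where R: "\<forall>m>N3. pdo_fls R m = 0" using pdo_fls_bound by blast
    \<comment> \<open>With \<open>i\<close>, \<open>j\<close>, \<open>s - i - j\<close> as the
      powers of \<open>T\<close> in the three factors, the bounds \<open>N1\<close>,
      \<open>N2\<close>, \<open>N3\<close> confine \<open>i\<close>, \<open>i + j\<close> and
      \<open>j\<close> to these intervals.\<close>
    let ?I = "{s - N3 - N2..N1}" and ?M = "{s - N3..N1 + N2}" and ?J = "{s - N3 - N1..N2}"
    let ?t = "\<lambda>i j. pdo_fls P i * fls_translate (of_int i) (pdo_fls Q j) * fls_translate (of_int (i + j)) (pdo_fls R (s - i - j))"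
    have 0: "?t i j = 0" if "i > N1 \<or> j > N2 \<or> s - i - j > N3" for i j using that P Q R by auto
    have "pdo_fls (P * Q * R) s =
        (\<Sum>m\<in>?M. pdo_fls (P * Q) m * fls_translate (of_int m) (pdo_fls R (s - m)))"
      using P Q R pdo_fls_mult_leading(2)[OF P Q] by (intro pdo_fls_mult_bounded) auto
    also have "\<dots> = (\<Sum>m\<in>?M. \<Sum>i\<in>?I. ?t i (m - i))"
    proof (intro sum.cong refl)
      fix m assume "m \<in> ?M"
      then have "pdo_fls (P * Q) m = (\<Sum>i\<in>?I. pdo_fls P i * fls_translate (of_int i) (pdo_fls Q (m - i)))"
        using P Q by (intro pdo_fls_mult_bounded) auto
      then show "pdo_fls (P * Q) m * fls_translate (of_int m) (pdo_fls R (s - m)) = (\<Sum>i\<in>?I. ?t i (m - i))"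
        by (simp add: sum_distrib_right)
    qed
    also have "\<dots> = (\<Sum>i\<in>?I. \<Sum>m\<in>?M. ?t i (m - i))" by (rule sum.swap)
    also have "\<dots> = (\<Sum>i\<in>?I. \<Sum>j\<in>?J. ?t i j)"
    proof (rule sum.cong[OF refl])
      fix i assume "i \<in> ?I"
      have "(\<Sum>m\<in>?M. ?t i (m - i)) = (\<Sum>j\<in>(\<lambda>m. m - i) ` ?M. ?t i j)"
        by (subst sum.reindex) (auto simp: inj_on_def)
      also have "\<dots> = (\<Sum>j\<in>?J. ?t i j)"
      proof (intro sum.mono_neutral_cong)
        fix j assume "j \<in> (\<lambda>m. m - i) ` ?M - ?J"
        then show "?t i j = 0" using \<open>i \<in> ?I\<close> by (intro 0) auto
      next
        fix j assume "j \<in> ?J - (\<lambda>m. m - i) ` ?M"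
        then have "i + j \<notin> ?M" by (auto simp: image_iff)
        then show "?t i j = 0" using \<open>i \<in> ?I\<close> \<open>j \<in> ?J - (\<lambda>m. m - i) ` ?M\<close> by (intro 0) auto
      qed auto
      finally show "(\<Sum>m\<in>?M. ?t i (m - i)) = (\<Sum>j\<in>?J. ?t i j)" .
    qed
    also have "\<dots> = (\<Sum>i\<in>?I. pdo_fls P i * fls_translate (of_int i) (pdo_fls (Q * R) (s - i)))"
    proof (intro sum.cong refl)
      fix i assume "i \<in> ?I"
      then have "pdo_fls (Q * R) (s - i) =
          (\<Sum>j\<in>?J. pdo_fls Q j * fls_translate (of_int j) (pdo_fls R (s - i - j)))"
        using Q R by (intro pdo_fls_mult_bounded) auto
      then show "(\<Sum>j\<in>?J. ?t i j) = pdo_fls P i * fls_translate (of_int i) (pdo_fls (Q * R) (s - i))"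
        by (simp add: fls_translate_sum fls_translate_mult fls_translate_translate sum_distrib_left
            mult.assoc add.commute)
    qed
    also have "\<dots> = pdo_fls (P * (Q * R)) s"
      using pdo_fls_mult_bounded[where a = "s - N3 - N2" and s = s and b = N1, OF P pdo_fls_mult_leading(2)[OF Q R]] by simp
    finally show "pdo_fls (P * Q * R) s = pdo_fls (P * (Q * R)) s" .
  qed
  show "1 * P = P"
    by (rule pdo_eqI) (subst pdo_fls_mult[of "{0}"], auto simp: pdo_fls_1)
  show "P * 1 = P"
  proof (rule pdo_eqI)
    fix s show "pdo_fls (P * 1) s = pdo_fls P s"
      by (subst pdo_fls_mult[of "{s}"]) (auto simp: pdo_fls_1)
  qed
  show "0 * P = 0" "P * 0 = 0"
    by (rule pdo_eqI, subst pdo_fls_mult[of "{}"], auto)+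
  show "(P + Q) * R = P * R + Q * R"
  proof (rule pdo_eqI)
    fix s
    obtain N1 where P: "\<forall>m>N1. pdo_fls P m = 0" using pdo_fls_bound by blast
    obtain N2 where Q: "\<forall>m>N2. pdo_fls Q m = 0" using pdo_fls_bound by blast
    obtain N3 where R: "\<forall>m>N3. pdo_fls R m = 0" using pdo_fls_bound by blast
    have PQ: "\<forall>m>max N1 N2. pdo_fls (P + Q) m = 0" using P Q by simp
    show "pdo_fls ((P + Q) * R) s = pdo_fls (P * R + Q * R) s"
      using pdo_fls_mult_bounded[where a = "s - N3" and s = s and b = "max N1 N2", OF PQ R]
        pdo_fls_mult_bounded[where a = "s - N3" and s = s and b = "max N1 N2", OF P R]
        pdo_fls_mult_bounded[where a = "s - N3" and s = s and b = "max N1 N2", OF Q R]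
      by (simp add: sum.distrib algebra_simps)
  qed
  show "P * (Q + R) = P * Q + P * R"
  proof (rule pdo_eqI)
    fix s
    obtain N1 where P: "\<forall>m>N1. pdo_fls P m = 0" using pdo_fls_bound by blast
    obtain N2 where Q: "\<forall>m>N2. pdo_fls Q m = 0" using pdo_fls_bound by blast
    obtain N3 where R: "\<forall>m>N3. pdo_fls R m = 0" using pdo_fls_bound by blast
    have QR: "\<forall>m>max N2 N3. pdo_fls (Q + R) m = 0" using Q R by simp
    show "pdo_fls (P * (Q + R)) s = pdo_fls (P * Q + P * R) s"
      using pdo_fls_mult_bounded[where a = "s - max N2 N3" and s = s and b = N1, OF P QR]
        pdo_fls_mult_bounded[where a = "s - max N2 N3" and s = s and b = N1, OF P Q]
        pdo_fls_mult_bounded[where a = "s - max N2 N3" and s = s and b = N1, OF P R]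
      by (simp add: sum.distrib fls_translate_add algebra_simps)
  qed
  show "(0 :: pdo) \<noteq> 1"
  proof
    assume "(0 :: pdo) = 1"
    then have "pdo_fls 0 0 = pdo_fls 1 0" by simp
    then show False by (simp add: pdo_fls_1)
  qed
  \<comment> \<open>Top coefficients in \<open>T\<close> multiply, one of them translated; Laurent
    series over the complex numbers form a field and translation is injective.\<close>
  have leading: "\<exists>N. pdo_fls X N \<noteq> 0 \<and> (\<forall>m>N. pdo_fls X m = 0)" if X0: "X \<noteq> 0" for X
  proof -
    obtain B where B: "\<forall>m>B. pdo_fls X m = 0" using pdo_fls_bound by blast
    obtain m0 where m0: "pdo_fls X m0 \<noteq> 0" using X0 by (metis pdo_eqI pdo_fls_0)
    let ?S = "{m \<in> {m0..B}. pdo_fls X m \<noteq> 0}"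
    have fin: "finite ?S" by (rule finite_subset[of _ "{m0..B}"]) auto
    have "m0 \<in> ?S" using m0 B by force
    then have "Max ?S \<in> ?S" using fin by (intro Max_in) auto
    moreover have "pdo_fls X m = 0" if "m > Max ?S" for m
    proof (rule ccontr)
      assume "pdo_fls X m \<noteq> 0"
      moreover from this have "m \<le> B" using B by force
      moreover have "m0 \<le> Max ?S" using fin \<open>m0 \<in> ?S\<close> by (rule Max_ge)
      ultimately have "m \<in> ?S" using that by auto
      then show False using Max_ge[OF fin, of m] that by simp
    qed
    ultimately show ?thesis by blast
  qed
  show "P * Q \<noteq> 0" if "P \<noteq> 0" "Q \<noteq> 0"
  proof
    obtain N where N: "pdo_fls P N \<noteq> 0" "\<forall>m>N. pdo_fls P m = 0" using leading[OF \<open>P \<noteq> 0\<close>] by blast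
    obtain N' where N': "pdo_fls Q N' \<noteq> 0" "\<forall>m>N'. pdo_fls Q m = 0" using leading[OF \<open>Q \<noteq> 0\<close>] by blast
    assume "P * Q = 0"
    then show False using pdo_fls_mult_leading(1)[OF N(2) N'(2)] N(1) N'(1) by simp
  qed
qed

section \<open>Rational functions and their difference operators\<close>

lemma rat_quot: "(r :: complex poly fract) = to_fract (fst (quot_of_fract r)) / to_fract (snd (quot_of_fract r))"
  by (metis Fract_conv_to_fract Fract_quot_of_fract)

lemma rat_cases:
  fixes r :: "complex poly fract"
  obtains a b where "r = to_fract a / to_fract b" "b \<noteq> 0"
  by (rule that[OF rat_quot]) simp

lemma to_fract_divide_eq_iff:
  assumes "b \<noteq> 0" "d \<noteq> 0"
  shows "to_fract a / to_fract b = to_fract c / to_fract d \<longleftrightarrow> a * d = c * b"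
  using assms by (simp add: frac_eq_eq flip: to_fract_mult)

lemma quot_of_fract_cross:
  fixes a b :: "complex poly"
  assumes "b \<noteq> 0"
  shows "fst (quot_of_fract (to_fract a / to_fract b)) * b = a * snd (quot_of_fract (to_fract a / to_fract b))"
  by (subst to_fract_divide_eq_iff[symmetric]) (use assms in \<open>simp_all flip: rat_quot\<close>)

text \<open>\<open>rat_regular\<close> inspects the reduced fraction, whereas fractions usually
  arise unreduced. By cross multiplication a zero of the reduced denominator at \<open>x\<close>
  would be one of the reduced numerator too, against coprimality.\<close>

lemma rat_eval_divide:
  assumes "poly b x \<noteq> 0"
  shows "rat_regular (to_fract a / to_fract b) x" and "rat_eval (to_fract a / to_fract b) x = poly a x / poly b x"
proof -
  let ?c = "fst (quot_of_fract (to_fract a / to_fract b))" and ?d = "snd (quot_of_fract (to_fract a / to_fract b))"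
  have b: "b \<noteq> 0" using assms by auto
  have cd: "poly ?c x * poly b x = poly a x * poly ?d x"
    using arg_cong[OF quot_of_fract_cross[OF b, of a], of "\<lambda>p. poly p x"] by simp
  have "poly ?d x \<noteq> 0"
  proof
    assume d: "poly ?d x = 0"
    with cd assms have "poly ?c x = 0" by auto
    with d have "[:- x, 1:] dvd ?c" "[:- x, 1:] dvd ?d" by (auto simp: poly_eq_0_iff_dvd)
    then have "is_unit [:- x, 1:]" using coprime_quot_of_fract coprime_common_divisor by blast
    then show False by (simp add: is_unit_iff_degree)
  qed
  then show "rat_regular (to_fract a / to_fract b) x" "rat_eval (to_fract a / to_fract b) x = poly a x / poly b x"
    using cd assms by (auto simp: rat_regular_def rat_eval_def field_simps)
qed

lemma rat_regularE:
  assumes "rat_regular r x"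
  obtains a b where "r = to_fract a / to_fract b" "poly b x \<noteq> 0"
  using assms unfolding rat_regular_def by (rule that[OF rat_quot])

lemma rat_eval_const [simp]:
  "rat_regular (to_fract p) x" "rat_eval (to_fract p) x = poly p x"
  using rat_eval_divide[of 1 x p] by simp_all

lemma rat_eval_0_1 [simp]:
  "rat_regular 0 x" "rat_eval 0 x = 0" "rat_regular 1 x" "rat_eval 1 x = 1"
  using rat_eval_const[of 0 x] rat_eval_const[of 1 x] by simp_all

lemma rat_eval_add:
  assumes "rat_regular r x" "rat_regular s x"
  shows "rat_regular (r + s) x" "rat_eval (r + s) x = rat_eval r x + rat_eval s x"
proof -
  obtain a b where 1: "r = to_fract a / to_fract b" "poly b x \<noteq> 0" using assms(1) by (rule rat_regularE)
  obtain c d where 2: "s = to_fract c / to_fract d" "poly d x \<noteq> 0" using assms(2) by (rule rat_regularE)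
  have nz: "b \<noteq> 0" "d \<noteq> 0" using 1 2 by auto
  have rs: "r + s = to_fract (a * d + c * b) / to_fract (b * d)"
    unfolding 1(1) 2(1) to_fract_mult to_fract_add by (rule add_frac_eq) (use nz in auto)
  have bd: "poly (b * d) x \<noteq> 0" using 1 2 by simp
  show "rat_regular (r + s) x" unfolding rs by (rule rat_eval_divide(1)[OF bd])
  show "rat_eval (r + s) x = rat_eval r x + rat_eval s x"
    unfolding rs rat_eval_divide(2)[OF bd] using 1 2 by (simp add: rat_eval_divide(2) add_frac_eq)
qed

lemma rat_eval_mult:
  assumes "rat_regular r x" "rat_regular s x"
  shows "rat_regular (r * s) x" "rat_eval (r * s) x = rat_eval r x * rat_eval s x"
proof -
  obtain a b where 1: "r = to_fract a / to_fract b" "poly b x \<noteq> 0" using assms(1) by (rule rat_regularE)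
  obtain c d where 2: "s = to_fract c / to_fract d" "poly d x \<noteq> 0" using assms(2) by (rule rat_regularE)
  have rs: "r * s = to_fract (a * c) / to_fract (b * d)" by (simp add: 1 2)
  have bd: "poly (b * d) x \<noteq> 0" using 1 2 by simp
  show "rat_regular (r * s) x" unfolding rs by (rule rat_eval_divide(1)[OF bd])
  show "rat_eval (r * s) x = rat_eval r x * rat_eval s x"
    unfolding rs rat_eval_divide(2)[OF bd] using 1 2 by (simp add: rat_eval_divide(2))
qed

lemma rat_eval_sum:
  assumes "\<And>i. i \<in> A \<Longrightarrow> rat_regular (f i) x"
  shows "rat_regular (sum f A) x \<and> rat_eval (sum f A) x = (\<Sum>i\<in>A. rat_eval (f i) x)"
  using assms by (induction A rule: infinite_finite_induct) (auto simp: rat_eval_add)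

lemma finite_not_rat_regular: "finite {x. \<not> rat_regular r x}"
  by (simp add: rat_regular_def poly_roots_finite)

lemma rat_eval_eq_infinite:
  assumes "infinite {x. rat_regular r x \<and> rat_regular s x \<and> rat_eval r x = rat_eval s x}"
  shows "r = s"
proof -
  let ?a = "fst (quot_of_fract r)" and ?b = "snd (quot_of_fract r)"
  let ?c = "fst (quot_of_fract s)" and ?d = "snd (quot_of_fract s)"
  have "{x. rat_regular r x \<and> rat_regular s x \<and> rat_eval r x = rat_eval s x} \<subseteq> {x. poly (?a * ?d - ?c * ?b) x = 0}"
    by (auto simp: rat_regular_def rat_eval_def field_simps)
  then have "?a * ?d - ?c * ?b = 0"
    using assms poly_roots_finite finite_subset by blast
  then have "?a * ?d = ?c * ?b" by simp
  then have "to_fract ?a / to_fract ?b = to_fract ?c / to_fract ?d"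
    by (subst to_fract_divide_eq_iff) auto
  then show ?thesis
    unfolding rat_quot[symmetric] .
qed

section \<open>Substitution into rational functions\<close>

definition rat_comp :: "complex poly \<Rightarrow> complex poly fract \<Rightarrow> complex poly fract" where
  "rat_comp h r =
     to_fract (pcompose (fst (quot_of_fract r)) h) / to_fract (pcompose (snd (quot_of_fract r)) h)"

text \<open>A nonconstant \<open>h\<close> keeps composed denominators nonzero. The cases needed are
  the shifts \<open>x + i\<close> and the reflections \<open>- x - i\<close>.\<close>

lemma rat_comp_divide:
  assumes "degree h > 0" "b \<noteq> 0"
  shows "rat_comp h (to_fract a / to_fract b) = to_fract (pcompose a h) / to_fract (pcompose b h)"
proof -
  have "pcompose p h \<noteq> 0" if "p \<noteq> 0" for p using that assms(1) pcompose_eq_0 by blast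
  then show ?thesis
    unfolding rat_comp_def using assms quot_of_fract_cross[OF assms(2), of a]
    by (subst to_fract_divide_eq_iff) (auto simp flip: pcompose_mult)
qed

lemma rat_comp_to_fract: "degree h > 0 \<Longrightarrow> rat_comp h (to_fract p) = to_fract (pcompose p h)"
  using rat_comp_divide[of h 1 p] by (simp add: pcompose_1)

lemma rat_comp_0_1 [simp]:
  "rat_comp h 0 = 0" "rat_comp h 1 = 1"
  by (simp_all add: rat_comp_def pcompose_1)

lemma rat_comp_mult:
  assumes "degree h > 0"
  shows "rat_comp h (r * s) = rat_comp h r * rat_comp h s"
proof -
  obtain a b where 1: "r = to_fract a / to_fract b" "b \<noteq> 0" by (rule rat_cases)
  obtain c d where 2: "s = to_fract c / to_fract d" "d \<noteq> 0" by (rule rat_cases)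
  have rs: "r * s = to_fract (a * c) / to_fract (b * d)" unfolding 1 2 by simp
  have bd: "b * d \<noteq> 0" using 1 2 by simp
  have "rat_comp h (r * s) = to_fract (pcompose (a * c) h) / to_fract (pcompose (b * d) h)"
    unfolding rs by (rule rat_comp_divide[OF assms bd])
  also have "\<dots> = rat_comp h r * rat_comp h s"
    unfolding 1(1) 2(1) rat_comp_divide[OF assms 1(2)] rat_comp_divide[OF assms 2(2)] by (simp add: pcompose_mult)
  finally show ?thesis .
qed

lemma rat_comp_add:
  assumes "degree h > 0"
  shows "rat_comp h (r + s) = rat_comp h r + rat_comp h s"
proof -
  obtain a b where 1: "r = to_fract a / to_fract b" "b \<noteq> 0" by (rule rat_cases)
  obtain c d where 2: "s = to_fract c / to_fract d" "d \<noteq> 0" by (rule rat_cases)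
  have rs: "r + s = to_fract (a * d + c * b) / to_fract (b * d)"
    unfolding 1(1) 2(1) to_fract_mult to_fract_add by (rule add_frac_eq) (use 1 2 in auto)
  have bd: "b * d \<noteq> 0" using 1 2 by simp
  have nz: "pcompose b h \<noteq> 0" "pcompose d h \<noteq> 0" using 1 2 assms pcompose_eq_0 by blast+
  have "rat_comp h (r + s) = to_fract (pcompose (a * d + c * b) h) / to_fract (pcompose (b * d) h)"
    unfolding rs by (rule rat_comp_divide[OF assms bd])
  also have "\<dots> = rat_comp h r + rat_comp h s"
    unfolding 1(1) 2(1) rat_comp_divide[OF assms 1(2)] rat_comp_divide[OF assms 2(2)]
    unfolding pcompose_mult pcompose_add to_fract_mult to_fract_add
    by (rule add_frac_eq [symmetric]) (use nz in auto)
  finally show ?thesis .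
qed

lemma rat_comp_sum:
  assumes "degree h > 0"
  shows "rat_comp h (sum f A) = (\<Sum>i\<in>A. rat_comp h (f i))"
  by (induction A rule: infinite_finite_induct) (simp_all add: rat_comp_add[OF assms])

lemma rat_comp_rat_comp:
  assumes "degree g > 0" "degree h > 0"
  shows "rat_comp g (rat_comp h r) = rat_comp (pcompose h g) r"
proof -
  obtain a b where 1: "r = to_fract a / to_fract b" "b \<noteq> 0" by (rule rat_cases)
  have hg: "degree (pcompose h g) > 0" using assms by (simp add: degree_pcompose)
  have bh: "pcompose b h \<noteq> 0" using 1 assms pcompose_eq_0 by blast
  show ?thesis
    unfolding 1(1) rat_comp_divide[OF assms(2) 1(2)] rat_comp_divide[OF assms(1) bh]
      rat_comp_divide[OF hg 1(2)] by (simp add: pcompose_assoc)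
qed

lemma rat_eval_comp:
  assumes "degree h > 0" "rat_regular r (poly h x)"
  shows "rat_regular (rat_comp h r) x" "rat_eval (rat_comp h r) x = rat_eval r (poly h x)"
proof -
  obtain a b where 1: "r = to_fract a / to_fract b" "poly b (poly h x) \<noteq> 0"
    using assms(2) by (rule rat_regularE)
  have "rat_comp h r = to_fract (pcompose a h) / to_fract (pcompose b h)"
    using 1 assms by (auto intro: rat_comp_divide)
  moreover have "poly (pcompose b h) x \<noteq> 0" using 1 by (simp add: poly_pcompose)
  ultimately show "rat_regular (rat_comp h r) x" "rat_eval (rat_comp h r) x = rat_eval r (poly h x)"
    using 1 by (simp_all add: rat_eval_divide poly_pcompose)
qed

section \<open>Expansion of rational functions at infinity\<close>

lemma poly_at_infinity_simps [simp]:
  "poly_at_infinity 0 = 0" "poly_at_infinity 1 = 1"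
  "poly_at_infinity (pCons c p) = fls_const c + fls_X_inv * poly_at_infinity p"
  by (simp_all add: poly_at_infinity_def map_poly_pCons map_poly_1)

lemma poly_at_infinity_add: "poly_at_infinity (p + q) = poly_at_infinity p + poly_at_infinity q"
  by (induction p q rule: poly_induct2) (simp_all add: algebra_simps add: fls_plus_const)

lemma poly_at_infinity_smult: "poly_at_infinity (Polynomial.smult c p) = fls_const c * poly_at_infinity p"
  by (induction p) (simp_all add: algebra_simps)

lemma poly_at_infinity_mult: "poly_at_infinity (p * q) = poly_at_infinity p * poly_at_infinity q"
  by (induction p) (simp_all add: algebra_simps poly_at_infinity_add poly_at_infinity_smult)

lemma poly_at_infinity_nth: "fls_nth (poly_at_infinity p) (- l) = (if l \<ge> 0 then coeff p (nat l) else 0)"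
proof (induction p arbitrary: l)
  case (pCons c p)
  have "fls_nth (poly_at_infinity (pCons c p)) (- l) = (if l = 0 then c else 0) + fls_nth (poly_at_infinity p) (- (l - 1))"
    by (simp add: fls_X_inv_times_conv_shift algebra_simps)
  then show ?case
    unfolding pCons.IH by (cases "nat l") (auto simp: coeff_pCons nat_diff_distrib split: nat.splits)
qed simp

lemma poly_at_infinity_eq_0_iff [simp]: "poly_at_infinity p = 0 \<longleftrightarrow> p = 0"
proof
  assume *: "poly_at_infinity p = 0"
  have "coeff p i = 0" for i
    using poly_at_infinity_nth[of p "int i"] by (simp add: *)
  then show "p = 0" by (simp add: poly_eq_iff)
qed simp

lemma rat_at_infinity_divide:
  assumes "b \<noteq> 0"
  shows "rat_at_infinity (to_fract a / to_fract b) = poly_at_infinity a / poly_at_infinity b"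
  unfolding rat_at_infinity_def using assms quot_of_fract_cross[OF assms, of a]
  by (auto simp: frac_eq_eq simp flip: poly_at_infinity_mult)

lemma rat_at_infinity_to_fract [simp]: "rat_at_infinity (to_fract p) = poly_at_infinity p"
  using rat_at_infinity_divide[of 1 p] by simp

lemma rat_at_infinity_0_1 [simp]: "rat_at_infinity 0 = 0" "rat_at_infinity 1 = 1"
  using rat_at_infinity_to_fract[of 0] rat_at_infinity_to_fract[of 1] by (simp_all del: rat_at_infinity_to_fract)

lemma rat_at_infinity_mult: "rat_at_infinity (r * s) = rat_at_infinity r * rat_at_infinity s"
proof -
  obtain a b where 1: "r = to_fract a / to_fract b" "b \<noteq> 0" by (rule rat_cases)
  obtain c d where 2: "s = to_fract c / to_fract d" "d \<noteq> 0" by (rule rat_cases)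
  have rs: "r * s = to_fract (a * c) / to_fract (b * d)" unfolding 1 2 by simp
  have bd: "b * d \<noteq> 0" using 1 2 by simp
  show ?thesis
    unfolding rs rat_at_infinity_divide[OF bd] unfolding 1(1) 2(1)
      rat_at_infinity_divide[OF 1(2)] rat_at_infinity_divide[OF 2(2)]
    by (simp add: poly_at_infinity_mult)
qed

lemma rat_at_infinity_add: "rat_at_infinity (r + s) = rat_at_infinity r + rat_at_infinity s"
proof -
  obtain a b where 1: "r = to_fract a / to_fract b" "b \<noteq> 0" by (rule rat_cases)
  obtain c d where 2: "s = to_fract c / to_fract d" "d \<noteq> 0" by (rule rat_cases)
  have rs: "r + s = to_fract (a * d + c * b) / to_fract (b * d)"
    unfolding 1(1) 2(1) to_fract_mult to_fract_add by (rule add_frac_eq) (use 1 2 in auto)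
  have bd: "b * d \<noteq> 0" using 1 2 by simp
  show ?thesis
    unfolding rs rat_at_infinity_divide[OF bd] unfolding 1(1) 2(1)
      rat_at_infinity_divide[OF 1(2)] rat_at_infinity_divide[OF 2(2)]
    unfolding poly_at_infinity_mult poly_at_infinity_add
    by (rule add_frac_eq [symmetric]) (use 1 2 in auto)
qed

lemma rat_at_infinity_sum: "rat_at_infinity (sum f A) = (\<Sum>i\<in>A. rat_at_infinity (f i))"
  by (induction A rule: infinite_finite_induct) (simp_all add: rat_at_infinity_add)

text \<open>Shifting commutes with expanding; this is what makes \<open>pdo_of_diffop\<close>
  multiplicative.\<close>

lemma fls_translate_rat_at_infinity:
  "fls_translate c (rat_at_infinity r) = rat_at_infinity (rat_comp [:c, 1:] r)"
proof -
  have p: "fls_translate c (poly_at_infinity p) = poly_at_infinity (pcompose p [:c, 1:])" for p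
    by (induction p) (simp_all add: pcompose_pCons poly_at_infinity_add poly_at_infinity_mult
        poly_at_infinity_smult fls_translate_add fls_translate_mult fls_translate_X_inv algebra_simps)
  obtain a b where 1: "r = to_fract a / to_fract b" "b \<noteq> 0" by (rule rat_cases)
  moreover have "pcompose b [:c, 1:] \<noteq> 0" using 1 pcompose_eq_0[of b "[:c, 1:]"] by auto
  ultimately show ?thesis
    by (simp add: rat_at_infinity_divide fls_translate_divide p rat_comp_divide)
qed

text \<open>The composition of operators, as opposed to the product of the polynomial type.\<close>

definition op_mult :: "rat_op \<Rightarrow> rat_op \<Rightarrow> rat_op" where
  "op_mult A B = (\<Sum>i\<le>degree A. \<Sum>j\<le>degree B.
     Polynomial.monom (coeff A i * rat_comp [:of_nat i, 1:] (coeff B j)) (i + j))"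

lemma coeff_op_mult:
  "coeff (op_mult A B) n = (\<Sum>i\<le>n. coeff A i * rat_comp [:of_nat i, 1:] (coeff B (n - i)))"
proof -
  let ?t = "\<lambda>i j. coeff A i * rat_comp [:of_nat i, 1:] (coeff B j)"
  have "coeff (op_mult A B) n = (\<Sum>i\<le>degree A. \<Sum>j\<le>degree B. if i + j = n then ?t i j else 0)"
    by (simp add: op_mult_def coeff_sum)
  also have "\<dots> = (\<Sum>i\<le>degree A. if i \<le> n then ?t i (n - i) else 0)"
  proof (intro sum.cong refl)
    fix i
    have "(\<Sum>j\<le>degree B. if i + j = n then ?t i j else 0) =
        (\<Sum>j\<le>degree B. if j = n - i then if i \<le> n then ?t i (n - i) else 0 else 0)"
      by (intro sum.cong) auto
    also have "\<dots> = (if i \<le> n then ?t i (n - i) else 0)"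
      by (simp add: sum.delta coeff_eq_0)
    finally show "(\<Sum>j\<le>degree B. if i + j = n then ?t i j else 0) = (if i \<le> n then ?t i (n - i) else 0)" .
  qed
  also have "\<dots> = (\<Sum>i\<le>n. ?t i (n - i))"
    by (intro sum.mono_neutral_cong) (auto simp: coeff_eq_0)
  finally show ?thesis .
qed

lemma op_mult_add_left: "op_mult (A + C) B = op_mult A B + op_mult C B"
  by (simp add: poly_eq_iff coeff_op_mult sum.distrib distrib_right)

lemma op_mult_const_left: "op_mult [:r:] B = Polynomial.smult r B"
proof (intro poly_eqI)
  fix n
  have "coeff (op_mult [:r:] B) n = (\<Sum>i\<le>n. if i = 0 then r * rat_comp [:0, 1:] (coeff B n) else 0)"
    unfolding coeff_op_mult by (intro sum.cong) (auto simp: coeff_pCons split: nat.splits)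
  moreover have "rat_comp [:0, 1:] s = s" for s
    unfolding rat_comp_def pcompose_idR rat_quot[symmetric] ..
  ultimately show "coeff (op_mult [:r:] B) n = coeff (Polynomial.smult r B) n" by (simp add: sum.delta)
qed

lemma op_mult_monic_right:
  assumes "lead_coeff B = 1" "A \<noteq> 0"
  shows "degree (op_mult A B) = degree A + degree B" "lead_coeff (op_mult A B) = lead_coeff A"
proof -
  have 0: "coeff A i * rat_comp [:of_nat i, 1:] (coeff B (n - i)) = 0"
    if "n > degree A + degree B \<or> n = degree A + degree B \<and> i \<noteq> degree A" for n i
  proof -
    have "i > degree A \<or> n - i > degree B" using that by auto
    then show ?thesis by (auto simp: coeff_eq_0)
  qed
  have "coeff (op_mult A B) (degree A + degree B) =
      (\<Sum>i\<le>degree A + degree B. if i = degree A then lead_coeff A else 0)"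
    unfolding coeff_op_mult using assms(1) 0[of "degree A + degree B"] by (intro sum.cong) auto
  then have lead: "coeff (op_mult A B) (degree A + degree B) = lead_coeff A" by (simp add: sum.delta)
  have "coeff (op_mult A B) n = 0" if "n > degree A + degree B" for n
    unfolding coeff_op_mult using 0 that by (intro sum.neutral) auto
  then have "degree (op_mult A B) \<le> degree A + degree B" by (intro degree_le) auto
  moreover have "degree (op_mult A B) \<ge> degree A + degree B" using lead assms(2) by (intro le_degree) simp
  ultimately show deg: "degree (op_mult A B) = degree A + degree B" by simp
  show "lead_coeff (op_mult A B) = lead_coeff A" unfolding deg by (rule lead)
qed

text \<open>Each step removes the top coefficient of \<open>A\<close> by subtracting
  \<open>C = r T^n\<close> composed with the monic \<open>B\<close>. The remainder is bounded
  through its coefficients, since \<open>degree R < degree B\<close> fails for \<open>R = 0\<close>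
  when \<open>degree B = 0\<close>.\<close>

lemma op_division:
  assumes "lead_coeff B = 1"
  shows "\<exists>Q R. A = op_mult Q B + R \<and> (\<forall>i\<ge>degree B. coeff R i = 0)"
proof -
  have "\<exists>Q R. A = op_mult Q B + R \<and> (\<forall>i\<ge>degree B. coeff R i = 0)" if "\<forall>i\<ge>degree B + n. coeff A i = 0" for n A
    using that
  proof (induction n arbitrary: A)
    case 0
    then show ?case by (intro exI[of _ 0] exI[of _ A]) (simp add: op_mult_def)
  next
    case (Suc n)
    define C where "C = Polynomial.monom (coeff A (degree B + n)) n"
    have C: "coeff (op_mult C B) m = (if m \<ge> n then coeff A (degree B + n) * rat_comp [:of_nat n, 1:] (coeff B (m - n)) else 0)" for m
    proof -
      have "coeff (op_mult C B) m =
          (\<Sum>i\<le>m. if i = n then coeff A (degree B + n) * rat_comp [:of_nat n, 1:] (coeff B (m - n)) else 0)"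
        unfolding coeff_op_mult C_def by (intro sum.cong) auto
      then show ?thesis by (simp add: sum.delta)
    qed
    have "\<forall>i\<ge>degree B + n. coeff (A - op_mult C B) i = 0"
    proof (intro allI impI)
      fix i assume "degree B + n \<le> i"
      then consider "i = degree B + n" | "i \<ge> degree B + Suc n" by linarith
      then show "coeff (A - op_mult C B) i = 0"
      proof cases
        case 1
        then show ?thesis using assms by (simp add: C)
      next
        case 2
        then show ?thesis using Suc.prems by (simp add: C coeff_eq_0)
      qed
    qed
    from Suc.IH[OF this] obtain Q R where "A - op_mult C B = op_mult Q B + R" "\<forall>i\<ge>degree B. coeff R i = 0" by blast
    then show ?case
      by (intro exI[of _ "Q + C"] exI[of _ R]) (simp add: op_mult_add_left algebra_simps)
  qed
  from this[of "Suc (degree A)"] show ?thesis by (simp add: coeff_eq_0)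
qed

text \<open>The anti-automorphism \<open>T \<mapsto> T\<close>, \<open>x \<mapsto> - x\<close>, which sends \<open>r(x) T\<^sup>i\<close> to \<open>T\<^sup>i r(- x) = r(- x - i) T\<^sup>i\<close>.\<close>

definition op_adj :: "rat_op \<Rightarrow> rat_op" where
  "op_adj A = (\<Sum>i\<le>degree A. Polynomial.monom (rat_comp [:- of_nat i, - 1:] (coeff A i)) i)"

lemma coeff_op_adj: "coeff (op_adj A) n = rat_comp [:- of_nat n, - 1:] (coeff A n)"
  by (simp add: op_adj_def coeff_sum coeff_eq_0)

lemma op_adj_monic:
  assumes "lead_coeff A = 1"
  shows "degree (op_adj A) = degree A" "lead_coeff (op_adj A) = 1"
proof -
  have "degree (op_adj A) \<le> degree A" by (intro degree_le) (simp add: coeff_op_adj coeff_eq_0)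
  moreover have "degree A \<le> degree (op_adj A)" using assms by (intro le_degree) (simp add: coeff_op_adj)
  ultimately show "degree (op_adj A) = degree A" by simp
  then show "lead_coeff (op_adj A) = 1" using assms by (simp add: coeff_op_adj)
qed

text \<open>The shifts match: \<open>- x - n\<close> substituted into \<open>x + i\<close> gives
  \<open>- x - (n - i)\<close>, and \<open>x + i\<close> substituted into
  \<open>- x - (n - i)\<close> gives \<open>- x - n\<close>. Exchanging \<open>i\<close> with
  \<open>n - i\<close> then reverses the factors.\<close>

lemma op_adj_mult: "op_adj (op_mult A B) = op_mult (op_adj B) (op_adj A)"
proof (intro poly_eqI)
  fix n
  have "coeff (op_adj (op_mult A B)) n =
      (\<Sum>i\<le>n. rat_comp [:- of_nat n, - 1:] (coeff A i) * rat_comp [:- of_nat (n - i), - 1:] (coeff B (n - i)))"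
    unfolding coeff_op_adj coeff_op_mult
    by (auto simp: rat_comp_sum rat_comp_mult rat_comp_rat_comp pcompose_pCons of_nat_diff intro!: sum.cong)
  also have "\<dots> = (\<Sum>i\<le>n. rat_comp [:- of_nat n, - 1:] (coeff A (n - i)) * rat_comp [:- of_nat i, - 1:] (coeff B i))"
    by (rule sum.reindex_bij_witness[of _ "\<lambda>i. n - i" "\<lambda>i. n - i"]) auto
  also have "\<dots> = coeff (op_mult (op_adj B) (op_adj A)) n"
    unfolding coeff_op_adj coeff_op_mult
    by (auto simp: rat_comp_rat_comp pcompose_pCons of_nat_diff mult.commute intro!: sum.cong)
  finally show "coeff (op_adj (op_mult A B)) n = coeff (op_mult (op_adj B) (op_adj A)) n" .
qed

lemma pdo_fls_of_diffop:
  "pdo_fls (pdo_of_diffop S) m = (if 0 \<le> m then rat_at_infinity (coeff S (nat m)) else 0)"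
  by (intro fls_eqI) (simp add: pdo_of_diffop.rep_eq)

lemma pdo_of_diffop_mult: "pdo_of_diffop (op_mult A B) = pdo_of_diffop A * pdo_of_diffop B"
proof (rule pdo_eqI)
  fix s
  have *: "pdo_fls (pdo_of_diffop A * pdo_of_diffop B) s =
      (\<Sum>m\<in>{0..s}. pdo_fls (pdo_of_diffop A) m * fls_translate (of_int m) (pdo_fls (pdo_of_diffop B) (s - m)))"
    by (rule pdo_fls_mult) (auto simp: pdo_fls_of_diffop)
  show "pdo_fls (pdo_of_diffop (op_mult A B)) s = pdo_fls (pdo_of_diffop A * pdo_of_diffop B) s"
  proof (cases "s \<ge> 0")
    case True
    then obtain n where s: "s = int n" using nonneg_int_cases by blast
    have "{0..s} = int ` {..n}"
      unfolding s using image_int_atLeastAtMost[of 0 n] by (simp add: atLeast0AtMost)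
    then have "pdo_fls (pdo_of_diffop A * pdo_of_diffop B) s =
        (\<Sum>i\<le>n. rat_at_infinity (coeff A i) * fls_translate (of_nat i) (rat_at_infinity (coeff B (n - i))))"
      unfolding * by (auto simp: sum.reindex pdo_fls_of_diffop s nat_diff_distrib intro!: sum.cong)
    then show ?thesis
      by (simp add: pdo_fls_of_diffop s coeff_op_mult rat_at_infinity_sum rat_at_infinity_mult
          fls_translate_rat_at_infinity)
  qed (simp add: * pdo_fls_of_diffop)
qed

section \<open>Action of difference operators on functions\<close>

lemma diffop_apply_bound:
  assumes "degree S \<le> N"
  shows "diffop_apply S f x = (\<Sum>i\<le>N. rat_eval (coeff S i) x * f (x + of_nat i))"
  unfolding diffop_apply_def using assms
  by (intro sum.mono_neutral_cong_left) (auto simp: coeff_eq_0)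

lemma rat_eval_coeff_nonzero: "rat_eval (coeff A i) x \<noteq> 0 \<Longrightarrow> i \<le> degree A"
  by (metis coeff_eq_0 not_le rat_eval_0_1(2))

text \<open>The coefficients of \<open>B\<close> enter at the points \<open>x + i\<close>, hence the
  regularity along the whole ray.\<close>

lemma diffop_apply_op_mult:
  assumes A: "op_regular A x" and B: "\<And>i. op_regular B (x + of_nat i)"
  shows "diffop_apply (op_mult A B) f x = diffop_apply A (diffop_apply B f) x"
proof -
  let ?N = "degree A + degree B"
  let ?t = "\<lambda>i j. rat_eval (coeff A i) x * rat_eval (coeff B j) (x + of_nat i) * f (x + of_nat i + of_nat j)"
  have "degree (op_mult A B) \<le> ?N"
  proof (rule degree_le, intro allI impI)
    fix n assume "?N < n"
    then have "i > degree A \<or> n - i > degree B" for i by linarith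
    then show "coeff (op_mult A B) n = 0" unfolding coeff_op_mult
      by (intro sum.neutral ballI) (metis coeff_eq_0 mult_zero_left mult_zero_right rat_comp_0_1(1))
  qed
  then have "diffop_apply (op_mult A B) f x = (\<Sum>n\<le>?N. rat_eval (coeff (op_mult A B) n) x * f (x + of_nat n))"
    by (rule diffop_apply_bound)
  also have "\<dots> = (\<Sum>n\<le>?N. \<Sum>i\<le>n. ?t i (n - i))"
  proof (rule sum.cong[OF refl])
    fix n
    have reg: "rat_regular (rat_comp [:of_nat i, 1:] (coeff B j)) x \<and>
        rat_eval (rat_comp [:of_nat i, 1:] (coeff B j)) x = rat_eval (coeff B j) (x + of_nat i)" for i j
      using B[of i] rat_eval_comp[of "[:of_nat i, 1:]" "coeff B j" x] by (simp add: op_regular_def add.commute)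
    have "rat_eval (coeff (op_mult A B) n) x =
        (\<Sum>i\<le>n. rat_eval (coeff A i * rat_comp [:of_nat i, 1:] (coeff B (n - i))) x)"
      unfolding coeff_op_mult using A reg by (intro rat_eval_sum[THEN conjunct2] rat_eval_mult) (auto simp: op_regular_def)
    also have "\<dots> = (\<Sum>i\<le>n. rat_eval (coeff A i) x * rat_eval (coeff B (n - i)) (x + of_nat i))"
      using A reg by (intro sum.cong) (auto simp: op_regular_def rat_eval_mult)
    finally show "rat_eval (coeff (op_mult A B) n) x * f (x + of_nat n) = (\<Sum>i\<le>n. ?t i (n - i))"
      by (auto simp: sum_distrib_right of_nat_diff intro!: sum.cong)
  qed
  also have "\<dots> = (\<Sum>(i, j)\<in>{(i, j). i + j \<le> ?N}. ?t i j)"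
    by (rule sum.triangle_reindex_eq [symmetric])
  also have "\<dots> = (\<Sum>(i, j)\<in>{..degree A} \<times> {..degree B}. ?t i j)"
  proof (rule sum.mono_neutral_right)
    have "{(i, j). i + j \<le> ?N} \<subseteq> {..?N} \<times> {..?N}" by auto
    then show "finite {(i, j). i + j \<le> ?N}" using finite_subset by blast
    show "\<forall>ij\<in>{(i, j). i + j \<le> ?N} - {..degree A} \<times> {..degree B}. (case ij of (i, j) \<Rightarrow> ?t i j) = 0"
      by (auto dest: rat_eval_coeff_nonzero)
  qed auto
  also have "\<dots> = diffop_apply A (diffop_apply B f) x"
    by (simp add: diffop_apply_def sum.cartesian_product[symmetric] sum_distrib_left mult.assoc)
  finally show ?thesis .
qed

lemma diffop_apply_add:
  assumes "op_regular A x" "op_regular B x"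
  shows "diffop_apply (A + B) f x = diffop_apply A f x + diffop_apply B f x"
proof -
  let ?N = "max (degree A) (degree B)"
  have "degree (A + B) \<le> ?N" by (rule degree_add_le_max)
  then show ?thesis
    using assms by (simp add: diffop_apply_bound[where N = ?N] op_regular_def rat_eval_add sum.distrib algebra_simps)
qed

section \<open>Quasi-exponentials\<close>

definition array_det :: "nat \<Rightarrow> (nat \<Rightarrow> nat \<Rightarrow> complex) \<Rightarrow> complex" where
  "array_det N F = Determinant.det (Matrix.mat N N (\<lambda>(i, j). F i j))"

lemma array_det_eq_0_iff:
  "array_det N F = 0 \<longleftrightarrow> (\<exists>v. (\<exists>j<N. v j \<noteq> 0) \<and> (\<forall>i<N. (\<Sum>j<N. F i j * v j) = 0))"
proof -
  let ?A = "Matrix.mat N N (\<lambda>(i, j). F i j)"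
  have "array_det N F = 0 \<longleftrightarrow> (\<exists>v. v \<in> carrier_vec N \<and> v \<noteq> 0\<^sub>v N \<and> ?A *\<^sub>v v = 0\<^sub>v N)"
    unfolding array_det_def by (rule det_0_iff_vec_prod_zero) simp
  also have "\<dots> \<longleftrightarrow> (\<exists>v. (\<exists>j<N. v j \<noteq> 0) \<and> (\<forall>i<N. (\<Sum>j<N. F i j * v j) = 0))"
  proof safe
    fix v assume v: "v \<in> carrier_vec N" "v \<noteq> 0\<^sub>v N" "?A *\<^sub>v v = 0\<^sub>v N"
    have "\<exists>j<N. vec_index v j \<noteq> 0"
    proof (rule ccontr)
      assume "\<not> (\<exists>j<N. vec_index v j \<noteq> 0)"
      then have "v = 0\<^sub>v N" using v(1) by (intro eq_vecI) auto
      then show False using v(2) by simp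
    qed
    moreover have "(\<Sum>j<N. F i j * vec_index v j) = 0" if "i < N" for i
    proof -
      have "vec_index (?A *\<^sub>v v) i = (\<Sum>j<N. F i j * vec_index v j)"
        using v(1) that by (auto simp: scalar_prod_def atLeast0LessThan intro!: sum.cong)
      then show ?thesis using v(3) that by simp
    qed
    ultimately show "\<exists>v. (\<exists>j<N. v j \<noteq> 0) \<and> (\<forall>i<N. (\<Sum>j<N. F i j * v j) = 0)" by blast
  next
    fix v j assume v: "\<forall>i<N. (\<Sum>j<N. F i j * v j) = 0" "j < N" "v j \<noteq> 0"
    let ?v = "Matrix.vec N v"
    have "?v \<noteq> 0\<^sub>v N" using v(2,3) by (metis index_vec index_zero_vec(1))
    moreover have "?A *\<^sub>v ?v = 0\<^sub>v N"
      using v(1) by (intro eq_vecI) (auto simp: scalar_prod_def atLeast0LessThan)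
    ultimately show "\<exists>v. v \<in> carrier_vec N \<and> v \<noteq> 0\<^sub>v N \<and> ?A *\<^sub>v v = 0\<^sub>v N"
      by (intro exI[of _ ?v]) simp
  qed
  finally show ?thesis .
qed

lemma array_det_transpose: "array_det N (\<lambda>i j. F j i) = array_det N F"
proof -
  have "Matrix.mat N N (\<lambda>(i, j). F j i) = transpose_mat (Matrix.mat N N (\<lambda>(i, j). F i j))"
    by (intro eq_matI) auto
  then show ?thesis unfolding array_det_def by (simp add: det_transpose[of _ N])
qed

lemma array_det_columns:
  assumes "array_det N F \<noteq> 0" "\<And>i. i < N \<Longrightarrow> (\<Sum>j<N. F i j * v j) = 0" "j < N"
  shows "v j = 0"
  using assms unfolding array_det_eq_0_iff by blast

lemma array_det_rows:
  assumes "array_det N F \<noteq> 0" "\<And>j. j < N \<Longrightarrow> (\<Sum>i<N. v i * F i j) = 0" "i < N"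
  shows "v i = 0"
  using array_det_columns[of N "\<lambda>i j. F j i" v i] array_det_transpose[of N F] assms
  by (simp add: mult.commute)

lemma array_det_mult:
  "array_det N F * array_det N G = array_det N (\<lambda>i j. \<Sum>k<N. F i k * G k j)"
proof -
  let ?F = "Matrix.mat N N (\<lambda>(i, j). F i j)" and ?G = "Matrix.mat N N (\<lambda>(i, j). G i j)"
  have "?F * ?G = Matrix.mat N N (\<lambda>(i, j). \<Sum>k<N. F i k * G k j)"
    by (intro eq_matI) (auto simp: scalar_prod_def atLeast0LessThan)
  then show ?thesis unfolding array_det_def by (simp add: det_mult[symmetric, of _ N])
qed

lemma array_det_unitriangular:
  assumes "\<And>i j. i < j \<Longrightarrow> j < N \<Longrightarrow> F i j = 0" "\<And>i. i < N \<Longrightarrow> F i i = 1"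
  shows "array_det N F = 1"
proof -
  let ?A = "Matrix.mat N N (\<lambda>(i, j). F i j)"
  have "Determinant.det ?A = prod_list (diag_mat ?A)"
    using assms(1) by (intro det_lower_triangular[of N]) auto
  also have "diag_mat ?A = replicate N 1"
    using assms(2) by (intro nth_equalityI) (auto simp: diag_mat_def)
  finally show ?thesis by (simp add: array_det_def)
qed

section \<open>Independence and spans of families of functions\<close>

lemma sum_fun_apply: "(\<Sum>i\<in>A. f i) x = (\<Sum>i\<in>A. f i x :: complex)"
  by (induction A rule: infinite_finite_induct) auto

lemma basis_family_coeffs_0:
  assumes "basis_family V I f" "finite I" "\<And>x. (\<Sum>i\<in>I. c i * f i x) = 0" "i \<in> I"
  shows "c i = 0"
proof -
  have inj: "inj_on f I" and indep: "\<not> cfun.dependent (f ` I)" using assms(1) by (auto simp: basis_family_def)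
  have "(\<Sum>v\<in>f ` I. (\<lambda>x. c (inv_into I f v) * v x)) = (\<Sum>i\<in>I. (\<lambda>x. c i * f i x))"
    by (subst sum.reindex[OF inj]) (use inj in \<open>auto intro!: sum.cong\<close>)
  also have "\<dots> = 0" using assms(3) by (auto simp: fun_eq_iff sum_fun_apply)
  finally have "c (inv_into I f (f i)) = 0"
    using indep assms(2,4) by (intro cfun.independentD[where t = "f ` I" and u = "\<lambda>v. c (inv_into I f v)"]) auto
  then show ?thesis using inj assms(4) by simp
qed

lemma basis_familyI:
  assumes "finite I" and indep: "\<And>c i. (\<And>x. (\<Sum>i\<in>I. c i * f i x) = 0) \<Longrightarrow> i \<in> I \<Longrightarrow> c i = 0"
  shows "basis_family (cfun.span (f ` I)) I f"
proof -
  have inj: "inj_on f I"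
  proof (rule inj_onI, rule ccontr)
    fix i j assume ij: "i \<in> I" "j \<in> I" "f i = f j" "i \<noteq> j"
    let ?c = "\<lambda>k. (if k = i then 1 else 0) - (if k = j then 1 else 0 :: complex)"
    have "(\<Sum>k\<in>I. ?c k * f k x) = 0" for x
      using ij assms(1) by (simp add: left_diff_distrib sum_subtractf if_distrib[of "\<lambda>u. u * _"] sum.delta cong: if_cong)
    from indep[OF this ij(1)] ij(4) show False by simp
  qed
  moreover have "\<not> cfun.dependent (f ` I)"
    unfolding cfun.dependent_finite[OF finite_imageI[OF assms(1)]]
  proof clarify
    fix u i assume i: "i \<in> I" "u (f i) \<noteq> 0" and *: "(\<Sum>v\<in>f ` I. (\<lambda>x. u v * v x)) = 0"
    have "(\<Sum>i\<in>I. u (f i) * f i x) = 0" for x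
      using fun_cong[OF *, of x] by (simp add: sum.reindex[OF inj] sum_fun_apply)
    from indep[OF this i(1)] i(2) show False by simp
  qed
  ultimately show ?thesis by (simp add: basis_family_def)
qed

lemma basis_family_dim:
  assumes "basis_family V I f"
  shows "cfun.dim V = card I"
  using assms cfun.dim_span_eq_card_independent[of "f ` I"] by (auto simp: basis_family_def card_image)

lemma span_family_coeffs:
  assumes "finite I" "g \<in> cfun.span (f ` I)"
  obtains c where "\<And>x. g x = (\<Sum>i\<in>I. c i * f i x)"
proof -
  have "\<exists>c. \<forall>x. g x = (\<Sum>i\<in>I. c i * f i x)"
    using assms(2)
  proof (rule cfun.span_induct[where P = "\<lambda>g. \<exists>c. \<forall>x. g x = (\<Sum>i\<in>I. c i * f i x)"])
    show "cfun.subspace {g. \<exists>c. \<forall>x. g x = (\<Sum>i\<in>I. c i * f i x)}"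
    proof (rule cfun.subspaceI)
      show "0 \<in> {g. \<exists>c. \<forall>x. g x = (\<Sum>i\<in>I. c i * f i x)}" by (auto intro: exI[of _ "\<lambda>_. 0"])
    next
      fix g h assume "g \<in> {g. \<exists>c. \<forall>x. g x = (\<Sum>i\<in>I. c i * f i x)}" "h \<in> {g. \<exists>c. \<forall>x. g x = (\<Sum>i\<in>I. c i * f i x)}"
      then obtain c d where "\<forall>x. g x = (\<Sum>i\<in>I. c i * f i x)" "\<forall>x. h x = (\<Sum>i\<in>I. d i * f i x)" by auto
      then show "g + h \<in> {g. \<exists>c. \<forall>x. g x = (\<Sum>i\<in>I. c i * f i x)}"
        by (auto intro!: exI[of _ "\<lambda>i. c i + d i"] simp: distrib_right sum.distrib)
    next
      fix a g assume "g \<in> {g. \<exists>c. \<forall>x. g x = (\<Sum>i\<in>I. c i * f i x)}"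
      then obtain c where "\<forall>x. g x = (\<Sum>i\<in>I. c i * f i x)" by auto
      then show "(\<lambda>x. a * g x) \<in> {g. \<exists>c. \<forall>x. g x = (\<Sum>i\<in>I. c i * f i x)}"
        by (auto intro!: exI[of _ "\<lambda>i. a * c i"] simp: sum_distrib_left mult.assoc)
    qed
  next
    fix v assume "v \<in> f ` I"
    then obtain i where "i \<in> I" "v = f i" by auto
    then show "\<exists>c. \<forall>x. v x = (\<Sum>j\<in>I. c j * f j x)"
      using assms(1) by (auto intro!: exI[of _ "\<lambda>j. if j = i then 1 else 0"] simp: if_distrib[of "\<lambda>u. u * _"] sum.delta cong: if_cong)
  qed
  then show ?thesis using that by auto
qed

text \<open>The leading coefficient is 1 at every place, so each value is determined by the
  \<open>d\<close> before it; this spreads initial zeros along a ray.\<close>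

lemma recurrence_zero:
  fixes u :: "nat \<Rightarrow> complex"
  assumes "\<And>m. (\<Sum>i\<le>d. s i m * u (m + i)) = 0" "\<And>m. s d m = 1" "\<And>j. j < d \<Longrightarrow> u j = 0"
  shows "u j = 0"
proof (induction j rule: less_induct)
  case (less j)
  show ?case
  proof (cases "j < d")
    case False
    then obtain m where j: "j = m + d" using le_Suc_ex[of d j] by (auto simp: add.commute)
    have "(\<Sum>i\<le>d. s i m * u (m + i)) = (\<Sum>i<d. s i m * u (m + i)) + u (m + d)"
      by (simp add: lessThan_Suc_atMost[symmetric] assms(2))
    then show ?thesis using less assms(1)[of m] j by simp
  qed (simp add: assms(3))
qed

lemma coeff_pcompose_shift_lead:
  fixes p :: "complex poly"
  assumes "degree p \<le> N"
  shows "coeff (pcompose p [:1, 1:]) N = coeff p N"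
proof (cases "degree p = N")
  case True
  have "lead_coeff (pcompose p [:1, 1:]) = lead_coeff p" by (subst lead_coeff_comp) auto
  then show ?thesis using True by (simp add: degree_pcompose)
next
  case False
  then show ?thesis using assms by (simp add: coeff_eq_0 degree_pcompose)
qed

text \<open>The operator \<open>T - \<alpha> b\<close> lowers the degree bound on \<open>q b\<close>
  and multiplies the top coefficient of every other \<open>q i\<close> by
  \<open>\<alpha> i - \<alpha> b\<close>, which is nonzero. Applied until \<open>q b\<close> is
  gone, it leaves the smaller index set \<open>I\<close> to the outer induction.\<close>

lemma exp_poly_zero:
  fixes \<alpha> :: "'i \<Rightarrow> complex" and q :: "'i \<Rightarrow> complex poly"
  assumes "finite I" "inj_on \<alpha> I" "\<And>i. i \<in> I \<Longrightarrow> \<alpha> i \<noteq> 0"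
    and "\<And>m::nat. (\<Sum>i\<in>I. \<alpha> i ^ m * poly (q i) (of_nat m)) = 0" "i \<in> I"
  shows "q i = 0"
proof -
  have "\<forall>i\<in>I. q i = 0"
    using assms(1-4)
  proof (induction I arbitrary: q rule: finite_induct)
    case (insert b I)
    have "\<forall>i\<in>insert b I. q i = 0"
      if "\<forall>j\<ge>N. coeff (q b) j = 0" "\<And>m. (\<Sum>i\<in>insert b I. \<alpha> i ^ m * poly (q i) (of_nat m)) = 0" for N q
      using that
    proof (induction N arbitrary: q)
      case 0
      then have "q b = 0" by (simp add: poly_eq_iff)
      moreover have "\<forall>i\<in>I. q i = 0"
        using insert.prems insert.hyps 0(2) \<open>q b = 0\<close> by (intro insert.IH) auto
      ultimately show ?case by simp
    next
      case (Suc N)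
      define q' where "q' = (\<lambda>i. Polynomial.smult (\<alpha> i) (pcompose (q i) [:1, 1:]) - Polynomial.smult (\<alpha> b) (q i))"
      have deg: "degree (q b) \<le> N" using Suc.prems(1) by (intro degree_le) auto
      have "\<forall>i\<in>insert b I. q' i = 0"
      proof (rule Suc.IH)
        show "\<forall>j\<ge>N. coeff (q' b) j = 0"
        proof (intro allI impI)
          fix j assume "N \<le> j"
          then show "coeff (q' b) j = 0"
            using deg by (cases "j = N") (auto simp: q'_def coeff_pcompose_shift_lead coeff_eq_0 degree_pcompose)
        qed
        fix m
        have "(\<Sum>i\<in>insert b I. \<alpha> i ^ m * poly (q' i) (of_nat m)) =
            (\<Sum>i\<in>insert b I. \<alpha> i ^ Suc m * poly (q i) (of_nat (Suc m))) -
            \<alpha> b * (\<Sum>i\<in>insert b I. \<alpha> i ^ m * poly (q i) (of_nat m))"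
          unfolding sum_distrib_left sum_subtractf[symmetric]
          by (intro sum.cong) (simp_all add: q'_def poly_pcompose algebra_simps)
        then show "(\<Sum>i\<in>insert b I. \<alpha> i ^ m * poly (q' i) (of_nat m)) = 0"
          by (simp only: Suc.prems(2)) simp
      qed
      moreover have "q i = 0" if "i \<in> I" "q' i = 0" for i
      proof -
        have "0 = coeff (q' i) (degree (q i))" using that by simp
        also have "\<dots> = (\<alpha> i - \<alpha> b) * lead_coeff (q i)"
          by (simp add: q'_def coeff_pcompose_shift_lead algebra_simps)
        finally show ?thesis using that insert.prems(1) insert.hyps(2) by (auto simp: inj_on_def)
      qed
      ultimately have I: "\<forall>i\<in>I. q i = 0" by auto
      have "poly (q b) (of_nat m) = 0" for m
        using Suc.prems(2)[of m] I insert.hyps insert.prems(2)[of b] by simp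
      then have "range (of_nat :: nat \<Rightarrow> complex) \<subseteq> {x. poly (q b) x = 0}" by auto
      moreover have "infinite (range (of_nat :: nat \<Rightarrow> complex))"
        by (intro range_inj_infinite) (auto simp: inj_on_def)
      ultimately have "q b = 0" using poly_roots_finite finite_subset by blast
      with I show ?case by simp
    qed
    from this[of "Suc (degree (q b))" q] insert.prems(3) show ?case by (simp add: coeff_eq_0)
  qed simp
  then show ?thesis using assms(5) by blast
qed

section \<open>Constant coefficient operators on quasi-exponentials\<close>

definition const_op_apply :: "complex poly \<Rightarrow> (complex \<Rightarrow> complex) \<Rightarrow> complex \<Rightarrow> complex" where
  "const_op_apply p f x = (\<Sum>i\<le>degree p. coeff p i * f (x + of_nat i))"

lemma const_op_apply_bound:
  "degree p \<le> N \<Longrightarrow> const_op_apply p f x = (\<Sum>i\<le>N. coeff p i * f (x + of_nat i))"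
  unfolding const_op_apply_def by (intro sum.mono_neutral_cong_left) (auto simp: coeff_eq_0)

lemma const_op_apply_add: "const_op_apply (p + q) f x = const_op_apply p f x + const_op_apply q f x"
proof -
  have "degree (p + q) \<le> max (degree p) (degree q)" by (rule degree_add_le_max)
  then show ?thesis by (simp add: const_op_apply_bound[where N = "max (degree p) (degree q)"] sum.distrib algebra_simps)
qed

lemma const_op_apply_smult: "const_op_apply (Polynomial.smult c p) f x = c * const_op_apply p f x"
  by (cases "c = 0") (simp_all add: const_op_apply_def sum_distrib_left mult.assoc)

lemma const_op_apply_pCons: "const_op_apply (pCons c p) f x = c * f x + const_op_apply p f (x + 1)"
proof -
  have "degree (pCons c p) \<le> Suc (degree p)" by (rule degree_pCons_le)
  then have "const_op_apply (pCons c p) f x = (\<Sum>i\<le>Suc (degree p). coeff (pCons c p) i * f (x + of_nat i))"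
    by (rule const_op_apply_bound)
  also have "\<dots> = c * f x + const_op_apply p f (x + 1)"
    by (subst sum.atMost_Suc_shift) (simp add: const_op_apply_def algebra_simps)
  finally show ?thesis .
qed

lemma const_op_apply_0 [simp]: "const_op_apply 0 f x = 0"
  by (simp add: const_op_apply_def)

text \<open>For constant coefficients composition is the commutative product of polynomials, so any
  factor of \<open>hat_poly\<close> may be applied first.\<close>

lemma const_op_apply_mult: "const_op_apply (p * q) f x = const_op_apply p (const_op_apply q f) x"
proof (induction p arbitrary: x)
  case (pCons c p)
  then show ?case
    by (simp add: const_op_apply_add const_op_apply_smult const_op_apply_pCons)
qed simp

lemma quasi_exp_shift:
  assumes "ln_branch l" "a \<noteq> 0"
  shows "quasi_exp l a q (x + of_nat j) = exp (x * l a) * a ^ j * poly q (x + of_nat j)"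
proof -
  have "exp (of_nat j * l a) = a ^ j"
    using assms by (simp add: exp_of_nat_mult ln_branch_def)
  then show ?thesis by (simp add: quasi_exp_def distrib_right exp_add)
qed

text \<open>On \<open>a^x q(x)\<close> the operator \<open>T - a\<close> acts as \<open>a\<close>
  times the forward difference of \<open>q\<close>, which drops the degree. Bounding coefficients
  instead of the degree lets the induction end at \<open>q = 0\<close>.\<close>

lemma linear_factor_kills:
  assumes "ln_branch l" "a \<noteq> 0" "\<And>i. i \<ge> k \<Longrightarrow> coeff q i = 0"
  shows "const_op_apply ([:- a, 1:] ^ k) (quasi_exp l a q) x = 0"
  using assms(3)
proof (induction k arbitrary: q x)
  case 0
  then have "q = 0" by (simp add: poly_eq_iff)
  then show ?case by (simp add: const_op_apply_def quasi_exp_def)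
next
  case (Suc k)
  define q' where "q' = Polynomial.smult a (pcompose q [:1, 1:] - q)"
  have "const_op_apply [:- a, 1:] (quasi_exp l a q) y = quasi_exp l a q' y" for y
    using quasi_exp_shift[OF assms(1,2), of q y 1] quasi_exp_shift[OF assms(1,2), of q y 0]
      quasi_exp_shift[OF assms(1,2), of q' y 0]
    by (simp add: const_op_apply_pCons q'_def poly_pcompose algebra_simps)
  then have "const_op_apply [:- a, 1:] (quasi_exp l a q) = quasi_exp l a q'" by blast
  moreover have "const_op_apply ([:- a, 1:] ^ k) (quasi_exp l a q') x = 0"
  proof (rule Suc.IH)
    fix i assume i: "k \<le> i"
    have "degree q \<le> k" using Suc.prems by (intro degree_le) auto
    then show "coeff q' i = 0"
      using i by (cases "i = k") (auto simp: q'_def coeff_pcompose_shift_lead coeff_eq_0 degree_pcompose)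
  qed
  ultimately show ?case unfolding power_Suc2 const_op_apply_mult by simp
qed

definition hat_poly :: "nat \<Rightarrow> (nat \<Rightarrow> complex) \<Rightarrow> (nat \<Rightarrow> nat) \<Rightarrow> complex poly" where
  "hat_poly n \<alpha> m = (\<Prod>i=1..n. [:- \<alpha> i, 1:] ^ m i)"

lemma hat_poly_monic: "lead_coeff (hat_poly n \<alpha> m) = 1" "degree (hat_poly n \<alpha> m) = (\<Sum>i=1..n. m i)"
proof -
  show "lead_coeff (hat_poly n \<alpha> m) = 1" by (simp add: hat_poly_def lead_coeff_prod lead_coeff_power)
  show "degree (hat_poly n \<alpha> m) = (\<Sum>i=1..n. m i)"
    unfolding hat_poly_def by (subst degree_prod_eq_sum_degree) (auto simp: degree_linear_power)
qed

definition hat_gen :: "(complex \<Rightarrow> complex) \<Rightarrow> (nat \<Rightarrow> complex) \<Rightarrow> nat \<times> nat \<Rightarrow> complex \<Rightarrow> complex" where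
  "hat_gen l \<alpha> = (\<lambda>(i, p). quasi_exp l (\<alpha> i) (Polynomial.monom 1 p))"

lemma hat_poly_kills_gen:
  assumes "ln_branch l" "\<alpha> i \<noteq> 0" "i \<in> {1..n}" "p < m i"
  shows "const_op_apply (hat_poly n \<alpha> m) (hat_gen l \<alpha> (i, p)) x = 0"
proof -
  have "hat_poly n \<alpha> m = (\<Prod>j\<in>{1..n} - {i}. [:- \<alpha> j, 1:] ^ m j) * [:- \<alpha> i, 1:] ^ m i"
    unfolding hat_poly_def using assms(3) by (subst prod.remove[of _ i]) (auto simp: mult.commute)
  moreover have "const_op_apply ([:- \<alpha> i, 1:] ^ m i) (hat_gen l \<alpha> (i, p)) y = 0" for y
    unfolding hat_gen_def prod.case using assms by (intro linear_factor_kills) auto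
  ultimately show ?thesis by (simp add: const_op_apply_mult) (simp add: const_op_apply_def)
qed

text \<open>Vanishing is assumed on a single ray only, which is stronger than independence of
  functions and will make the Casorati determinant nonzero at every point. The base point is
  absorbed into the polynomials \<open>Q i\<close>.\<close>

lemma hat_gen_coeffs_0:
  assumes "ln_branch l" "inj_on \<alpha> {1..n}" "\<And>i. i \<in> {1..n} \<Longrightarrow> \<alpha> i \<noteq> 0"
    and "\<And>j::nat. (\<Sum>ip\<in>(SIGMA i:{1..n}. {..<m i}). c ip * hat_gen l \<alpha> ip (x + of_nat j)) = 0"
    and ip: "i \<in> {1..n}" "p < m i"
  shows "c (i, p) = 0"
proof -
  define q where "q = (\<lambda>i. \<Sum>p<m i. Polynomial.monom (c (i, p)) p)"
  define Q where "Q = (\<lambda>i. Polynomial.smult (exp (x * l (\<alpha> i))) (pcompose (q i) [:x, 1:]))"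
  have "(\<Sum>i=1..n. \<alpha> i ^ j * poly (Q i) (of_nat j)) = 0" for j
  proof -
    have "(\<Sum>i=1..n. \<alpha> i ^ j * poly (Q i) (of_nat j)) =
        (\<Sum>i=1..n. \<Sum>p<m i. c (i, p) * hat_gen l \<alpha> (i, p) (x + of_nat j))"
      using assms(3)
      by (intro sum.cong refl)
        (simp add: Q_def q_def hat_gen_def quasi_exp_shift[OF assms(1)] poly_pcompose poly_sum poly_monom
          sum_distrib_left algebra_simps)
    also have "\<dots> = (\<Sum>ip\<in>(SIGMA i:{1..n}. {..<m i}). c ip * hat_gen l \<alpha> ip (x + of_nat j))"
      by (subst sum.Sigma) (auto intro!: sum.cong)
    finally show ?thesis using assms(4) by simp
  qed
  then have "Q i = 0" using assms(2,3) ip(1) by (intro exp_poly_zero[of "{1..n}" \<alpha> Q i]) auto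
  then have "pcompose (q i) [:x, 1:] = 0" by (simp add: Q_def)
  then have "q i = 0" by (rule pcompose_eq_0) simp
  then have "coeff (q i) p = 0" by simp
  then show ?thesis using ip(2) by (simp add: q_def coeff_sum sum.delta)
qed

lemma hat_space_eq_span:
  "hat_space l n \<alpha> \<mu> =
    cfun.span (hat_gen l \<alpha> ` (SIGMA i:{1..n}. {..<\<mu> i 1 + conj_part (\<mu> i) 1}))"
proof -
  have "{quasi_exp l (\<alpha> i) (Polynomial.monom 1 p) | i p. i \<in> {1..n} \<and> p < m i} =
      hat_gen l \<alpha> ` (SIGMA i:{1..n}. {..<m i})" for m
  proof (intro Set.set_eqI iffI)
    fix f assume "f \<in> {quasi_exp l (\<alpha> i) (Polynomial.monom 1 p) | i p. i \<in> {1..n} \<and> p < m i}"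
    then obtain i p where "f = hat_gen l \<alpha> (i, p)" "i \<in> {1..n}" "p < m i" by (auto simp: hat_gen_def)
    then show "f \<in> hat_gen l \<alpha> ` (SIGMA i:{1..n}. {..<m i})" by (intro image_eqI[of _ _ "(i, p)"]) auto
  next
    fix f assume "f \<in> hat_gen l \<alpha> ` (SIGMA i:{1..n}. {..<m i})"
    then obtain i p where "f = hat_gen l \<alpha> (i, p)" "i \<in> {1..n}" "p < m i" by auto
    then show "f \<in> {quasi_exp l (\<alpha> i) (Polynomial.monom 1 p) | i p. i \<in> {1..n} \<and> p < m i}"
      unfolding hat_gen_def by auto
  qed
  then show ?thesis unfolding hat_space_def by simp
qed

section \<open>Factorization and adjoint operators\<close>

text \<open>When the window of \<open>K\<close> starts \<open>e\<close> places after that of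
  \<open>\<Psi>\<close>, the product of the arrays is unitriangular: its entry \<open>(t, s)\<close>
  is the pairing at \<open>m = e + t - s\<close>, which is 0 for \<open>t < s\<close> and 1 for
  \<open>t = s\<close>.\<close>

lemma pairing_dets:
  fixes K \<Psi> :: "nat \<Rightarrow> int \<Rightarrow> complex"
  assumes pair: "\<And>m p. 1 \<le> m \<Longrightarrow> m \<le> e \<Longrightarrow> (\<Sum>a<e. K a (p + int m) * \<Psi> a p) = (if m = e then 1 else 0)"
  shows "array_det e (\<lambda>t a. K a (n + int t)) \<noteq> 0" "array_det e (\<lambda>a s. \<Psi> a (n + int s)) \<noteq> 0"
proof -
  have "array_det e (\<lambda>t a. K a (n + int e + int t)) * array_det e (\<lambda>a s. \<Psi> a (n + int s)) = 1" for n
    unfolding array_det_mult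
  proof (rule array_det_unitriangular)
    fix t s assume ts: "t < s" "s < e"
    then have "n + int e + int t = (n + int s) + int (e + t - s)" by simp
    then show "(\<Sum>a<e. K a (n + int e + int t) * \<Psi> a (n + int s)) = 0"
      using pair[of "e + t - s" "n + int s"] ts by (simp only:) auto
  next
    fix t assume "t < e"
    moreover have "n + int e + int t = (n + int t) + int e" by simp
    ultimately show "(\<Sum>a<e. K a (n + int e + int t) * \<Psi> a (n + int t)) = 1"
      using pair[of e "n + int t"] by (simp only:) auto
  qed
  \<comment> \<open>The second instance moves the window of \<open>K\<close> back to
    \<open>n\<close>.\<close>
  from this[of n] this[of "n - int e"]
  show "array_det e (\<lambda>t a. K a (n + int t)) \<noteq> 0" "array_det e (\<lambda>a s. \<Psi> a (n + int s)) \<noteq> 0" by auto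
qed

text \<open>
  On a lattice \<open>x + \<int>\<close> the operator \<open>\<Sum>\<^sub>i c\<^sub>i T\<^sup>i\<close> is an infinite triangular matrix. The truncated Green function \<open>G\<close> is
  its right inverse, hence also its left inverse, and the latter property yields the adjoint equation.
\<close>

lemma green_adjoint:
  fixes c K \<Psi> :: "nat \<Rightarrow> int \<Rightarrow> complex"
  assumes K: "\<And>a p. a < e \<Longrightarrow> (\<Sum>i\<le>e. c i p * K a (p + int i)) = 0"
    and c: "\<And>p. c e p = 1"
    and pair: "\<And>m p. 1 \<le> m \<Longrightarrow> m \<le> e \<Longrightarrow> (\<Sum>a<e. K a (p + int m) * \<Psi> a p) = (if m = e then 1 else 0)"
    and a: "a < e"
  shows "(\<Sum>i\<le>e. c i (n - int i) * \<Psi> a (n - int i)) = 0"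
proof -
  define G where "G = (\<lambda>m p. if m > p then \<Sum>a<e. K a m * \<Psi> a p else 0)"
  \<comment> \<open>For \<open>m > p\<close> nothing is truncated and \<open>K\<close> solves the
    equation. For \<open>m = p\<close> truncation removes the term \<open>i = 0\<close> and the
    pairing keeps only \<open>i = e\<close>. For \<open>m < p\<close> every distance
    \<open>m + i - p\<close> that survives truncation is below \<open>e\<close>, so its pairing is
    0.\<close>
  have SG: "(\<Sum>i\<le>e. c i m * G (m + int i) p) = (if m = p then 1 else 0)" for m p
  proof -
    consider "m > p" | "m = p" | "m < p" by linarith
    then show ?thesis
    proof cases
      case 1
      then have "(\<Sum>i\<le>e. c i m * G (m + int i) p) = (\<Sum>i\<le>e. \<Sum>a<e. c i m * K a (m + int i) * \<Psi> a p)"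
        by (simp add: G_def sum_distrib_left mult.assoc)
      also have "\<dots> = (\<Sum>a<e. (\<Sum>i\<le>e. c i m * K a (m + int i)) * \<Psi> a p)"
        by (subst sum.swap) (simp add: sum_distrib_right)
      finally show ?thesis using 1 K by simp
    next
      case 2
      have "c i m * G (m + int i) p = (if i = e then 1 else 0)" if "i \<le> e" for i
        using that 2 pair[of i p] a c by (auto simp: G_def)
      then have "(\<Sum>i\<le>e. c i m * G (m + int i) p) = (\<Sum>i\<le>e. if i = e then 1 else 0)" by (intro sum.cong) auto
      then show ?thesis using 2 by simp
    next
      case 3
      have "G (m + int i) p = 0" if "i \<le> e" for i
      proof (cases "m + int i > p")
        case True
        define j where "j = nat (m + int i - p)"
        have "m + int i = p + int j" "1 \<le> j" "j < e" using True 3 that by (auto simp: j_def)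
        then show ?thesis using pair[of j p] by (simp add: G_def)
      qed (simp add: G_def)
      then show ?thesis using 3 by simp
    qed
  qed
  \<comment> \<open>Column \<open>n\<close> of the product in the other order: the operator, as a
    matrix, has \<open>c i (n - i)\<close> in row \<open>n - i\<close> and column \<open>n\<close>.
    The deviation \<open>D\<close> from the identity lies in the kernel of the operator, because
    applying the operator to \<open>R\<close> returns its own column \<open>n\<close>.\<close>
  define R where "R = (\<lambda>m. \<Sum>i\<le>e. G m (n - int i) * c i (n - int i))"
  define D where "D = (\<lambda>m. R m - (if m = n then 1 else 0))"
  have rec: "(\<Sum>j\<le>e. c j m * D (m + int j)) = 0" for m
  proof -
    have "(\<Sum>j\<le>e. c j m * R (m + int j)) = (\<Sum>j\<le>e. \<Sum>i\<le>e. c j m * G (m + int j) (n - int i) * c i (n - int i))"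
      by (simp add: R_def sum_distrib_left mult.assoc)
    also have "\<dots> = (\<Sum>i\<le>e. (\<Sum>j\<le>e. c j m * G (m + int j) (n - int i)) * c i (n - int i))"
      by (subst sum.swap) (simp add: sum_distrib_right)
    also have "\<dots> = (\<Sum>i\<le>e. c i m * (if m + int i = n then 1 else 0))"
      unfolding SG by (intro sum.cong) auto
    finally show ?thesis by (simp add: D_def right_diff_distrib sum_subtractf)
  qed
  \<comment> \<open>The \<open>e\<close> rows from \<open>n - 2 * e + 1\<close> to
    \<open>n - e\<close> do not exceed any \<open>n - i\<close>, so truncation makes
    \<open>R\<close> zero there; these are the initial values of the recurrence.\<close>
  have D0: "D (n - 2 * int e + 1 + int j) = 0" for j
  proof (rule recurrence_zero[where u = "\<lambda>j. D (n - 2 * int e + 1 + int j)" and d = e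
        and s = "\<lambda>i m. c i (n - 2 * int e + 1 + int m)"])
    fix m
    show "(\<Sum>i\<le>e. c i (n - 2 * int e + 1 + int m) * D (n - 2 * int e + 1 + int (m + i))) = 0"
      using rec[of "n - 2 * int e + 1 + int m"] by (simp add: algebra_simps)
  next
    fix j assume j: "j < e"
    have "R (n - 2 * int e + 1 + int j) = 0"
      unfolding R_def by (intro sum.neutral) (use j in \<open>auto simp: G_def\<close>)
    then show "D (n - 2 * int e + 1 + int j) = 0" using j by (simp add: D_def)
  qed (simp add: c)
  \<comment> \<open>In the \<open>e\<close> rows following \<open>n\<close> nothing is truncated and
    the identity contributes 0. So \<open>D = 0\<close> there says that \<open>K\<close> pairs to
    zero with the vector of adjoint expressions.\<close>
  have det: "array_det e (\<lambda>t a. K a (n + 1 + int t)) \<noteq> 0"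
    using pair by (rule pairing_dets)
  show ?thesis
  proof (rule array_det_columns[OF det _ a, where v = "\<lambda>a. \<Sum>i\<le>e. c i (n - int i) * \<Psi> a (n - int i)"])
    fix t assume "t < e"
    have "(\<Sum>a<e. K a (n + 1 + int t) * (\<Sum>i\<le>e. c i (n - int i) * \<Psi> a (n - int i))) = R (n + 1 + int t)"
      unfolding R_def G_def sum_distrib_left by (subst sum.swap) (simp add: sum_distrib_left algebra_simps)
    also have "\<dots> = D (n + 1 + int t)" by (simp add: D_def)
    also have "\<dots> = 0" using D0[of "2 * e + t"] by (simp add: algebra_simps)
    finally show "(\<Sum>a<e. K a (n + 1 + int t) * (\<Sum>i\<le>e. c i (n - int i) * \<Psi> a (n - int i))) = 0" .
  qed
qed

section \<open>Generic lattices and passage from generic to all points\<close>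

definition lattice_regular :: "rat_op \<Rightarrow> complex \<Rightarrow> bool" where
  "lattice_regular A x \<longleftrightarrow> (\<forall>j::int. op_regular A (x + of_int j))"

lemma lattice_regular_shift:
  assumes "lattice_regular A x"
  shows "lattice_regular A (x + of_int j)" "lattice_regular A (x - of_int j)"
proof -
  have "lattice_regular A (x + of_int j)" for j
    unfolding lattice_regular_def
  proof
    fix i show "op_regular A (x + of_int j + of_int i)"
      using assms[unfolded lattice_regular_def, rule_format, of "j + i"] by (simp add: add.assoc)
  qed
  from this[of j] this[of "- j"] show "lattice_regular A (x + of_int j)" "lattice_regular A (x - of_int j)"
    by simp_all
qed

lemma lattice_regular_nat: "lattice_regular A x \<Longrightarrow> lattice_regular A (x + of_nat j)"
  using lattice_regular_shift(1)[of A x "int j"] by simp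

lemma lattice_regularD: "lattice_regular A x \<Longrightarrow> op_regular A x"
  unfolding lattice_regular_def by (drule spec[of _ 0]) simp

lemma countable_not_lattice_regular: "countable {x. \<not> lattice_regular A x}"
proof -
  have "{x. \<not> op_regular A x} \<subseteq> (\<Union>i\<le>degree A. {x. \<not> rat_regular (coeff A i) x})"
    unfolding op_regular_def by clarsimp (metis atMost_iff coeff_eq_0 not_le rat_eval_0_1(1))
  then have fin: "finite {x. \<not> op_regular A x}"
    by (rule finite_subset) (simp add: finite_not_rat_regular)
  have "{x. \<not> lattice_regular A x} \<subseteq> (\<Union>j::int. (\<lambda>x. x - of_int j) ` {x. \<not> op_regular A x})"
    by (force simp: lattice_regular_def)
  moreover have "countable (\<Union>j::int. (\<lambda>x. x - of_int j) ` {x. \<not> op_regular A x})"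
    using fin by (intro countable_UN countable_image) (auto intro: countable_finite)
  ultimately show ?thesis by (rule countable_subset)
qed

lemma countable_reflect: "countable B \<Longrightarrow> countable {x :: complex. c - x \<in> B}"
proof -
  assume "countable B"
  have "{x. c - x \<in> B} = (\<lambda>x. c - x) ` B" by force
  then show ?thesis using \<open>countable B\<close> by simp
qed

lemma rat_eq_generic:
  assumes "countable B" "\<And>x. x \<notin> B \<Longrightarrow> rat_regular r x \<and> rat_regular s x \<and> rat_eval r x = rat_eval s x"
  shows "r = s"
proof (rule rat_eval_eq_infinite)
  have "- B \<subseteq> {x. rat_regular r x \<and> rat_regular s x \<and> rat_eval r x = rat_eval s x}" using assms(2) by auto
  moreover have "infinite (- B)"
  proof
    assume "finite (- B)"
    then have "countable (B \<union> - B)" using assms(1) countable_finite countable_Un by blast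
    then show False using uncountable_UNIV_complex by simp
  qed
  ultimately show "infinite {x. rat_regular r x \<and> rat_regular s x \<and> rat_eval r x = rat_eval s x}"
    using finite_subset by blast
qed

lemma isCont_rat_eval:
  assumes "rat_regular r x"
  shows "isCont (rat_eval r) x"
  using assms unfolding rat_eval_def rat_regular_def by (intro continuous_intros) auto

lemma isCont_diffop_apply:
  assumes "op_regular A x" "continuous_on UNIV f"
  shows "isCont (diffop_apply A f) x"
proof -
  have f: "isCont f y" for y using assms(2) by (simp add: continuous_on_eq_continuous_at)
  have "isCont (\<lambda>x. f (x + of_nat i)) x" for i
    by (rule continuous_within_compose3[OF f]) (intro continuous_intros)
  then show ?thesis
    unfolding diffop_apply_def using assms(1)
    by (intro continuous_intros isCont_rat_eval) (auto simp: op_regular_def)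
qed

text \<open>A nonzero value would persist on a ball, and balls are uncountable.\<close>

lemma isCont_zero_generic:
  fixes f :: "complex \<Rightarrow> complex"
  assumes "isCont f x" "countable B" "\<And>y. y \<notin> B \<Longrightarrow> f y = 0"
  shows "f x = 0"
proof (rule ccontr)
  assume "f x \<noteq> 0"
  then have "\<forall>\<^sub>F y in nhds x. f y \<noteq> 0"
    using assms(1) by (intro tendsto_imp_eventually_ne) (auto simp: continuous_at tendsto_at_iff_tendsto_nhds)
  then obtain r where "r > 0" "\<And>y. dist y x < r \<Longrightarrow> f y \<noteq> 0" by (auto simp: eventually_nhds_metric)
  then have "ball x r \<subseteq> B" using assms(3) by (force simp: dist_commute)
  then show False using assms(2) uncountable_ball[OF \<open>r > 0\<close>, of x] countable_subset by blast
qed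

definition const_op :: "complex poly \<Rightarrow> rat_op" where
  "const_op P = map_poly (\<lambda>c. to_fract [:c:]) P"

lemma coeff_const_op [simp]: "coeff (const_op P) i = to_fract [:coeff P i:]"
  unfolding const_op_def by (subst coeff_map_poly) auto

lemma degree_const_op [simp]: "degree (const_op P) = degree P"
  unfolding const_op_def by (intro degree_map_poly) auto

lemma diffop_apply_const_op: "diffop_apply (const_op P) f x = const_op_apply P f x"
  by (simp add: diffop_apply_def const_op_apply_def)

lemma sum_lessThan_add: "(\<Sum>i<d + e. f i) = (\<Sum>i<d. f i) + (\<Sum>a<e. f (d + a :: nat) :: complex)"
  by (induction e) (simp_all add: add.assoc)

lemma reflect_span:
  assumes "f \<in> cfun.span (\<phi> ` A)"
  shows "(\<lambda>x. f (- x)) \<in> cfun.span ((\<lambda>a x. \<phi> a (- x)) ` A)"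
  using assms
proof (rule cfun.span_induct[where P = "\<lambda>f. (\<lambda>x. f (- x)) \<in> cfun.span ((\<lambda>a x. \<phi> a (- x)) ` A)"])
  show "cfun.subspace {f. (\<lambda>x. f (- x)) \<in> cfun.span ((\<lambda>a x. \<phi> a (- x)) ` A)}"
  proof (rule cfun.subspaceI)
    show "0 \<in> {f. (\<lambda>x. f (- x)) \<in> cfun.span ((\<lambda>a x. \<phi> a (- x)) ` A)}"
      using cfun.span_zero by (simp add: zero_fun_def)
  next
    fix f g assume "f \<in> {f. (\<lambda>x. f (- x)) \<in> cfun.span ((\<lambda>a x. \<phi> a (- x)) ` A)}"
      "g \<in> {f. (\<lambda>x. f (- x)) \<in> cfun.span ((\<lambda>a x. \<phi> a (- x)) ` A)}"
    then show "f + g \<in> {f. (\<lambda>x. f (- x)) \<in> cfun.span ((\<lambda>a x. \<phi> a (- x)) ` A)}"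
      using cfun.span_add by (auto simp: plus_fun_def)
  next
    fix c f assume "f \<in> {f. (\<lambda>x. f (- x)) \<in> cfun.span ((\<lambda>a x. \<phi> a (- x)) ` A)}"
    then show "(\<lambda>x. c * f x) \<in> {f. (\<lambda>x. f (- x)) \<in> cfun.span ((\<lambda>a x. \<phi> a (- x)) ` A)}"
      using cfun.span_scale[of "\<lambda>x. f (- x)" _ c] by simp
  qed
next
  fix f assume "f \<in> \<phi> ` A"
  then show "(\<lambda>x. f (- x)) \<in> cfun.span ((\<lambda>a x. \<phi> a (- x)) ` A)" by (auto intro: cfun.span_base)
qed

lemma reflect_span_eq:
  "{\<lambda>x. f (- x) | f. f \<in> cfun.span (\<phi> ` A)} = cfun.span ((\<lambda>a x. \<phi> a (- x)) ` A)"
proof safe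
  fix h assume "h \<in> cfun.span ((\<lambda>a x. \<phi> a (- x)) ` A)"
  from reflect_span[OF this] show "\<exists>f. h = (\<lambda>x. f (- x)) \<and> f \<in> cfun.span (\<phi> ` A)"
    by (intro exI[of _ "\<lambda>x. h (- x)"]) simp
qed (rule reflect_span)

text \<open>The first \<open>d\<close> functions \<open>g\<close> stand for a basis of
  \<open>U\<close>, the other \<open>e\<close> for its completion to a basis of
  \<open>hat_space\<close>; \<open>\<psi>\<close> is the last row of the inverse Casorati matrix of
  \<open>g\<close>. Shifts in the pairing start at \<open>m = 1\<close> because of the outer
  \<open>T\<close> in the definition of \<open>Q(U)\<close>.\<close>

locale factorization_setup =
  fixes g \<psi> :: "nat \<Rightarrow> complex \<Rightarrow> complex" and d e :: nat and S :: rat_op and P :: "complex poly"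
  assumes P: "lead_coeff P = 1" "degree P = d + e"
    and P_kills: "\<And>i x. i < d + e \<Longrightarrow> const_op_apply P (g i) x = 0"
    and nonsingular: "\<And>x. array_det (d + e) (\<lambda>i j. g i (x + of_nat j)) \<noteq> 0"
    and S: "lead_coeff S = 1" "degree S = d"
    and S_kills: "\<And>i x. i < d \<Longrightarrow> op_regular S x \<Longrightarrow> diffop_apply S (g i) x = 0"
    and pair: "\<And>m x. 1 \<le> m \<Longrightarrow> m \<le> d + e \<Longrightarrow>
      (\<Sum>i<d + e. g i (x + of_nat m) * \<psi> i x) = (if m = d + e then 1 else 0)"
    and cont: "\<And>a. a < e \<Longrightarrow> continuous_on UNIV (\<psi> (d + a))"
begin

text \<open>A combination of the first \<open>d\<close> functions with zeros at \<open>d\<close>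
  consecutive points would vanish along the whole ray by the recurrence of \<open>S\<close>.
  Extended by zero, it would be a dependence between rows of the nonsingular matrix of size
  \<open>d + e\<close>.\<close>

lemma casorati_kernel:
  assumes "lattice_regular S x"
  shows "array_det d (\<lambda>i j. g i (x + of_nat j)) \<noteq> 0"
proof
  assume "array_det d (\<lambda>i j. g i (x + of_nat j)) = 0"
  then have "array_det d (\<lambda>i j. g j (x + of_nat i)) = 0"
    using array_det_transpose[of d "\<lambda>i j. g i (x + of_nat j)"] by simp
  then obtain v j where v: "j < d" "v j \<noteq> 0" "\<And>i. i < d \<Longrightarrow> (\<Sum>j<d. g j (x + of_nat i) * v j) = 0"
    unfolding array_det_eq_0_iff by auto
  define u where "u = (\<lambda>m. \<Sum>j<d. g j (x + of_nat m) * v j)"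
  have "u m = 0" for m
  proof (rule recurrence_zero[where u = u and d = d and s = "\<lambda>i m. rat_eval (coeff S i) (x + of_nat m)"])
    fix m
    have reg: "op_regular S (x + of_nat m)" using lattice_regularD lattice_regular_nat assms by blast
    have "(\<Sum>i\<le>d. rat_eval (coeff S i) (x + of_nat m) * u (m + i)) =
        (\<Sum>i\<le>d. \<Sum>j<d. rat_eval (coeff S i) (x + of_nat m) * g j (x + of_nat m + of_nat i) * v j)"
      by (simp add: u_def sum_distrib_left mult.assoc add.assoc)
    also have "\<dots> = (\<Sum>j<d. diffop_apply S (g j) (x + of_nat m) * v j)"
      by (subst sum.swap) (simp add: diffop_apply_def S sum_distrib_right)
    also have "\<dots> = 0" using S_kills reg by simp
    finally show "(\<Sum>i\<le>d. rat_eval (coeff S i) (x + of_nat m) * u (m + i)) = 0" .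
    show "rat_eval (coeff S d) (x + of_nat m) = 1" using S by simp
  qed (use v(3) in \<open>simp add: u_def\<close>)
  then have "(if j < d then v j else 0) = 0"
    using v(1) by (intro array_det_rows[OF nonsingular[of x], where v = "\<lambda>i. if i < d then v i else 0"])
      (auto simp: sum_lessThan_add u_def mult.commute)
  with v show False by simp
qed

text \<open>The remainder of the right division by \<open>S\<close> kills the first \<open>d\<close>
  functions, as \<open>P\<close> and \<open>S\<close> both do. Its order is below \<open>d\<close>,
  so \<open>casorati_kernel\<close> makes it zero at generic points.\<close>

lemma factorization: "\<exists>Q. op_mult Q S = const_op P"
proof -
  obtain Q R where QR: "const_op P = op_mult Q S + R" and R: "\<And>i. i \<ge> d \<Longrightarrow> coeff R i = 0"
    using op_division[OF S(1), of "const_op P"] S(2) by auto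
  let ?B = "{x. \<not> lattice_regular S x} \<union> {x. \<not> lattice_regular Q x} \<union> {x. \<not> lattice_regular R x}
    \<union> {x. \<not> lattice_regular (op_mult Q S) x}"
  have B: "countable ?B" by (intro countable_Un countable_not_lattice_regular)
  have "coeff R i = 0" if "i < d" for i
  proof (rule rat_eq_generic[OF B], intro conjI)
    fix x assume x: "x \<notin> ?B"
    then show regR: "rat_regular (coeff R i) x" using lattice_regularD[of R x] by (simp add: op_regular_def)
    have degR: "degree R \<le> d" using R by (intro degree_le) auto
    have "diffop_apply R (g j) x = 0" if "j < d" for j
    proof -
      have S0: "diffop_apply S (g j) (x + of_nat m) = 0" for m
        using x that by (auto intro!: S_kills lattice_regularD lattice_regular_nat)
      have "0 = diffop_apply (op_mult Q S + R) (g j) x"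
        unfolding QR[symmetric] diffop_apply_const_op using P_kills that by simp
      also have "\<dots> = diffop_apply Q (diffop_apply S (g j)) x + diffop_apply R (g j) x"
        using x by (subst diffop_apply_add)
          (auto intro!: lattice_regularD lattice_regular_nat diffop_apply_op_mult)
      also have "diffop_apply Q (diffop_apply S (g j)) x = 0"
        unfolding diffop_apply_def[of Q] using S0 by simp
      finally show ?thesis by simp
    qed
    then have "(\<Sum>i<d. g j (x + of_nat i) * rat_eval (coeff R i) x) = 0" if "j < d" for j
      using that diffop_apply_bound[OF degR, of "g j" x] R
      by (simp add: lessThan_Suc_atMost[symmetric] mult.commute)
    then have "rat_eval (coeff R i) x = 0"
      using array_det_columns[OF casorati_kernel, of x "\<lambda>i. rat_eval (coeff R i) x" i] x that by auto
    then show "rat_eval (coeff R i) x = rat_eval 0 x" by simp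
  qed simp
  then have "R = 0" using R by (metis leI poly_eqI coeff_0)
  with QR show ?thesis by auto
qed

text \<open>Applying \<open>S\<close> to the pairing in the shifted variable removes the first
  \<open>d\<close> terms. Among the total shifts \<open>m + j\<close> only \<open>j = d\<close> with
  \<open>m = e\<close> reaches \<open>d + e\<close>, and there the coefficient of \<open>S\<close>
  is 1.\<close>

lemma kernel_pairing:
  assumes "lattice_regular S x" "1 \<le> m" "m \<le> e"
  shows "(\<Sum>a<e. diffop_apply S (g (d + a)) (x + of_nat m) * \<psi> (d + a) x) = (if m = e then 1 else 0)"
proof -
  have reg: "op_regular S (x + of_nat m)" using lattice_regularD lattice_regular_nat assms by blast
  have "(\<Sum>a<e. diffop_apply S (g (d + a)) (x + of_nat m) * \<psi> (d + a) x) =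
      (\<Sum>i<d + e. diffop_apply S (g i) (x + of_nat m) * \<psi> i x)"
    using S_kills reg by (simp add: sum_lessThan_add)
  also have "\<dots> = (\<Sum>i<d + e. \<Sum>j\<le>d. rat_eval (coeff S j) (x + of_nat m) * (g i (x + of_nat (m + j)) * \<psi> i x))"
    by (simp add: diffop_apply_def S sum_distrib_left algebra_simps)
  also have "\<dots> = (\<Sum>j\<le>d. rat_eval (coeff S j) (x + of_nat m) * (\<Sum>i<d + e. g i (x + of_nat (m + j)) * \<psi> i x))"
    by (subst sum.swap) (simp add: sum_distrib_left)
  also have "\<dots> = (\<Sum>j\<le>d. if j = d then if m = e then 1 else 0 else 0)"
  proof (intro sum.cong refl)
    fix j assume "j \<in> {..d}"
    then have "(\<Sum>i<d + e. g i (x + of_nat (m + j)) * \<psi> i x) = (if m + j = d + e then 1 else 0)"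
      using assms by (intro pair) auto
    then show "rat_eval (coeff S j) (x + of_nat m) * (\<Sum>i<d + e. g i (x + of_nat (m + j)) * \<psi> i x) =
        (if j = d then if m = e then 1 else 0 else 0)"
      using S assms \<open>j \<in> {..d}\<close> by auto
  qed
  also have "\<dots> = (if m = e then 1 else 0)" by (simp add: sum.delta)
  finally show ?thesis .
qed

lemma lattice_pairing:
  assumes "lattice_regular S x" "1 \<le> m" "m \<le> e"
  shows "(\<Sum>a<e. diffop_apply S (g (d + a)) (x + of_int (p + int m)) * \<psi> (d + a) (x + of_int p)) =
    (if m = e then 1 else 0)"
  using kernel_pairing[OF lattice_regular_shift(1)[OF assms(1), of p] assms(2,3)] by (simp add: add.assoc)

lemma casorati_cokernel:
  assumes "lattice_regular S x"
  shows "array_det e (\<lambda>a s. \<psi> (d + a) (x + of_nat s)) \<noteq> 0"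
  using pairing_dets(2)[of e "\<lambda>a p. diffop_apply S (g (d + a)) (x + of_int p)" "\<lambda>a p. \<psi> (d + a) (x + of_int p)" 0,
    OF lattice_pairing[OF assms]] by simp

lemma factor_monic:
  assumes "op_mult Q S = const_op P"
  shows "lead_coeff Q = 1" "degree Q = e"
proof -
  have "P \<noteq> 0" using P(1) by auto
  then have "const_op P \<noteq> 0" using degree_const_op coeff_const_op
    by (metis P(1) coeff_0 one_pCons to_fract_1 zero_neq_one)
  then have "Q \<noteq> 0" using assms by (auto simp: op_mult_def)
  from op_mult_monic_right[OF S(1) this] show "lead_coeff Q = 1" "degree Q = e"
    using assms P S(2) by (auto simp flip: one_pCons)
qed

text \<open>The functions \<open>diffop_apply S (g (d + a))\<close> lie in the kernel of
  \<open>Q\<close>, since \<open>P\<close> kills \<open>g\<close>. Together with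
  \<open>lattice_pairing\<close> this is the situation of \<open>green_adjoint\<close> on the
  lattice of \<open>x\<close>.\<close>

lemma adjoint_kills_generic:
  assumes Q: "op_mult Q S = const_op P" and x: "lattice_regular S x" "lattice_regular Q x" and "a < e"
  shows "(\<Sum>i\<le>e. rat_eval (coeff Q i) (x - of_nat i) * \<psi> (d + a) (x - of_nat i)) = 0"
proof -
  let ?c = "\<lambda>i p. rat_eval (coeff Q i) (x + of_int p)"
  let ?K = "\<lambda>a p. diffop_apply S (g (d + a)) (x + of_int p)"
  let ?\<Psi> = "\<lambda>a p. \<psi> (d + a) (x + of_int p)"
  have "(\<Sum>i\<le>e. ?c i (0 - int i) * ?\<Psi> a (0 - int i)) = 0"
  proof (rule green_adjoint[where c = ?c and K = ?K and \<Psi> = ?\<Psi>])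
    fix a p assume "a < e"
    have S: "op_regular S (x + of_int p + of_nat i)" for i
      by (intro lattice_regularD lattice_regular_nat lattice_regular_shift x(1))
    have "diffop_apply Q (diffop_apply S (g (d + a))) (x + of_int p) = diffop_apply (op_mult Q S) (g (d + a)) (x + of_int p)"
      by (intro diffop_apply_op_mult[symmetric] S lattice_regularD[of Q] lattice_regular_shift x(2))
    also have "\<dots> = 0" unfolding Q diffop_apply_const_op using \<open>a < e\<close> by (intro P_kills) simp
    finally show "(\<Sum>i\<le>e. ?c i p * ?K a (p + int i)) = 0"
      unfolding diffop_apply_def[of Q] factor_monic(2)[OF Q] by (simp add: add.assoc)
  next
    show "?c e p = 1" for p using factor_monic[OF Q] by simp
  next
    fix m p assume "1 \<le> m" "m \<le> e"
    then show "(\<Sum>a<e. ?K a (p + int m) * ?\<Psi> a p) = (if m = e then 1 else 0)"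
      by (rule lattice_pairing[OF x(1)])
  qed fact
  then show ?thesis by simp
qed

lemma adj_generic:
  assumes "lattice_regular Q (- x)"
  shows "rat_regular (coeff (op_adj Q) i) x"
    and "rat_eval (coeff (op_adj Q) i) x = rat_eval (coeff Q i) (- x - of_nat i)"
proof -
  have "op_regular Q (- x - of_int (int i))"
    using assms by (intro lattice_regularD lattice_regular_shift)
  then have "rat_regular (coeff Q i) (poly [:- of_nat i, - 1:] x)"
    by (simp add: op_regular_def algebra_simps)
  from rat_eval_comp[OF _ this] show "rat_regular (coeff (op_adj Q) i) x"
    "rat_eval (coeff (op_adj Q) i) x = rat_eval (coeff Q i) (- x - of_nat i)"
    by (simp_all add: coeff_op_adj algebra_simps)
qed

definition W :: "(complex \<Rightarrow> complex) set" where
  "W = cfun.span ((\<lambda>a x. \<psi> (d + a) (- x)) ` {..<e})"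

text \<open>The lattice argument covers generic points only, whereas \<open>is_fund_diffop\<close>
  asks for every point where the operator is regular; continuity of the generators closes the
  gap.\<close>

lemma adjoint_kills:
  assumes Q: "op_mult Q S = const_op P" and "f \<in> W" and reg: "op_regular (op_adj Q) x"
  shows "diffop_apply (op_adj Q) f x = 0"
proof -
  have gen: "diffop_apply (op_adj Q) (\<lambda>x. \<psi> (d + a) (- x)) x = 0" if a: "a < e" for a
  proof (rule isCont_zero_generic[where f = "diffop_apply (op_adj Q) (\<lambda>x. \<psi> (d + a) (- x))"
        and B = "{y. 0 - y \<in> {x. \<not> lattice_regular S x} \<union> {x. \<not> lattice_regular Q x}}"])
    have "continuous_on UNIV (\<lambda>x. \<psi> (d + a) (- x))"
      by (rule continuous_on_compose2[OF cont[OF a]]) (auto intro!: continuous_intros)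
    then show "isCont (diffop_apply (op_adj Q) (\<lambda>x. \<psi> (d + a) (- x))) x" using reg by (rule isCont_diffop_apply[rotated])
    show "countable {y. 0 - y \<in> {x. \<not> lattice_regular S x} \<union> {x. \<not> lattice_regular Q x}}"
      by (intro countable_reflect countable_Un countable_not_lattice_regular)
    fix y assume "y \<notin> {y. 0 - y \<in> {x. \<not> lattice_regular S x} \<union> {x. \<not> lattice_regular Q x}}"
    then have y: "lattice_regular S (- y)" "lattice_regular Q (- y)" by auto
    have "degree (op_adj Q) = e" using op_adj_monic factor_monic[OF Q] by simp
    then show "diffop_apply (op_adj Q) (\<lambda>x. \<psi> (d + a) (- x)) y = 0"
      using adjoint_kills_generic[OF Q y a] adj_generic(2)[OF y(2)] by (simp add: diffop_apply_def)
  qed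
  obtain c where c: "\<And>x. f x = (\<Sum>a<e. c a * \<psi> (d + a) (- x))"
    using assms(2) unfolding W_def by (rule span_family_coeffs[rotated]) auto
  have "diffop_apply (op_adj Q) f x = (\<Sum>a<e. c a * diffop_apply (op_adj Q) (\<lambda>x. \<psi> (d + a) (- x)) x)"
    unfolding diffop_apply_def c sum_distrib_left by (subst sum.swap) (simp add: algebra_simps)
  then show ?thesis using gen by simp
qed

text \<open>A relation between the generators would be a dependence of the rows in
  \<open>casorati_cokernel\<close> at a lattice-regular point, and one such point exists by
  countability.\<close>

lemma dim_W: "cfun.dim W = e"
proof -
  obtain x where x: "lattice_regular S x"
    using countable_not_lattice_regular[of S] uncountable_UNIV_complex
    by (metis (mono_tags, lifting) UNIV_eq_I mem_Collect_eq)
  have "basis_family W {..<e} (\<lambda>a x. \<psi> (d + a) (- x))"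
    unfolding W_def
  proof (rule basis_familyI)
    fix c i assume *: "\<And>x. (\<Sum>i<e. c i * \<psi> (d + i) (- x)) = 0" "i \<in> {..<e}"
    show "c i = 0"
    proof (rule array_det_rows[OF casorati_cokernel[OF x]])
      fix j show "(\<Sum>i<e. c i * \<psi> (d + i) (x + of_nat j)) = 0"
        using *(1)[of "- (x + of_nat j)"] by (simp only: minus_minus)
    qed (use * in auto)
  qed simp
  from basis_family_dim[OF this] show ?thesis by simp
qed

text \<open>For uniqueness, two monic operators of order \<open>e\<close> killing \<open>W\<close>
  differ by an operator of lower order; at a generic point its coefficients solve a homogeneous
  system with the nonsingular matrix of \<open>casorati_cokernel\<close>.\<close>

theorem fund_diffop_W:
  assumes Q: "op_mult Q S = const_op P"
  shows "fund_diffop W = op_adj Q"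
  unfolding fund_diffop_def
proof (rule the_equality)
  show "is_fund_diffop W (op_adj Q)"
    unfolding is_fund_diffop_def using adjoint_kills[OF Q] dim_W op_adj_monic[of Q] factor_monic[OF Q] by simp
next
  fix A assume A: "is_fund_diffop W A"
  then have degA: "degree A = e" "lead_coeff A = 1" by (auto simp: is_fund_diffop_def dim_W)
  have degQ: "degree (op_adj Q) = e" "lead_coeff (op_adj Q) = 1"
    using op_adj_monic[of Q] factor_monic[OF Q] by auto
  let ?T = "op_adj Q"
  let ?B = "{x. \<not> lattice_regular A x} \<union> {x. \<not> lattice_regular ?T x} \<union> {x. - of_nat (e - 1) - x \<in> {x. \<not> lattice_regular S x}}"
  have B: "countable ?B" by (intro countable_Un countable_not_lattice_regular countable_reflect)
  show "A = op_adj Q"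
  proof (rule poly_eqI)
    fix i
    consider "i < e" | "i = e" | "i > e" by linarith
    then show "coeff A i = coeff ?T i"
    proof cases
      case 1
      show ?thesis
      proof (rule rat_eq_generic[OF B], intro conjI)
        fix x assume x: "x \<notin> ?B"
        have reg: "op_regular A x" "op_regular ?T x" using x by (auto intro: lattice_regularD)
        then show "rat_regular (coeff A i) x" "rat_regular (coeff ?T i) x" by (auto simp: op_regular_def)
        \<comment> \<open>The points \<open>- (x + i)\<close> with \<open>i < e\<close>, read
          backwards, are \<open>y + s\<close> with \<open>s = e - 1 - i\<close>.\<close>
        define y where "y = - of_nat (e - 1) - x"
        define v where "v = (\<lambda>i. rat_eval (coeff A i) x - rat_eval (coeff ?T i) x)"
        have y: "lattice_regular S y" using x by (simp add: y_def)
        have "(\<Sum>s<e. \<psi> (d + a) (y + of_nat s) * v (e - 1 - s)) = 0" if a: "a < e" for a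
        proof -
          let ?f = "\<lambda>x. \<psi> (d + a) (- x)"
          have f: "?f \<in> W" unfolding W_def using a by (intro cfun.span_base) auto
          have "0 = diffop_apply A ?f x - diffop_apply ?T ?f x"
            using A f reg adjoint_kills[OF Q f reg(2)] by (auto simp: is_fund_diffop_def)
          also have "\<dots> = (\<Sum>i<e. v i * \<psi> (d + a) (- (x + of_nat i)))"
            using degA degQ
            by (simp add: diffop_apply_def lessThan_Suc_atMost[symmetric] v_def left_diff_distrib sum_subtractf)
          also have "\<dots> = (\<Sum>s<e. v (e - Suc s) * \<psi> (d + a) (- (x + of_nat (e - Suc s))))"
            by (rule sum.nat_diff_reindex [symmetric])
          also have "\<dots> = (\<Sum>s<e. \<psi> (d + a) (y + of_nat s) * v (e - 1 - s))"
            by (intro sum.cong) (auto simp: y_def of_nat_diff algebra_simps)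
          finally show ?thesis by simp
        qed
        then have "v (e - 1 - s) = 0" if "s < e" for s
          using array_det_columns[OF casorati_cokernel[OF y], of "\<lambda>s. v (e - 1 - s)" s] that by auto
        from this[of "e - 1 - i"] show "rat_eval (coeff A i) x = rat_eval (coeff ?T i) x"
          using 1 by (simp add: v_def)
      qed
    qed (use degA degQ in \<open>auto simp: coeff_eq_0\<close>)
  qed
qed

end

section \<open>Inversion of the fundamental operators\<close>

lemma pdo_of_diffop_add: "pdo_of_diffop (A + B) = pdo_of_diffop A + pdo_of_diffop B"
  by (rule pdo_eqI) (simp add: pdo_fls_of_diffop rat_at_infinity_add)

lemma pdo_of_diffop_0_1: "pdo_of_diffop 0 = 0" "pdo_of_diffop 1 = 1"
  by (rule pdo_eqI; auto simp: pdo_fls_of_diffop pdo_fls_1 nat_eq_iff2)+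

lemma pdo_of_diffop_sum: "pdo_of_diffop (sum f I) = (\<Sum>i\<in>I. pdo_of_diffop (f i))"
  by (induction I rule: infinite_finite_induct) (simp_all add: pdo_of_diffop_add pdo_of_diffop_0_1)

text \<open>Cancel \<open>Q\<close> on the right in \<open>Q * P * Q = Q\<close>; there are no zero
  divisors.\<close>

lemma pdo_right_inverse:
  fixes P Q :: pdo
  assumes "P * Q = 1"
  shows "Q * P = 1"
proof -
  have "Q * P * Q = Q" using assms by (simp add: mult.assoc)
  then have "(Q * P - 1) * Q = 0" by (simp add: left_diff_distrib)
  moreover have "Q \<noteq> 0" using assms by auto
  ultimately show ?thesis by simp
qed

lemma pdo_inverse_eq:
  assumes "P * Q = 1"
  shows "pdo_inverse P = Q"
  unfolding pdo_inverse_def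
proof (rule the_equality)
  show "P * Q = 1 \<and> Q * P = 1" using assms pdo_right_inverse by blast
  fix R assume "P * R = 1 \<and> R * P = 1"
  then have "R = R * (P * Q)" using assms by simp
  also have "\<dots> = Q" using \<open>P * R = 1 \<and> R * P = 1\<close> by (simp flip: mult.assoc)
  finally show "R = Q" .
qed

text \<open>Laurent series in the inverse of \<open>T\<close> with constant coefficients form a
  field inside the algebra; a nonzero \<open>p(T)\<close> is inverted there.\<close>

lift_definition pdo_of_fls_T :: "complex fls \<Rightarrow> pdo" is
  "\<lambda>F l m. if l = 0 then fls_nth F (- m) else 0"
proof (intro exI allI impI)
  fix F :: "complex fls" and l m :: int
  assume "(if l = 0 then fls_nth F (- m) else 0) \<noteq> 0"
  then show "l \<le> 0 \<and> m \<le> - fls_subdegree F"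
    using fls_subdegree_leI[of F "- m"] by (auto split: if_splits)
qed

lemma pdo_fls_of_fls_T: "pdo_fls (pdo_of_fls_T F) m = fls_const (fls_nth F (- m))"
  by (intro fls_eqI) (simp add: pdo_of_fls_T.rep_eq)

lemma pdo_of_fls_T_mult: "pdo_of_fls_T (F * G) = pdo_of_fls_T F * pdo_of_fls_T G"
proof (rule pdo_eqI)
  fix s
  define N where "N = - fls_subdegree F"
  define N' where "N' = - fls_subdegree G"
  have F: "\<forall>m>N. pdo_fls (pdo_of_fls_T F) m = 0" and G: "\<forall>m>N'. pdo_fls (pdo_of_fls_T G) m = 0"
    by (auto simp: pdo_fls_of_fls_T N_def N'_def)
  have "fls_nth (F * G) (- s) = (\<Sum>m=s-N'..N. fls_nth F (- m) * fls_nth G (- (s - m)))"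
    by (rule fls_mult_nth_bounds) (auto simp: N_def N'_def)
  moreover have "fls_const (\<Sum>m\<in>A. f m) = (\<Sum>m\<in>A. fls_const (f m))" for A and f :: "int \<Rightarrow> complex"
    by (induction A rule: infinite_finite_induct) (simp_all flip: fls_plus_const)
  ultimately show "pdo_fls (pdo_of_fls_T (F * G)) s = pdo_fls (pdo_of_fls_T F * pdo_of_fls_T G) s"
    using pdo_fls_mult_bounded[OF F G, of "s - N'" s N] by (simp add: pdo_fls_of_fls_T)
qed

lemma pdo_poly_T_const_op: "pdo_poly_T p = pdo_of_diffop (const_op p)"
  by (simp add: pdo_poly_T_def const_op_def)

lemma pdo_poly_T_eq: "pdo_poly_T p = pdo_of_fls_T (poly_at_infinity p)"
  unfolding pdo_poly_T_const_op
  by (rule pdo_eqI) (auto simp: pdo_fls_of_diffop pdo_fls_of_fls_T poly_at_infinity_nth)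

lemma pdo_poly_T_mult: "pdo_poly_T (p * q) = pdo_poly_T p * pdo_poly_T q"
  by (simp add: pdo_poly_T_eq poly_at_infinity_mult pdo_of_fls_T_mult)

lemma pdo_poly_T_inverse:
  assumes "p \<noteq> 0"
  shows "pdo_poly_T p * pdo_inverse (pdo_poly_T p) = 1"
proof -
  have "pdo_of_fls_T 1 = 1"
    by (rule pdo_eqI) (auto simp: pdo_fls_of_fls_T pdo_fls_1)
  then have "pdo_poly_T p * pdo_of_fls_T (inverse (poly_at_infinity p)) = 1"
    using assms by (simp add: pdo_poly_T_eq flip: pdo_of_fls_T_mult)
  with pdo_inverse_eq[OF this] show ?thesis by simp
qed

text \<open>The inverse is again a difference operator with rational coefficients, namely
  multiplication by \<open>1 / q\<close>.\<close>

lemma pdo_poly_x_inverse: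
  assumes "q \<noteq> 0"
  shows "pdo_poly_x q * pdo_inverse (pdo_poly_x q) = 1"
proof -
  have "pdo_poly_x q * pdo_of_diffop [:inverse (to_fract q):] = pdo_of_diffop 1"
    unfolding pdo_poly_x_def pdo_of_diffop_mult[symmetric] op_mult_const_left using assms
    by (simp add: one_pCons)
  then have *: "pdo_poly_x q * pdo_of_diffop [:inverse (to_fract q):] = 1"
    by (simp add: pdo_of_diffop_0_1)
  with pdo_inverse_eq[OF *] show ?thesis by simp
qed

lemma op_adj_sum: "op_adj (sum f I) = (\<Sum>i\<in>I. op_adj (f i))"
  by (rule poly_eqI) (simp add: coeff_op_adj coeff_sum rat_comp_sum)

lemma op_adj_const_op: "op_adj (const_op P) = const_op P"
  by (rule poly_eqI) (simp add: coeff_op_adj rat_comp_to_fract)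

lemma op_adj_const: "op_adj [:to_fract p:] = [:to_fract (pcompose p [:0, - 1:]):]"
  by (rule poly_eqI) (auto simp: coeff_op_adj coeff_pCons rat_comp_to_fract split: nat.splits)

text \<open>The adjoint of \<open>x^a T^i\<close> is \<open>T^i (- x)^a\<close>, the shape of the
  terms of \<open>pdo_tau\<close>. Hence \<open>pdo_tau\<close> is the adjoint of
  \<open>q S\<close>, and reversing the factors puts \<open>q(- x)\<close> on the right, where its
  inverse stands in \<open>fund_pdo_quasi_poly\<close>.\<close>

lemma pdo_tau_eq:
  assumes "Polynomial.smult (to_fract q) S =
    (\<Sum>i\<le>m. \<Sum>a\<le>d. Polynomial.monom (to_fract (Polynomial.monom (A i a) a)) i)"
  shows "pdo_tau m d A = pdo_of_diffop (op_adj S) * pdo_poly_x (pcompose q [:0, - 1:])"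
proof -
  have x: "pcompose (Polynomial.monom 1 a) [:0, - 1:] = Polynomial.monom ((- 1) ^ a) a" for a :: nat
    by (induction a) (simp_all add: monom_Suc pcompose_pCons monom_0 one_pCons smult_monom)
  have term_eq: "pdo_monom c 0 (int i) * pdo_monom ((- 1) ^ a) (int a) 0 =
      pdo_of_diffop (op_adj (Polynomial.monom (to_fract (Polynomial.monom c a)) i))" for c i a
  proof -
    have "Polynomial.monom (to_fract (Polynomial.monom c a)) i =
        op_mult [:to_fract (Polynomial.monom 1 a):] (const_op (Polynomial.monom c i))"
      unfolding op_mult_const_left
      by (rule poly_eqI) (auto simp: smult_monom simp flip: to_fract_mult)
    then have "pdo_of_diffop (op_adj (Polynomial.monom (to_fract (Polynomial.monom c a)) i)) =
        pdo_of_diffop (const_op (Polynomial.monom c i)) *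
        pdo_of_diffop [:to_fract (Polynomial.monom ((- 1) ^ a) a):]"
      by (simp only: op_adj_mult op_adj_const_op op_adj_const x pdo_of_diffop_mult)
    moreover have "pdo_of_diffop (const_op (Polynomial.monom c i)) = pdo_monom c 0 (int i)"
      by (rule pdo_eqI, rule fls_eqI) (auto simp: pdo_fls_of_diffop pdo_monom.rep_eq)
    moreover have "pdo_of_diffop [:to_fract (Polynomial.monom b a):] = pdo_monom b (int a) 0" for b
    proof (rule pdo_eqI, rule fls_eqI)
      fix s j
      show "fls_nth (pdo_fls (pdo_of_diffop [:to_fract (Polynomial.monom b a):]) s) j =
          fls_nth (pdo_fls (pdo_monom b (int a) 0) s) j"
        using poly_at_infinity_nth[of "Polynomial.monom b a" "- j"]
        by (auto simp: pdo_fls_of_diffop pdo_monom.rep_eq coeff_pCons split: nat.splits)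
    qed
    ultimately show ?thesis by simp
  qed
  have "pdo_tau m d A = pdo_of_diffop (op_adj (Polynomial.smult (to_fract q) S))"
    unfolding pdo_tau_def assms op_adj_sum pdo_of_diffop_sum term_eq ..
  then show ?thesis
    unfolding op_mult_const_left[symmetric] op_adj_mult op_adj_const pdo_of_diffop_mult pdo_poly_x_def .
qed

text \<open>A part \<open>conj_part p j\<close> with \<open>j \<ge> 1\<close> is positive exactly
  for \<open>j \<le> p 1\<close>. Finiteness of the counted sets matters, as \<open>card\<close>
  gives 0 for infinite ones.\<close>

lemma conj_part_conj_part_1:
  assumes "is_partition p"
  shows "conj_part (conj_part p) 1 = p 1"
proof -
  obtain N where N: "\<And>i. i \<ge> N \<Longrightarrow> p i = 0" using assms by (auto simp: is_partition_def)
  have mono: "p i \<le> p 1" if "1 \<le> i" for i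
    using that
  proof (induction i rule: dec_induct)
    case (step i)
    then show ?case using assms unfolding is_partition_def by (meson order_trans)
  qed simp
  have "1 \<le> conj_part p j \<longleftrightarrow> j \<le> p 1" if "1 \<le> j" for j
  proof -
    have "{i. 1 \<le> i \<and> j \<le> p i} \<subseteq> {..N}"
    proof
      fix i assume "i \<in> {i. 1 \<le> i \<and> j \<le> p i}"
      then have "p i \<noteq> 0" using that by auto
      then show "i \<in> {..N}" using N[of i] by (cases "N \<le> i") auto
    qed
    then have fin: "finite {i. 1 \<le> i \<and> j \<le> p i}" by (rule finite_subset) simp
    have "1 \<le> conj_part p j \<longleftrightarrow> {i. 1 \<le> i \<and> j \<le> p i} \<noteq> {}"
      using fin by (simp add: conj_part_def Suc_le_eq card_gt_0_iff)
    then show ?thesis using mono by (auto intro: order_trans)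
  qed
  then have "{j. 1 \<le> j \<and> 1 \<le> conj_part p j} = {1..p 1}" by auto
  then show ?thesis by (simp add: conj_part_def[of "conj_part p"])
qed

section \<open>The enlarged space and its Wronskians\<close>

lemma hat_space_vanishing:
  assumes "ln_branch l" "inj_on \<alpha> {1..n}" "\<And>i. i \<in> {1..n} \<Longrightarrow> \<alpha> i \<noteq> 0"
    and f: "f \<in> hat_space l n \<alpha> \<mu>" and "\<And>j::nat. f (x + of_nat j) = 0"
  shows "f y = 0"
proof -
  let ?I = "SIGMA i:{1..n}. {..<\<mu> i 1 + conj_part (\<mu> i) 1}"
  obtain c where c: "\<And>x. f x = (\<Sum>ip\<in>?I. c ip * hat_gen l \<alpha> ip x)"
    using f unfolding hat_space_eq_span by (rule span_family_coeffs[rotated]) auto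
  have "c ip = 0" if "ip \<in> ?I" for ip
    using that hat_gen_coeffs_0[OF assms(1-3), where m = "\<lambda>i. \<mu> i 1 + conj_part (\<mu> i) 1" and c = c and x = x
        and i = "fst ip" and p = "snd ip"] assms(5)
    by (auto simp: c)
  then show ?thesis by (simp add: c)
qed

lemma hat_space_killed:
  assumes "ln_branch l" "\<And>i. i \<in> {1..n} \<Longrightarrow> \<alpha> i \<noteq> 0" and f: "f \<in> hat_space l n \<alpha> \<mu>"
  shows "const_op_apply (hat_poly n \<alpha> (\<lambda>i. \<mu> i 1 + conj_part (\<mu> i) 1)) f x = 0"
proof -
  let ?I = "SIGMA i:{1..n}. {..<\<mu> i 1 + conj_part (\<mu> i) 1}" and ?P = "hat_poly n \<alpha> (\<lambda>i. \<mu> i 1 + conj_part (\<mu> i) 1)"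
  obtain c where c: "\<And>x. f x = (\<Sum>ip\<in>?I. c ip * hat_gen l \<alpha> ip x)"
    using f unfolding hat_space_eq_span by (rule span_family_coeffs[rotated]) auto
  have "const_op_apply ?P f x = (\<Sum>ip\<in>?I. c ip * const_op_apply ?P (hat_gen l \<alpha> ip) x)"
    unfolding const_op_apply_def c sum_distrib_left by (subst sum.swap) (simp add: algebra_simps)
  also have "\<dots> = 0"
    using assms(1,2) by (intro sum.neutral) (auto intro!: hat_poly_kills_gen)
  finally show ?thesis .
qed

lemma hat_space_continuous:
  assumes "f \<in> hat_space l n \<alpha> \<mu>"
  shows "continuous_on UNIV f"
proof -
  let ?I = "SIGMA i:{1..n}. {..<\<mu> i 1 + conj_part (\<mu> i) 1}"
  obtain c where c: "\<And>x. f x = (\<Sum>ip\<in>?I. c ip * hat_gen l \<alpha> ip x)"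
    using assms unfolding hat_space_eq_span by (rule span_family_coeffs[rotated]) auto
  have "f = (\<lambda>x. \<Sum>ip\<in>?I. c ip * hat_gen l \<alpha> ip x)" using c by blast
  moreover have "continuous_on UNIV (hat_gen l \<alpha> ip)" for ip
    by (cases ip) (auto simp: hat_gen_def quasi_exp_def intro!: continuous_intros)
  ultimately show ?thesis by (auto intro!: continuous_intros)
qed

lemma dim_hat_space:
  assumes "ln_branch l" "inj_on \<alpha> {1..n}" "\<And>i. i \<in> {1..n} \<Longrightarrow> \<alpha> i \<noteq> 0"
  shows "cfun.dim (hat_space l n \<alpha> \<mu>) = (\<Sum>i=1..n. \<mu> i 1 + conj_part (\<mu> i) 1)"
proof -
  let ?I = "SIGMA i:{1..n}. {..<\<mu> i 1 + conj_part (\<mu> i) 1}"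
  have "basis_family (hat_space l n \<alpha> \<mu>) ?I (hat_gen l \<alpha>)"
    unfolding hat_space_eq_span
  proof (rule basis_familyI)
    fix c ip assume "\<And>x. (\<Sum>ip\<in>?I. c ip * hat_gen l \<alpha> ip x) = 0" "ip \<in> ?I"
    then show "c ip = 0"
      using hat_gen_coeffs_0[OF assms, where m = "\<lambda>i. \<mu> i 1 + conj_part (\<mu> i) 1" and c = c and x = 0
        and i = "fst ip" and p = "snd ip"] by auto
  qed auto
  from basis_family_dim[OF this] show ?thesis by simp
qed

lemma continuous_discrete_wronskian:
  assumes "\<And>f. f \<in> set gs \<Longrightarrow> continuous_on UNIV f"
  shows "continuous_on UNIV (discrete_wronskian gs)"
proof -
  have shift: "continuous_on UNIV (\<lambda>x. (gs ! i) (x + of_nat j))" if "i < length gs" for i j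
    by (rule continuous_on_compose2[OF assms]) (use that in \<open>auto intro!: continuous_intros\<close>)
  have eq: "discrete_wronskian gs = (\<lambda>x. \<Sum>p\<in>{p. p permutes {0..<length gs}}.
      signof p * (\<Prod>i=0..<length gs. (gs ! i) (x + of_nat (p i))))"
  proof
    fix x
    show "discrete_wronskian gs x = (\<Sum>p\<in>{p. p permutes {0..<length gs}}.
      signof p * (\<Prod>i=0..<length gs. (gs ! i) (x + of_nat (p i))))"
      unfolding discrete_wronskian_def
      by (subst det_def'[where n = "length gs"]) (auto intro!: sum.cong prod.cong dest: permutes_in_image)
  qed
  show ?thesis
    unfolding eq by (intro continuous_intros shift) auto
qed

lemma discrete_wronskian_array_det:
  "discrete_wronskian gs x = array_det (length gs) (\<lambda>i j. (gs ! i) (x + of_nat j))"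
  by (simp add: discrete_wronskian_def array_det_def)

text \<open>Up to sign, deleting \<open>h\<^sub>a\<close> from the Wronskian leaves the cofactor of the last entry of its row, so
  the quotients form the last row of the inverse of the Casorati matrix.\<close>

lemma wronskian_quotient_pairing:
  fixes fs hs :: "(complex \<Rightarrow> complex) list" and \<phi> :: "nat \<Rightarrow> complex \<Rightarrow> complex"
  defines "N \<equiv> length fs + length hs"
  assumes nz: "\<And>x. discrete_wronskian (fs @ hs) x \<noteq> 0"
    and \<phi>: "\<phi> = (\<lambda>a x. discrete_wronskian (fs @ take a hs @ drop (Suc a) hs) (x + 1) /
      discrete_wronskian (fs @ hs) (x + 1))"
  shows "\<exists>\<psi>. (\<forall>m x. 1 \<le> m \<longrightarrow> m \<le> N \<longrightarrow>
      (\<Sum>i<N. ((fs @ hs) ! i) (x + of_nat m) * \<psi> i x) = (if m = N then 1 else 0)) \<and>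
    (\<forall>a<length hs. \<psi> (length fs + a) = (\<lambda>x. (- 1) ^ (length fs + a + (N - 1)) * \<phi> a x))"
proof -
  \<comment> \<open>The base point \<open>x + 1\<close> reflects the outer \<open>T\<close> in
    \<open>\<phi>\<close>; column \<open>m - 1\<close> thus holds the values at
    \<open>x + m\<close>.\<close>
  define C where "C = (\<lambda>x. Matrix.mat N N (\<lambda>(i, j). ((fs @ hs) ! i) (x + 1 + of_nat j)))"
  define \<psi> where "\<psi> = (\<lambda>i x. cofactor (C x) i (N - 1) / Determinant.det (C x))"
  have C: "C x \<in> carrier_mat N N" for x by (simp add: C_def)
  have detC: "Determinant.det (C x) = discrete_wronskian (fs @ hs) (x + 1)" for x
    by (simp add: C_def discrete_wronskian_def N_def)
  have "(\<Sum>i<N. ((fs @ hs) ! i) (x + of_nat m) * \<psi> i x) = (if m = N then 1 else 0)"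
    if m: "1 \<le> m" "m \<le> N" for m x
  proof -
    have "(\<Sum>i<N. ((fs @ hs) ! i) (x + of_nat m) * \<psi> i x) * Determinant.det (C x) =
        (\<Sum>i<N. cofactor (C x) i (N - 1) * ((fs @ hs) ! i) (x + of_nat m))"
      unfolding sum_distrib_right using nz by (intro sum.cong) (auto simp: \<psi>_def detC)
    \<comment> \<open>The cofactors of the last column form the last row of the adjugate, and
      adjugate times matrix is the determinant times the identity.\<close>
    also have "\<dots> = (adj_mat (C x) * C x) $$ (N - 1, m - 1)"
      using m C[of x] by (auto simp: adj_mat_def scalar_prod_def C_def atLeast0LessThan of_nat_diff intro!: sum.cong)
    also have "\<dots> = (if m = N then Determinant.det (C x) else 0)"
      unfolding adj_mat(3)[OF C] using m by auto
    finally show ?thesis using nz by (auto simp: detC split: if_splits)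
  qed
  moreover have "\<psi> (length fs + a) = (\<lambda>x. (- 1) ^ (length fs + a + (N - 1)) * \<phi> a x)" if a: "a < length hs" for a
  proof
    fix x
    let ?gs = "fs @ take a hs @ drop (Suc a) hs"
    have len: "length ?gs = N - 1" using a by (simp add: N_def)
    \<comment> \<open>Omitting \<open>hs ! a\<close> skips the index \<open>length fs + a\<close>,
      which is the row removed by \<open>mat_delete\<close>.\<close>
    have nth: "?gs ! i = (fs @ hs) ! (if i < length fs + a then i else Suc i)" if "i < N - 1" for i
      using that a by (auto simp: nth_append N_def Suc_diff_le)
    have "mat_delete (C x) (length fs + a) (N - 1) =
        Matrix.mat (length ?gs) (length ?gs) (\<lambda>(i, j). (?gs ! i) (x + 1 + of_nat j))"
      unfolding len by (rule eq_matI) (auto simp: mat_delete_def C_def nth)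
    then show "\<psi> (length fs + a) x = (- 1) ^ (length fs + a + (N - 1)) * \<phi> a x"
      by (simp add: \<psi>_def cofactor_def \<phi> detC discrete_wronskian_def)
  qed
  ultimately show ?thesis by (intro exI[of _ \<psi>]) simp
qed

lemma span_sign_eq:
  assumes "\<And>a. a \<in> A \<Longrightarrow> \<psi> a = (\<lambda>x. (- 1) ^ k a * \<phi> a x)"
  shows "cfun.span (\<phi> ` A) = cfun.span (\<psi> ` A)"
proof -
  have 1: "\<psi> a \<in> cfun.span (\<phi> ` A)" if "a \<in> A" for a
    unfolding assms[OF that] using that by (intro cfun.span_scale cfun.span_base) auto
  have 2: "\<phi> a \<in> cfun.span (\<psi> ` A)" if "a \<in> A" for a
  proof -
    have "(- 1) ^ k a * (- 1) ^ k a = (1 :: complex)" by (simp flip: power_mult_distrib)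
    then have "\<phi> a = (\<lambda>x. (- 1) ^ k a * \<psi> a x)"
      unfolding assms[OF that] by (simp add: fun_eq_iff mult.assoc [symmetric])
    moreover have "(\<lambda>x. (- 1) ^ k a * \<psi> a x) \<in> cfun.span (\<psi> ` A)"
      using that by (intro cfun.span_scale cfun.span_base) auto
    ultimately show ?thesis by simp
  qed
  show ?thesis unfolding cfun.span_eq using 1 2 by auto
qed

text \<open>This explains the powers allowed in \<open>hat_space\<close>: the multiplicity of the
  root \<open>\<alpha> i\<close> in the product is
  \<open>\<mu> i 1 + conj_part (\<mu> i) 1\<close>.\<close>

lemma p_poly_mult_conj:
  assumes "\<And>i. i \<in> {1..n} \<Longrightarrow> is_partition (\<mu> i)"
  shows "p_poly n \<alpha> \<mu> * p_poly n \<alpha> (\<lambda>i. conj_part (\<mu> i)) = hat_poly n \<alpha> (\<lambda>i. \<mu> i 1 + conj_part (\<mu> i) 1)"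
  unfolding p_poly_def hat_poly_def prod.distrib[symmetric]
  using conj_part_conj_part_1[OF assms] by (intro prod.cong) (auto simp: power_add mult.commute)

text \<open>Instantiates \<open>factorization_setup\<close>; its \<open>\<psi>\<close> differ from
  the quotients defining \<open>W\<close> by signs only, which leave the span unchanged.\<close>

lemma quotient_dual_fund_diffop:
  assumes l: "ln_branch l" and \<alpha>: "inj_on \<alpha> {1..n}" "\<And>i. i \<in> {1..n} \<Longrightarrow> \<alpha> i \<noteq> 0"
    and S: "is_fund_diffop U S" and W: "quotient_dual l n \<alpha> \<mu> U W"
  obtains Q where "op_mult Q S = const_op (hat_poly n \<alpha> (\<lambda>i. \<mu> i 1 + conj_part (\<mu> i) 1))"
    and "fund_diffop W = op_adj Q"
proof -
  let ?P = "hat_poly n \<alpha> (\<lambda>i. \<mu> i 1 + conj_part (\<mu> i) 1)"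
  obtain fs hs where U: "basis_family U {..<length fs} (\<lambda>i. fs ! i)"
    and hat: "basis_family (hat_space l n \<alpha> \<mu>) {..<length (fs @ hs)} (\<lambda>i. (fs @ hs) ! i)"
    and W: "W = {\<lambda>x. f (- x) | f. f \<in> cfun.span ((\<lambda>a x. discrete_wronskian (fs @ take a hs @ drop (Suc a) hs) (x + 1) /
                        discrete_wronskian (fs @ hs) (x + 1)) ` {..<length hs})}"
    using W unfolding quotient_dual_def Let_def by blast
  define d e where "d = length fs" and "e = length hs"
  define g where "g = (\<lambda>i. (fs @ hs) ! i)"
  define \<phi> where "\<phi> = (\<lambda>a x. discrete_wronskian (fs @ take a hs @ drop (Suc a) hs) (x + 1) /
                        discrete_wronskian (fs @ hs) (x + 1))"
  have hat: "basis_family (hat_space l n \<alpha> \<mu>) {..<d + e} g"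
    using hat by (simp add: g_def d_def e_def)
  have g: "g i \<in> hat_space l n \<alpha> \<mu>" if "i < d + e" for i
    using hat that by (auto simp: basis_family_def intro: cfun.span_base)
  have deg: "degree ?P = d + e"
    using dim_hat_space[OF l \<alpha>, of \<mu>] basis_family_dim[OF hat] hat_poly_monic(2) by simp
  have kill: "const_op_apply ?P f x = 0" if "f \<in> hat_space l n \<alpha> \<mu>" for f x
    using hat_space_killed[OF l \<alpha>(2) that] .
  \<comment> \<open>A null vector gives an element of \<open>hat_space\<close> with
    \<open>d + e\<close> consecutive zeros. This is the order of \<open>?P\<close>, so the zeros
    spread along a ray and the element is 0. No point is excluded, as constant coefficients have no
    poles.\<close>
  have nonsing: "array_det (d + e) (\<lambda>i j. g i (x + of_nat j)) \<noteq> 0" for x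
  proof
    assume "array_det (d + e) (\<lambda>i j. g i (x + of_nat j)) = 0"
    then have "array_det (d + e) (\<lambda>i j. g j (x + of_nat i)) = 0"
      using array_det_transpose[of "d + e" "\<lambda>i j. g i (x + of_nat j)"] by simp
    then obtain v k where v: "k < d + e" "v k \<noteq> 0" "\<And>i. i < d + e \<Longrightarrow> (\<Sum>j<d + e. g j (x + of_nat i) * v j) = 0"
      unfolding array_det_eq_0_iff by auto
    define f where "f = (\<Sum>j<d + e. (\<lambda>x. v j * g j x))"
    have f: "f x = (\<Sum>j<d + e. v j * g j x)" for x by (simp add: f_def sum_fun_apply)
    have "f \<in> cfun.span (g ` {..<d + e})"
      unfolding f_def by (intro cfun.span_sum cfun.span_scale cfun.span_base) auto
    then have f_hat: "f \<in> hat_space l n \<alpha> \<mu>" using hat by (simp add: basis_family_def)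
    have "f (x + of_nat j) = 0" for j
    proof (rule recurrence_zero[where u = "\<lambda>j. f (x + of_nat j)" and d = "d + e" and s = "\<lambda>i m. coeff ?P i"])
      show "(\<Sum>i\<le>d + e. coeff ?P i * f (x + of_nat (m + i))) = 0" for m
        using kill[OF f_hat, of "x + of_nat m"] unfolding const_op_apply_def deg by (simp add: add.assoc)
      show "coeff ?P (d + e) = 1" using hat_poly_monic(1) deg by metis
      show "f (x + of_nat j) = 0" if "j < d + e" for j
        using v(3)[OF that] by (simp add: f mult.commute)
    qed
    then have "f y = 0" for y using hat_space_vanishing[of l \<alpha> n f \<mu> x y] l \<alpha> f_hat by blast
    then have "v k = 0"
      using v(1) by (intro basis_family_coeffs_0[OF hat, where c = v]) (simp_all add: f)
    with v show False by simp
  qed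
  have wronskian: "discrete_wronskian (fs @ hs) x \<noteq> 0" for x
    using nonsing[of x] by (simp add: discrete_wronskian_array_det d_def e_def g_def)
  obtain \<psi> where pair: "\<forall>m x. 1 \<le> m \<longrightarrow> m \<le> d + e \<longrightarrow>
      (\<Sum>i<d + e. ((fs @ hs) ! i) (x + of_nat m) * \<psi> i x) = (if m = d + e then 1 else 0)"
    and \<psi>_all: "\<forall>a<e. \<psi> (d + a) = (\<lambda>x. (- 1) ^ (d + a + (d + e - 1)) * \<phi> a x)"
    using wronskian_quotient_pairing[OF wronskian \<phi>_def] unfolding d_def e_def by (elim exE conjE)
  have \<psi>: "\<psi> (d + a) = (\<lambda>x. (- 1) ^ (d + a + (d + e - 1)) * \<phi> a x)" if "a < e" for a
    using \<psi>_all that by blast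
  interpret factorization_setup g \<psi> d e S ?P
  proof
    show "lead_coeff ?P = 1" by (rule hat_poly_monic)
    show "degree ?P = d + e" by (rule deg)
    show "const_op_apply ?P (g i) x = 0" if "i < d + e" for i x using kill g that by blast
    show "array_det (d + e) (\<lambda>i j. g i (x + of_nat j)) \<noteq> 0" for x by (rule nonsing)
    show "lead_coeff S = 1" using S unfolding is_fund_diffop_def by blast
    show "degree S = d" using S basis_family_dim[OF U] by (simp add: is_fund_diffop_def d_def)
    show "diffop_apply S (g i) x = 0" if "i < d" "op_regular S x" for i x
    proof -
      have "fs ! i \<in> U" using U that by (auto simp: basis_family_def d_def intro: cfun.span_base)
      then show ?thesis using S that by (simp add: is_fund_diffop_def g_def nth_append d_def)
    qed
    show "(\<Sum>i<d + e. g i (x + of_nat m) * \<psi> i x) = (if m = d + e then 1 else 0)"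
      if "1 \<le> m" "m \<le> d + e" for m x unfolding g_def using that pair by blast
    show "continuous_on UNIV (\<psi> (d + a))" if a: "a < e" for a
    proof -
      have all: "continuous_on UNIV f" if f: "f \<in> set (fs @ hs)" for f
      proof -
        obtain i where i: "i < length (fs @ hs)" "(fs @ hs) ! i = f"
          using f unfolding in_set_conv_nth by (elim exE conjE)
        then have "i < d + e" by (simp only: d_def e_def length_append)
        from hat_space_continuous[OF g[OF this]] show ?thesis unfolding g_def i(2) .
      qed
      have sub: "set (fs @ take a hs @ drop (Suc a) hs) \<subseteq> set (fs @ hs)"
        using set_take_subset[of a hs] set_drop_subset[of "Suc a" hs] by auto
      have "continuous_on UNIV (discrete_wronskian (fs @ take a hs @ drop (Suc a) hs))"
        by (rule continuous_discrete_wronskian, rule all, erule subsetD[OF sub])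
      moreover have "continuous_on UNIV (discrete_wronskian (fs @ hs))"
        by (rule continuous_discrete_wronskian, rule all)
      moreover have "continuous_on UNIV (\<lambda>x. F (x + 1))" if "continuous_on UNIV F" for F :: "complex \<Rightarrow> complex"
        by (rule continuous_on_compose2[OF that]) (auto intro!: continuous_intros)
      ultimately have "continuous_on UNIV (\<phi> a)"
        unfolding \<phi>_def using wronskian by (intro continuous_on_divide) auto
      then show ?thesis unfolding \<psi>[OF a] by (intro continuous_intros)
    qed
  qed
  obtain Q where Q: "op_mult Q S = const_op ?P" using factorization by blast
  have "W = cfun.span ((\<lambda>a x. \<phi> a (- x)) ` {..<e})"
    unfolding W \<phi>_def[symmetric] e_def[symmetric] by (rule reflect_span_eq)
  also have "\<dots> = cfun.span ((\<lambda>a x. \<psi> (d + a) (- x)) ` {..<e})"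
    by (rule span_sign_eq[where k = "\<lambda>a. d + a + (d + e - 1)"]) (use \<psi> in auto)
  finally have "fund_diffop W = op_adj Q" using fund_diffop_W[OF Q] by (simp add: W_def)
  with Q show ?thesis by (rule that)
qed

theorem theorem5p2:
  fixes l :: "complex \<Rightarrow> complex"
    and k n :: nat
    and z \<alpha> :: "nat \<Rightarrow> complex"
    and lam \<mu> :: "nat \<Rightarrow> nat \<Rightarrow> nat"
    and V U W :: "(complex \<Rightarrow> complex) set"
    and A :: "nat \<Rightarrow> nat \<Rightarrow> complex"
  assumes "ln_branch l"
    and "admissible_data k z lam n \<alpha> \<mu>"
    and "quasi_polynomial_space k z lam n \<alpha> \<mu> V"
    and "bar_D_coeffs V (p_poly n \<alpha> \<mu>) (total_length n \<mu>) (total_length k lam) A"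
    and "bispectral_dual l k z lam n \<alpha> \<mu> A U"
    and "quotient_dual l n \<alpha> \<mu> U W"
  shows "pdo_invertible (fund_pdo_quasi_poly k z lam n \<alpha> \<mu> A) \<and>
         fund_pdo_quasi_exp n \<alpha> (\<lambda>i. conj_part (\<mu> i)) W =
         pdo_inverse (fund_pdo_quasi_poly k z lam n \<alpha> \<mu> A)"
proof -
  let ?p = "pdo_poly_T (p_poly n \<alpha> \<mu>)" and ?p' = "pdo_poly_T (p_poly n \<alpha> (\<lambda>i. conj_part (\<mu> i)))"
  let ?q = "pdo_poly_x (pcompose (q_poly k z lam) [:0, - 1:])"
  let ?V = "fund_pdo_quasi_poly k z lam n \<alpha> \<mu> A" and ?W = "fund_pdo_quasi_exp n \<alpha> (\<lambda>i. conj_part (\<mu> i)) W"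
  have \<alpha>: "inj_on \<alpha> {1..n}" "\<And>i. i \<in> {1..n} \<Longrightarrow> \<alpha> i \<noteq> 0"
    and \<mu>: "\<And>i. i \<in> {1..n} \<Longrightarrow> is_partition (\<mu> i)"
    using assms(2) by (auto simp: admissible_data_def nonzero_partition_def)
  obtain S where S: "is_fund_diffop U S" and qS: "Polynomial.smult (to_fract (q_poly k z lam)) S =
        (\<Sum>i\<le>total_length n \<mu>. \<Sum>a\<le>total_length k lam.
           Polynomial.monom (to_fract (Polynomial.monom (A i a) a)) i)"
    using assms(5) by (auto simp: bispectral_dual_def)
  obtain Q where Q: "op_mult Q S = const_op (hat_poly n \<alpha> (\<lambda>i. \<mu> i 1 + conj_part (\<mu> i) 1))"
    and W: "fund_diffop W = op_adj Q"
    using quotient_dual_fund_diffop[OF assms(1) \<alpha> S assms(6)] by blast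
  have "q_poly k z lam \<noteq> 0" "p_poly n \<alpha> \<mu> \<noteq> 0" "p_poly n \<alpha> (\<lambda>i. conj_part (\<mu> i)) \<noteq> 0"
    by (auto simp: q_poly_def p_poly_def)
  moreover from this(1) have "pcompose (q_poly k z lam) [:0, - 1:] \<noteq> 0"
    using pcompose_eq_0[of "q_poly k z lam" "[:0, - 1:]"] by auto
  ultimately have inv: "pdo_inverse ?p * ?p = 1" "?p' * pdo_inverse ?p' = 1" "?q * pdo_inverse ?q = 1"
    by (simp_all add: pdo_poly_T_inverse pdo_poly_x_inverse pdo_right_inverse)
  have V_eq: "?V = pdo_inverse ?p * pdo_of_diffop (op_adj S)"
    unfolding fund_pdo_quasi_poly_def pdo_tau_eq[OF qS] using inv(3) by (simp add: mult.assoc)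
  have W_eq: "?W = pdo_of_diffop (op_adj Q) * pdo_inverse ?p'"
    by (simp add: fund_pdo_quasi_exp_def W)
  have hat: "p_poly n \<alpha> \<mu> * p_poly n \<alpha> (\<lambda>i. conj_part (\<mu> i)) = hat_poly n \<alpha> (\<lambda>i. \<mu> i 1 + conj_part (\<mu> i) 1)"
    using \<mu> by (rule p_poly_mult_conj)
  have adj: "pdo_of_diffop (op_adj S) * pdo_of_diffop (op_adj Q) = ?p * ?p'"
    unfolding pdo_of_diffop_mult[symmetric] op_adj_mult[symmetric] Q op_adj_const_op
      pdo_poly_T_const_op[symmetric] pdo_poly_T_mult[symmetric] hat ..
  have "?V * ?W = pdo_inverse ?p * (pdo_of_diffop (op_adj S) * pdo_of_diffop (op_adj Q)) * pdo_inverse ?p'"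
    unfolding V_eq W_eq by (simp only: mult.assoc)
  also have "\<dots> = (pdo_inverse ?p * ?p) * (?p' * pdo_inverse ?p')"
    unfolding adj by (simp only: mult.assoc)
  also have "\<dots> = 1" using inv by simp
  finally have VW: "?V * ?W = 1" .
  \<comment> \<open>The single product suffices: a right inverse is two-sided here, and this
    determines \<open>pdo_inverse\<close>.\<close>
  then show ?thesis
    using pdo_right_inverse[OF VW] pdo_inverse_eq[OF VW] by (auto simp: pdo_invertible_def)
qed

end
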